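(* Let $s\ge0$ be real and, for $r>0$ and $z\in\mathbf C^d$, let $$\omega_{1,r,s}(z)=\begin{cases}e^{r(\log\langle z\rangle)^{\frac1{1-2s}}},&s<\frac12,\\ e^{\frac{|z|^2}2-r|z|^{\frac1s}},&s\ge\frac12.\end{cases}$$ Consider the map $\mathcal P:\sum_{\alpha}c_\alpha e_\alpha\mapsto\big(z\mapsto\sum_{\alpha}c_\alpha z^\alpha/\sqrt{\alpha!}\big)$ from $\boldsymbol{\mathcal A}_0(\mathbf C^d)$ (finite sums) to $A(\mathbf C^d)$. Then the following is true: (1) $\mathcal P$ extends uniquely to a homeomorphism from $\boldsymbol{\mathcal A}_s(\mathbf C^d)$ to $$\{F\in A(\mathbf C^d)\,;\,|F(z)|\lesssim\omega_{1,r,s}(z)\ \text{for some } r>0\};$$ (2) if in addition $s\notin\{0,\frac12\}$, then $\mathcal P$ extends uniquely to a homeomorphism from $\boldsymbol{\mathcal A}_{0,s}(\mathbf C^d)$ to $$\{F\in A(\mathbf C^d)\,;\,|F(z)|\lesssim\omega_{1,r,s}(z)\ \text{for every } r>0\}.$$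
   Context: $A(\mathbf C^d)$ is the set of entire functions on $\mathbf C^d$; $\langle z\rangle=(1+|z|^2)^{1/2}$; $f\lesssim g$ means $f\le cg$ for some constant $c>0$; $e_\alpha(z)=z^\alpha/\sqrt{\alpha!}$, $\alpha\in\mathbf N^d$. For $s>0$ and $r>0$ let $\vartheta_{r,s}(\alpha)=e^{r|\alpha|^{1/(2s)}}$, and for $p\in(0,\infty]$ let $\ell^p_{[\vartheta]}(\mathbf N^d)$ be the quasi-Banach space of complex sequences with $\|\{c_\alpha\vartheta(\alpha)\}\|_{\ell^p}<\infty$. Let $\ell_{0,s}(\mathbf N^d)=\bigcap_{r>0}\ell^p_{[\vartheta_{r,s}]}(\mathbf N^d)$ (projective limit topology) and $\ell_s(\mathbf N^d)=\bigcup_{r>0}\ell^p_{[\vartheta_{r,s}]}(\mathbf N^d)$ (inductive limit topology); they are independent of $p$. $\ell_0(\mathbf N^d)$ is the space of sequences with finitely many nonzero entries, with the inductive limit topology of the finite-dimensional spaces $\{c_\alpha=0\text{ when }|\alpha|>N\}$, $N\ge0$. The spaces $\boldsymbol{\mathcal A}_{0,s}(\mathbf C^d)$ and $\boldsymbol{\mathcal A}_s(\mathbf C^d)$ consist of all formal power series $\sum_\alpha c_\alpha e_\alpha$ with $\{c_\alpha\}$ in $\ell_{0,s}(\mathbf N^d)$ and $\ell_s(\mathbf N^d)$, respectively, with topologies transported from the sequence spaces. For a family $\{\omega_r\}_{r>0}$ of positive weights on $\mathbf C^d$, the set of $F\in A(\mathbf C^d)$ with $|F|\lesssim\omega_r$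 for some (for every) $r>0$ carries the inductive (projective) limit topology of the Banach spaces $\{F\in A(\mathbf C^d)\,;\,\sup_z|F(z)|/\omega_r(z)<\infty\}$. *)

theory Defs
  imports "HOL-Analysis.Analysis"
begin

section \<open>Limits of topologies on spaces of complex-valued functions\<close>

text \<open>
  Sequences indexed by multi-indices and functions on \<open>\<complex>\<^sup>d\<close> are both of type
  \<^typ>\<open>'i \<Rightarrow> complex\<close> with pointwise vector space operations, and all spaces below are
  linear subspaces of such types, topologised by values of \<^typ>\<open>('i \<Rightarrow> complex) topology\<close>.
\<close>

definition abs_convex :: "('i \<Rightarrow> complex) set \<Rightarrow> bool" where
  "abs_convex V \<longleftrightarrow>
     (\<forall>f\<in>V. \<forall>g\<in>V. \<forall>a b. norm a + norm b \<le> 1 \<longrightarrow> (\<lambda>i. a * f i + b * g i) \<in> V)"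

text \<open>The topology of a (quasi-)normed space with carrier \<open>X\<close> and (quasi-)norm \<open>N\<close>.\<close>

definition norm_topology ::
    "('i \<Rightarrow> complex) set \<Rightarrow> (('i \<Rightarrow> complex) \<Rightarrow> real) \<Rightarrow> ('i \<Rightarrow> complex) topology" where
  "norm_topology X N = topology (\<lambda>U. U \<subseteq> X \<and>
     (\<forall>f\<in>U. \<exists>\<epsilon>>0. \<forall>g\<in>X. N (\<lambda>i. g i - f i) < \<epsilon> \<longrightarrow> g \<in> U))"

text \<open>
  The locally convex inductive limit of a directed family of spaces: the finest locally convex
  topology on the union for which all inclusions are continuous. A base of neighbourhoods of the
  origin consists of the absolutely convex sets whose trace on each step is a neighbourhood of
  the origin in that step.
\<close>

definition ind_lim_nbhd ::
    "'r set \<Rightarrow> ('r \<Rightarrow> ('i \<Rightarrow> complex) topology) \<Rightarrow> ('i \<Rightarrow> complex) set \<Rightarrow> bool" where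
  "ind_lim_nbhd R T V \<longleftrightarrow> V \<subseteq> (\<Union>r\<in>R. topspace (T r)) \<and> abs_convex V \<and>
     (\<forall>r\<in>R. \<exists>W. openin (T r) W \<and> (\<lambda>_. 0) \<in> W \<and> W \<subseteq> V)"

definition inductive_limit_topology ::
    "'r set \<Rightarrow> ('r \<Rightarrow> ('i \<Rightarrow> complex) topology) \<Rightarrow> ('i \<Rightarrow> complex) topology" where
  "inductive_limit_topology R T = topology (\<lambda>U. U \<subseteq> (\<Union>r\<in>R. topspace (T r)) \<and>
     (\<forall>f\<in>U. \<exists>V. ind_lim_nbhd R T V \<and> (\<forall>g\<in>V. (\<lambda>i. f i + g i) \<in> U)))"

text \<open>The coarsest topology on the intersection for which all inclusions are continuous.\<close>

definition projective_limit_topology ::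
    "'r set \<Rightarrow> ('r \<Rightarrow> ('i \<Rightarrow> complex) topology) \<Rightarrow> ('i \<Rightarrow> complex) topology" where
  "projective_limit_topology R T = topology_generated_by
     {W \<inter> (\<Inter>r\<in>R. topspace (T r)) | W. \<exists>r\<in>R. openin (T r) W}"

lemma istopology_norm_topology:
  fixes X :: "('i \<Rightarrow> complex) set" and N :: "('i \<Rightarrow> complex) \<Rightarrow> real"
  shows "istopology (\<lambda>U. U \<subseteq> X \<and> (\<forall>f\<in>U. \<exists>\<epsilon>>0::real. \<forall>g\<in>X. N (\<lambda>i. g i - f i) < \<epsilon> \<longrightarrow> g \<in> U))"
  (is "istopology ?P")
proof -
  have "?P (S \<inter> T)" if S: "?P S" and T: "?P T" for S T
  proof (intro conjI ballI)
    show "S \<inter> T \<subseteq> X" using S by blast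
    fix f assume "f \<in> S \<inter> T"
    with S T have "f \<in> S" "f \<in> T" by auto
    obtain d where d: "d > 0" "\<forall>g\<in>X. N (\<lambda>i. g i - f i) < d \<longrightarrow> g \<in> S"
      using S \<open>f \<in> S\<close> by meson
    obtain e where e: "e > 0" "\<forall>g\<in>X. N (\<lambda>i. g i - f i) < e \<longrightarrow> g \<in> T"
      using T \<open>f \<in> T\<close> by meson
    show "\<exists>\<epsilon>>0. \<forall>g\<in>X. N (\<lambda>i. g i - f i) < \<epsilon> \<longrightarrow> g \<in> S \<inter> T"
      using d e by (intro exI[of _ "min d e"]) simp
  qed
  moreover have "?P (\<Union>K)" if K: "\<forall>S\<in>K. ?P S" for K
  proof (intro conjI ballI)
    show "\<Union>K \<subseteq> X" using K by blast
    fix f assume "f \<in> \<Union>K"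
    then obtain S where S: "S \<in> K" "f \<in> S" by blast
    then obtain e where "e > 0" "\<forall>g\<in>X. N (\<lambda>i. g i - f i) < e \<longrightarrow> g \<in> S"
      using K by meson
    with S(1) show "\<exists>\<epsilon>>0. \<forall>g\<in>X. N (\<lambda>i. g i - f i) < \<epsilon> \<longrightarrow> g \<in> \<Union>K"
      by (intro exI[of _ e]) blast
  qed
  ultimately show ?thesis unfolding istopology_def by simp
qed

lemma ind_lim_nbhd_Int:
  assumes "ind_lim_nbhd R T V" "ind_lim_nbhd R T W"
  shows "ind_lim_nbhd R T (V \<inter> W)"
  unfolding ind_lim_nbhd_def
proof (intro conjI ballI)
  show "V \<inter> W \<subseteq> (\<Union>r\<in>R. topspace (T r))" using assms unfolding ind_lim_nbhd_def by blast
  show "abs_convex (V \<inter> W)" using assms unfolding ind_lim_nbhd_def abs_convex_def by blast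
  fix r assume "r \<in> R"
  then obtain A B where "openin (T r) A" "(\<lambda>_. 0) \<in> A" "A \<subseteq> V"
    "openin (T r) B" "(\<lambda>_. 0) \<in> B" "B \<subseteq> W"
    using assms unfolding ind_lim_nbhd_def by meson
  then show "\<exists>C. openin (T r) C \<and> (\<lambda>_. 0) \<in> C \<and> C \<subseteq> V \<inter> W"
    by (intro exI[of _ "A \<inter> B"]) auto
qed

lemma istopology_inductive_limit:
  "istopology (\<lambda>U. U \<subseteq> (\<Union>r\<in>R. topspace (T r)) \<and>
     (\<forall>f\<in>U. \<exists>V. ind_lim_nbhd R T V \<and> (\<forall>g\<in>V. (\<lambda>i. f i + g i) \<in> U)))"
  (is "istopology ?P")
proof -
  have "?P (A \<inter> B)" if A: "?P A" and B: "?P B" for A B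
  proof (intro conjI ballI)
    show "A \<inter> B \<subseteq> (\<Union>r\<in>R. topspace (T r))" using A by blast
    fix f assume "f \<in> A \<inter> B"
    then have "f \<in> A" "f \<in> B" by auto
    obtain V where V: "ind_lim_nbhd R T V" "\<forall>g\<in>V. (\<lambda>i. f i + g i) \<in> A"
      using A \<open>f \<in> A\<close> by meson
    obtain W where W: "ind_lim_nbhd R T W" "\<forall>g\<in>W. (\<lambda>i. f i + g i) \<in> B"
      using B \<open>f \<in> B\<close> by meson
    show "\<exists>V. ind_lim_nbhd R T V \<and> (\<forall>g\<in>V. (\<lambda>i. f i + g i) \<in> A \<inter> B)"
      using ind_lim_nbhd_Int[OF V(1) W(1)] V(2) W(2) by (intro exI[of _ "V \<inter> W"]) simp
  qed
  moreover have "?P (\<Union>K)" if K: "\<forall>S\<in>K. ?P S" for K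
  proof (intro conjI ballI)
    show "\<Union>K \<subseteq> (\<Union>r\<in>R. topspace (T r))" using K by blast
    fix f assume "f \<in> \<Union>K"
    then obtain S where S: "S \<in> K" "f \<in> S" by blast
    then obtain V where "ind_lim_nbhd R T V" "\<forall>g\<in>V. (\<lambda>i. f i + g i) \<in> S"
      using K by meson
    with S(1) show "\<exists>V. ind_lim_nbhd R T V \<and> (\<forall>g\<in>V. (\<lambda>i. f i + g i) \<in> \<Union>K)"
      by (intro exI[of _ V]) blast
  qed
  ultimately show ?thesis unfolding istopology_def by simp
qed

lemmas openin_norm_topology =
  topology_inverse'[OF istopology_norm_topology, folded norm_topology_def]

lemmas openin_inductive_limit =
  topology_inverse'[OF istopology_inductive_limit, folded inductive_limit_topology_def]

lemma topspace_norm_topology [simp]: "topspace (norm_topology X N) = X"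
proof (rule subset_antisym)
  show "topspace (norm_topology X N) \<subseteq> X"
    using openin_topspace[of "norm_topology X N"] by (simp only: openin_norm_topology)
  have "openin (norm_topology X N) X"
    unfolding openin_norm_topology using zero_less_one by blast
  then show "X \<subseteq> topspace (norm_topology X N)" by (rule openin_subset)
qed

lemma topspace_inductive_limit:
  assumes zero: "\<And>r. r \<in> R \<Longrightarrow> (\<lambda>_. 0) \<in> topspace (T r)"
    and lin: "\<And>f g a b. \<lbrakk>f \<in> (\<Union>r\<in>R. topspace (T r)); g \<in> (\<Union>r\<in>R. topspace (T r))\<rbrakk>
                \<Longrightarrow> (\<lambda>i. a * f i + b * g i) \<in> (\<Union>r\<in>R. topspace (T r))"
  shows "topspace (inductive_limit_topology R T) = (\<Union>r\<in>R. topspace (T r))"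
    (is "?L = ?E")
proof (rule subset_antisym)
  show "?L \<subseteq> ?E"
    using openin_topspace[of "inductive_limit_topology R T"]
    by (simp only: openin_inductive_limit)
  have "\<exists>W. openin (T r) W \<and> (\<lambda>_. 0) \<in> W \<and> W \<subseteq> ?E" if "r \<in> R" for r
    using zero[OF that] that openin_topspace by blast
  moreover have "abs_convex ?E"
    unfolding abs_convex_def by (intro ballI allI impI) (rule lin)
  ultimately have V: "ind_lim_nbhd R T ?E" unfolding ind_lim_nbhd_def by blast
  have "(\<lambda>i. f i + g i) \<in> ?E" if "f \<in> ?E" "g \<in> ?E" for f g
    using lin[OF that, of 1 1] by simp
  with V have "openin (inductive_limit_topology R T) ?E"
    unfolding openin_inductive_limit by blast
  then show "?E \<subseteq> ?L" by (rule openin_subset)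
qed

lemma topspace_projective_limit:
  assumes "R \<noteq> {}"
  shows "topspace (projective_limit_topology R T) = (\<Inter>r\<in>R. topspace (T r))"
    (is "_ = ?I")
proof -
  obtain r where "r \<in> R" using assms by blast
  then have "?I = topspace (T r) \<inter> ?I" by (rule Int_absorb1[OF INT_lower, symmetric])
  with \<open>r \<in> R\<close> have "?I \<in> {W \<inter> ?I | W. \<exists>r\<in>R. openin (T r) W}"
    using openin_topspace[of "T r"] by (intro CollectI exI[of _ "topspace (T r)"]) auto
  then have "?I \<subseteq> \<Union>{W \<inter> ?I | W. \<exists>r\<in>R. openin (T r) W}" by (rule Union_upper)
  moreover have "\<Union>{W \<inter> ?I | W. \<exists>r\<in>R. openin (T r) W} \<subseteq> ?I" by blast
  ultimately show ?thesis
    unfolding projective_limit_topology_def topology_generated_by_topspace by simp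
qed

section \<open>Entire functions and weighted spaces\<close>

text \<open>Entire: complex differentiable everywhere, i.e. with complex-linear total derivative.\<close>

definition entire :: "(complex ^ 'd::finite \<Rightarrow> complex) \<Rightarrow> bool" where
  "entire F \<longleftrightarrow> (\<forall>z. \<exists>D. (F has_derivative D) (at z) \<and> (\<forall>a v. D (a *s v) = a * D v))"

definition dominated :: "('x \<Rightarrow> complex) \<Rightarrow> ('x \<Rightarrow> real) \<Rightarrow> bool" where
  "dominated F w \<longleftrightarrow> (\<exists>C>0. \<forall>z. norm (F z) \<le> C * w z)"

definition weighted_topology ::
    "(complex ^ 'd::finite \<Rightarrow> real) \<Rightarrow> (complex ^ 'd \<Rightarrow> complex) topology" where
  "weighted_topology w =
     norm_topology {F. entire F \<and> dominated F w} (\<lambda>F. SUP z. norm (F z) / w z)"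

definition japanese :: "complex ^ 'd::finite \<Rightarrow> real" where
  "japanese z = sqrt (1 + (norm z)\<^sup>2)"

definition \<omega>\<^sub>1 :: "real \<Rightarrow> real \<Rightarrow> complex ^ 'd::finite \<Rightarrow> real" where
  "\<omega>\<^sub>1 r s z =
     (if s < 1/2 then exp (r * ln (japanese z) powr (1 / (1 - 2 * s)))
      else exp ((norm z)\<^sup>2 / 2 - r * norm z powr (1 / s)))"

section \<open>Sequence spaces and power series spaces\<close>

text \<open>
  A formal power series \<open>\<Sum>\<^sub>\<alpha> c\<^sub>\<alpha> e\<^sub>\<alpha>\<close> is represented by its family of coefficients
  \<open>c\<close> with respect to the \<open>e\<^sub>\<alpha>\<close>; under this identification the spaces of formal power series
  and their transported topologies are the sequence spaces and their topologies.
\<close>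

type_synonym 'd power_series = "nat ^ 'd \<Rightarrow> complex"

definition mi_size :: "nat ^ 'd::finite \<Rightarrow> nat" where
  "mi_size \<alpha> = (\<Sum>i\<in>UNIV. \<alpha> $ i)"

definition mi_fact :: "nat ^ 'd::finite \<Rightarrow> real" where
  "mi_fact \<alpha> = (\<Prod>i\<in>UNIV. fact (\<alpha> $ i))"

definition e_fun :: "nat ^ 'd::finite \<Rightarrow> complex ^ 'd \<Rightarrow> complex" where
  "e_fun \<alpha> z = (\<Prod>i\<in>UNIV. (z $ i) ^ (\<alpha> $ i)) / complex_of_real (sqrt (mi_fact \<alpha>))"

definition \<theta> :: "real \<Rightarrow> real \<Rightarrow> nat ^ 'd::finite \<Rightarrow> real" where
  "\<theta> r s \<alpha> = exp (r * real (mi_size \<alpha>) powr (1 / (2 * s)))"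

text \<open>The exponent \<open>p \<in> (0, \<infinity>]\<close> is an extended nonnegative real.\<close>

definition lp_mem :: "ennreal \<Rightarrow> ('i \<Rightarrow> complex) \<Rightarrow> bool" where
  "lp_mem p c \<longleftrightarrow>
     (if p = \<infinity> then bdd_above (range (\<lambda>i. norm (c i)))
      else (\<lambda>i. norm (c i) powr enn2real p) summable_on UNIV)"

definition lp_norm :: "ennreal \<Rightarrow> ('i \<Rightarrow> complex) \<Rightarrow> real" where
  "lp_norm p c =
     (if p = \<infinity> then (SUP i. norm (c i))
      else (\<Sum>\<^sub>\<infinity>i. norm (c i) powr enn2real p) powr (1 / enn2real p))"

definition lp_topology :: "ennreal \<Rightarrow> ('i \<Rightarrow> real) \<Rightarrow> ('i \<Rightarrow> complex) topology" where
  "lp_topology p w =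
     norm_topology {c. lp_mem p (\<lambda>i. c i * complex_of_real (w i))}
       (\<lambda>c. lp_norm p (\<lambda>i. c i * complex_of_real (w i)))"

definition finite_series :: "'d::finite power_series set" where
  "finite_series = {c. finite {\<alpha>. c \<alpha> \<noteq> 0}}"

text \<open>
  The finite-dimensional spaces \<open>{c. c\<^sub>\<alpha> = 0 when |\<alpha>| > N}\<close> carry their only Hausdorff vector
  topology, here given by the maximum norm.
\<close>

definition finite_series_topology :: "'d::finite power_series topology" where
  "finite_series_topology = inductive_limit_topology (UNIV :: nat set)
     (\<lambda>N. norm_topology {c. \<forall>\<alpha>. mi_size \<alpha> > N \<longrightarrow> c \<alpha> = 0} (\<lambda>c. SUP \<alpha>. norm (c \<alpha>)))"

text \<open>The spaces \<open>A\<^sub>s\<close> for \<open>s \<ge> 0\<close>, and \<open>A\<^sub>0\<^sub>,\<^sub>s\<close> for \<open>s > 0\<close>.\<close>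

definition A_topology :: "ennreal \<Rightarrow> real \<Rightarrow> 'd::finite power_series topology" where
  "A_topology p s =
     (if s = 0 then finite_series_topology
      else inductive_limit_topology {0<..} (\<lambda>r. lp_topology p (\<theta> r s)))"

definition A0_topology :: "ennreal \<Rightarrow> real \<Rightarrow> 'd::finite power_series topology" where
  "A0_topology p s = projective_limit_topology {0<..} (\<lambda>r. lp_topology p (\<theta> r s))"

definition \<P> :: "'d::finite power_series \<Rightarrow> complex ^ 'd \<Rightarrow> complex" where
  "\<P> c z = (\<Sum>\<alpha> | c \<alpha> \<noteq> 0. c \<alpha> * e_fun \<alpha> z)"

section \<open>The target spaces and unique extension\<close>

definition bounded_some_topology :: "real \<Rightarrow> (complex ^ 'd::finite \<Rightarrow> complex) topology" where
  "bounded_some_topology s = inductive_limit_topology {0<..} (\<lambda>r. weighted_topology (\<omega>\<^sub>1 r s))"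

definition bounded_every_topology :: "real \<Rightarrow> (complex ^ 'd::finite \<Rightarrow> complex) topology" where
  "bounded_every_topology s = projective_limit_topology {0<..} (\<lambda>r. weighted_topology (\<omega>\<^sub>1 r s))"

definition extends_uniquely_to_homeomorphism ::
    "('a \<Rightarrow> 'b) \<Rightarrow> 'a set \<Rightarrow> 'a topology \<Rightarrow> 'b topology \<Rightarrow> bool" where
  "extends_uniquely_to_homeomorphism f S X Y \<longleftrightarrow> S \<subseteq> topspace X \<and>
     (\<exists>!\<Phi>. \<Phi> \<in> extensional (topspace X) \<and> homeomorphic_map X Y \<Phi> \<and> (\<forall>x\<in>S. \<Phi> x = f x))"

lemma topspace_bounded_every:
  "topspace (bounded_every_topology s) = {F. entire F \<and> (\<forall>r>0. dominated F (\<omega>\<^sub>1 r s))}"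
proof -
  have "topspace (bounded_every_topology s) = (\<Inter>r\<in>{0<..}. {F. entire F \<and> dominated F (\<omega>\<^sub>1 r s)})"
    unfolding bounded_every_topology_def
    by (subst topspace_projective_limit) (simp_all add: weighted_topology_def)
  also have "\<dots> = {F. entire F \<and> (\<forall>r>0. dominated F (\<omega>\<^sub>1 r s))}"
    by auto (use greaterThan_iff[of "0::real" 1] zero_less_one in blast)
  finally show ?thesis .
qed

lemma topspace_bounded_some:
  "topspace (bounded_some_topology s) = {F. entire F \<and> (\<exists>r>0. dominated F (\<omega>\<^sub>1 r s))}"
proof -
  let ?X = "\<lambda>r. {F. entire F \<and> dominated F (\<omega>\<^sub>1 r s :: complex ^ 'a \<Rightarrow> real)}"
  have pos: "\<omega>\<^sub>1 r s z > 0" for r and z :: "complex ^ 'a" by (simp add: \<omega>\<^sub>1_def)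
  have mono: "(\<forall>z :: complex ^ 'a. \<omega>\<^sub>1 r s z \<le> \<omega>\<^sub>1 r' s z) \<or> (\<forall>z :: complex ^ 'a. \<omega>\<^sub>1 r' s z \<le> \<omega>\<^sub>1 r s z)"
    if "r \<le> r'" for r r'
    using that by (cases "s < 1/2") (simp_all add: \<omega>\<^sub>1_def mult_right_mono)
  have chain: "\<exists>t\<in>{r, r'}. (\<forall>z :: complex ^ 'a. \<omega>\<^sub>1 r s z \<le> \<omega>\<^sub>1 t s z \<and> \<omega>\<^sub>1 r' s z \<le> \<omega>\<^sub>1 t s z)"
    for r r' using mono[of r r'] mono[of r' r] linear[of r r'] by auto
  have dom_mono: "dominated F w'" if "dominated F w" "\<And>z. w z \<le> w' z"
    for F :: "complex ^ 'a \<Rightarrow> complex" and w w'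
    using that unfolding dominated_def
    by (meson mult_left_mono less_imp_le order_trans)
  have dom_lin: "dominated (\<lambda>z. a * F z + b * G z) w" if F: "dominated F w" and G: "dominated G w" and w: "\<And>z. w z > 0"
    for F G :: "complex ^ 'a \<Rightarrow> complex" and w a b
  proof -
    obtain C D where C: "C > 0" "\<And>z. norm (F z) \<le> C * w z" and D: "D > 0" "\<And>z. norm (G z) \<le> D * w z"
      using F G unfolding dominated_def by blast
    have "norm (a * F z + b * G z) \<le> (norm a * C + norm b * D + 1) * w z" for z
    proof -
      have "norm (a * F z + b * G z) \<le> norm a * norm (F z) + norm b * norm (G z)"
        by (metis norm_mult norm_triangle_ineq)
      also have "\<dots> \<le> norm a * (C * w z) + norm b * (D * w z)"
        using C D by (intro add_mono mult_left_mono) auto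
      also have "\<dots> \<le> (norm a * C + norm b * D + 1) * w z"
        using w[of z] by (simp add: algebra_simps)
      finally show ?thesis .
    qed
    moreover have "norm a * C + norm b * D + 1 > 0"
      using C(1) D(1) by (simp add: add_nonneg_pos)
    ultimately show ?thesis unfolding dominated_def by blast
  qed
  have ent_lin: "entire (\<lambda>z. a * F z + b * G z)" if "entire F" "entire G"
    for F G :: "complex ^ 'a \<Rightarrow> complex" and a b
    unfolding entire_def
  proof
    fix z
    obtain D E where D: "(F has_derivative D) (at z)" "\<forall>c v. D (c *s v) = c * D v"
      and E: "(G has_derivative E) (at z)" "\<forall>c v. E (c *s v) = c * E v"
      using \<open>entire F\<close> \<open>entire G\<close> unfolding entire_def by meson
    have "((\<lambda>z. a * F z + b * G z) has_derivative (\<lambda>v. a * D v + b * E v)) (at z)"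
      by (intro has_derivative_add has_derivative_mult_right D E)
    then show "\<exists>D. ((\<lambda>z. a * F z + b * G z) has_derivative D) (at z) \<and>
        (\<forall>a v. D (a *s v) = a * D v)"
      using D(2) E(2) by (intro exI[of _ "\<lambda>v. a * D v + b * E v"]) (simp add: algebra_simps)
  qed
  have zero: "(\<lambda>_. 0) \<in> ?X r" for r
  proof -
    have "entire (\<lambda>_ :: complex ^ 'a. 0)"
      unfolding entire_def by (intro allI exI[of _ "\<lambda>_. 0"]) simp
    moreover have "dominated (\<lambda>_. 0) (\<omega>\<^sub>1 r s :: complex ^ 'a \<Rightarrow> real)"
      unfolding dominated_def using pos[of r] by (intro exI[of _ 1]) (simp add: less_imp_le)
    ultimately show ?thesis by simp
  qed
  have lin: "(\<lambda>z. a * F z + b * G z) \<in> (\<Union>r\<in>{0<..}. ?X r)"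
    if F: "F \<in> (\<Union>r\<in>{0<..}. ?X r)" and G: "G \<in> (\<Union>r\<in>{0<..}. ?X r)" for F G a b
  proof -
    obtain r r' where r: "r > 0" "F \<in> ?X r" and r': "r' > 0" "G \<in> ?X r'" using F G by auto
    obtain t where t: "t \<in> {r, r'}"
      and le: "\<And>z :: complex ^ 'a. \<omega>\<^sub>1 r s z \<le> \<omega>\<^sub>1 t s z" "\<And>z :: complex ^ 'a. \<omega>\<^sub>1 r' s z \<le> \<omega>\<^sub>1 t s z"
      using chain[of r r'] by blast
    have FG: "dominated F (\<omega>\<^sub>1 t s)" "dominated G (\<omega>\<^sub>1 t s)"
      using r(2) r'(2) dom_mono[OF _ le(1)] dom_mono[OF _ le(2)] by auto
    have "(\<lambda>z. a * F z + b * G z) \<in> ?X t"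
      using dom_lin[OF FG pos] ent_lin r(2) r'(2) by simp
    moreover have "t > 0" using t r(1) r'(1) by auto
    ultimately show ?thesis by blast
  qed
  have "topspace (bounded_some_topology s) = (\<Union>r\<in>{0<..}. ?X r)"
    unfolding bounded_some_topology_def
    by (subst topspace_inductive_limit)
      (simp_all only: weighted_topology_def topspace_norm_topology zero lin)
  then show ?thesis by auto
qed

end

theory Submission
  imports Defs "HOL-Complex_Analysis.Cauchy_Integral_Formula" "HOL-Real_Asymp.Real_Asymp"
begin

text \<open>
  For \<open>s > 0\<close> put \<open>a = 1 / (2s)\<close>, and write \<open>n\<close> for \<open>|\<alpha>|\<close>. As \<open>exp (- r n powr a)\<close> has summable powers, the
  weighted \<open>\<ell>\<^sup>p\<close> norms are equivalent to weighted supremum norms up to a change of \<open>r\<close>; so the coefficient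
  spaces are those of sequences dominated by \<open>exp (- r n powr a)\<close> for some or all \<open>r > 0\<close>. The theorem then says that this decay of the coefficients
  corresponds to the growth bound \<open>\<omega>\<^sub>1\<close> for the function, with a loss in the parameters only. Both directions
  are inequalities between weighted supremum norms (\<open>series_bound\<close> and \<open>coeff_bound\<close>), and as they are
  uniform on each step of the limits, continuity of the map and of its inverse comes with them.

  From coefficients to functions one estimates the sum of \<open>exp (- r n powr a) |e\<^sub>\<alpha>(z)|\<close>. For \<open>0 < s < 1/2\<close>
  the terms are at most \<open>exp (n L - r n powr a)\<close> with \<open>L = ln \<langle>z\<rangle>\<close>, and Young's inequality with the exponents
  \<open>a\<close> and \<open>a / (a - 1) = 1 / (1 - 2s)\<close> bounds \<open>n L\<close> by half of \<open>r n powr a\<close> plus a multiple of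
  \<open>L powr (1 / (1 - 2s))\<close>
  (\<open>series_bound_log_growth\<close>). For \<open>s \<ge> 1/2\<close> the sums of \<open>|e\<^sub>\<alpha>(z)|\<^sup>2\<close> over \<open>|\<alpha>| = n\<close> are
  \<open>exp (|z|\<^sup>2)\<close> times a Poisson distribution of mean \<open>|z|\<^sup>2\<close>;
  the weight near the mean contributes \<open>exp (- R |z| powr (1/s))\<close>, and the lower tail is smaller than
  \<open>exp (|z|\<^sup>2)\<close> by a factor that is exponential in \<open>|z|\<^sup>2\<close> (\<open>series_bound_gaussian\<close>). For \<open>s = 1/2\<close>
  this tail limits \<open>R\<close>, which is why the second part excludes that value.

  From functions to coefficients one uses Cauchy's inequality on a torus: of radius \<open>exp (4 r n powr (a - 1))\<close>
  for \<open>0 < s < 1/2\<close> (\<open>coeff_bound_log_growth\<close>), of radii \<open>sqrt (\<alpha> $ j)\<close> together with Stirling's formula for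
  \<open>s \<ge> 1/2\<close> (\<open>coeff_bound_gaussian\<close>), and of radius tending to infinity for \<open>s = 0\<close>, as in Liouville's theorem
  (\<open>coeff_bound_polynomial\<close>). This requires the expansion of an entire function of several variables into a
  power series together with Cauchy's inequality (\<open>separately_holomorphic_power_series_on\<close>), which is proved by
  induction over the variables, and the uniqueness of its coefficients.

  A homeomorphism is determined by its values on finite series because truncations converge in the
  sequence spaces and point evaluations are continuous on the function spaces
  (\<open>extends_uniquely_by_density\<close>).
\<close>

section \<open>Limits of quasi-normed spaces\<close>

text \<open>
  For \<open>p < 1\<close> the \<open>\<ell>\<^sup>p\<close> norms satisfy the triangle inequality only up to a constant, so that balls need
  not be open; this weak notion is what the steps of all limits below have in common.
\<close>

definition quasi_norm :: "('i \<Rightarrow> complex) set \<Rightarrow> (('i \<Rightarrow> complex) \<Rightarrow> real) \<Rightarrow> bool" where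
  "quasi_norm X N \<longleftrightarrow> N (\<lambda>_. 0) = 0 \<and>
     (\<exists>K>0. \<forall>f\<in>X. \<forall>g\<in>X. \<forall>h\<in>X.
        N (\<lambda>i. f i - h i) \<le> K * (N (\<lambda>i. f i - g i) + N (\<lambda>i. g i - h i)))"

text \<open>
  The interior of a ball, defined as the set of points that have a smaller ball inside, is open:
  by the weak triangle inequality a ball whose radius is shrunk by the factor \<open>2K\<close> keeps all its
  points inside the interior.
\<close>

lemma norm_topology_ball_nbhd:
  assumes q: "quasi_norm X N" and f: "f \<in> X" and "\<epsilon> > 0"
    and S: "\<And>g. g \<in> X \<Longrightarrow> N (\<lambda>i. g i - f i) < \<epsilon> \<Longrightarrow> g \<in> S"
  shows "\<exists>W. openin (norm_topology X N) W \<and> f \<in> W \<and> W \<subseteq> S"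
proof -
  obtain K where K: "K > 0" and tri: "\<And>f g h. f \<in> X \<Longrightarrow> g \<in> X \<Longrightarrow> h \<in> X \<Longrightarrow>
      N (\<lambda>i. f i - h i) \<le> K * (N (\<lambda>i. f i - g i) + N (\<lambda>i. g i - h i))"
    using q unfolding quasi_norm_def by blast
  have N0: "N (\<lambda>i. g i - g i) = 0" for g using q by (simp add: quasi_norm_def)
  define W where "W = {g \<in> X. \<exists>\<delta>>0. \<forall>h\<in>X. N (\<lambda>i. h i - g i) < \<delta> \<longrightarrow> h \<in> S}"
  have "\<exists>\<delta>>0. \<forall>h\<in>X. N (\<lambda>i. h i - g i) < \<delta> \<longrightarrow> h \<in> W" if gW: "g \<in> W" for g
  proof -
    obtain \<delta> where d: "\<delta> > 0" "\<And>h. h \<in> X \<Longrightarrow> N (\<lambda>i. h i - g i) < \<delta> \<Longrightarrow> h \<in> S" and g: "g \<in> X"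
      using gW unfolding W_def by blast
    let ?d = "\<delta> / (2 * K)"
    have "h \<in> W" if h: "h \<in> X" "N (\<lambda>i. h i - g i) < ?d" for h
    proof -
      have "k \<in> S" if k: "k \<in> X" "N (\<lambda>i. k i - h i) < ?d" for k
      proof (rule d(2)[OF k(1)])
        have "N (\<lambda>i. k i - g i) \<le> K * (N (\<lambda>i. k i - h i) + N (\<lambda>i. h i - g i))"
          using tri[OF k(1) h(1) g] .
        also have "\<dots> < K * (?d + ?d)"
          using h k K by (intro mult_strict_left_mono add_strict_mono) auto
        finally show "N (\<lambda>i. k i - g i) < \<delta>" using K by (simp add: field_simps)
      qed
      moreover have "?d > 0" using d K by simp
      ultimately show ?thesis unfolding W_def using h by blast
    qed
    moreover have "?d > 0" using d K by simp
    ultimately show ?thesis by blast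
  qed
  then have "openin (norm_topology X N) W"
    unfolding openin_norm_topology by (auto simp: W_def)
  moreover have "f \<in> W" using f S \<open>\<epsilon> > 0\<close> unfolding W_def by blast
  moreover have "W \<subseteq> S"
  proof
    fix g assume "g \<in> W"
    then obtain \<delta> where d: "\<delta> > 0" "\<And>h. h \<in> X \<Longrightarrow> N (\<lambda>i. h i - g i) < \<delta> \<Longrightarrow> h \<in> S" and g: "g \<in> X"
      unfolding W_def by blast
    show "g \<in> S" by (rule d(2)[OF g]) (use N0 d(1) in simp)
  qed
  ultimately show ?thesis by blast
qed

lemma openin_norm_topologyD:
  assumes "openin (norm_topology X N) W" "f \<in> W"
  obtains \<epsilon> where "\<epsilon> > 0" "\<And>g. g \<in> X \<Longrightarrow> N (\<lambda>i. g i - f i) < \<epsilon> \<Longrightarrow> g \<in> W"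
  using assms unfolding openin_norm_topology by meson

text \<open>
  A linear map that is bounded from every step of the domain into some step of the codomain pulls
  neighbourhoods of the origin back to neighbourhoods of the origin, hence is continuous.
\<close>

lemma continuous_map_inductive_limit:
  fixes R :: "'r set" and X :: "'r \<Rightarrow> ('i \<Rightarrow> complex) set" and Y :: "'q \<Rightarrow> ('j \<Rightarrow> complex) set"
  defines "E \<equiv> \<Union>r\<in>R. X r"
  assumes q: "\<And>r. r \<in> R \<Longrightarrow> quasi_norm (X r) (N r)"
    and zero: "\<And>r. r \<in> R \<Longrightarrow> (\<lambda>_. 0) \<in> X r"
    and lin: "\<And>f g a b. f \<in> E \<Longrightarrow> g \<in> E \<Longrightarrow> (\<lambda>i. a * f i + b * g i) \<in> E"
    and T: "topspace (inductive_limit_topology Q (\<lambda>t. norm_topology (Y t) (M t))) = (\<Union>t\<in>Q. Y t)"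
    and \<Phi>: "\<And>f g a b. f \<in> E \<Longrightarrow> g \<in> E \<Longrightarrow>
                 \<Phi> (\<lambda>i. a * f i + b * g i) = (\<lambda>j. a * \<Phi> f j + b * \<Phi> g j)"
    and bound: "\<And>r. r \<in> R \<Longrightarrow> \<exists>t\<in>Q. \<exists>C>0. \<forall>f\<in>X r. \<Phi> f \<in> Y t \<and> M t (\<Phi> f) \<le> C * N r f"
  shows "continuous_map (inductive_limit_topology R (\<lambda>r. norm_topology (X r) (N r)))
           (inductive_limit_topology Q (\<lambda>t. norm_topology (Y t) (M t))) \<Phi>"
    (is "continuous_map ?S ?T \<Phi>")
proof -
  have S: "topspace ?S = E"
    using topspace_inductive_limit[of R "\<lambda>r. norm_topology (X r) (N r)"] zero lin
    unfolding topspace_norm_topology E_def by blast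
  have nbhd: "ind_lim_nbhd R (\<lambda>r. norm_topology (X r) (N r)) {f \<in> E. \<Phi> f \<in> V}"
    if V: "ind_lim_nbhd Q (\<lambda>t. norm_topology (Y t) (M t)) V" for V
    unfolding ind_lim_nbhd_def
  proof (intro conjI ballI)
    show "{f \<in> E. \<Phi> f \<in> V} \<subseteq> (\<Union>r\<in>R. topspace (norm_topology (X r) (N r)))"
      by (auto simp: E_def)
    show "abs_convex {f \<in> E. \<Phi> f \<in> V}"
      using V unfolding abs_convex_def ind_lim_nbhd_def by (simp add: lin \<Phi>)
    fix r assume r: "r \<in> R"
    obtain t C where t: "t \<in> Q" "C > 0" "\<And>f. f \<in> X r \<Longrightarrow> \<Phi> f \<in> Y t \<and> M t (\<Phi> f) \<le> C * N r f"
      using bound[OF r] by blast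
    obtain W where W: "openin (norm_topology (Y t) (M t)) W" "(\<lambda>_. 0) \<in> W" "W \<subseteq> V"
      using V t(1) unfolding ind_lim_nbhd_def by meson
    obtain \<epsilon> where e: "\<epsilon> > 0" "\<And>g. g \<in> Y t \<Longrightarrow> M t (\<lambda>i. g i - 0) < \<epsilon> \<Longrightarrow> g \<in> W"
      using openin_norm_topologyD[OF W(1,2)] by blast
    show "\<exists>W. openin (norm_topology (X r) (N r)) W \<and> (\<lambda>_. 0) \<in> W \<and> W \<subseteq> {f \<in> E. \<Phi> f \<in> V}"
    proof (rule norm_topology_ball_nbhd[OF q[OF r] zero[OF r]])
      show "\<epsilon> / C > 0" using e t by simp
      fix g assume g: "g \<in> X r" "N r (\<lambda>i. g i - 0) < \<epsilon> / C"
      then have "C * N r g < \<epsilon>" using t(2) by (simp add: field_simps)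
      then have "\<Phi> g \<in> W" using t(3)[OF g(1)] by (intro e(2)) auto
      then show "g \<in> {f \<in> E. \<Phi> f \<in> V}" using W(3) g(1) r by (auto simp: E_def)
    qed
  qed
  show ?thesis
    unfolding continuous_map_def S T
  proof (intro conjI allI impI)
    show "\<Phi> \<in> E \<rightarrow> (\<Union>t\<in>Q. Y t)"
      using bound unfolding E_def by blast
    fix U assume "openin ?T U"
    then have U: "\<And>f. f \<in> U \<Longrightarrow> \<exists>V. ind_lim_nbhd Q (\<lambda>t. norm_topology (Y t) (M t)) V \<and>
        (\<forall>g\<in>V. (\<lambda>i. f i + g i) \<in> U)"
      unfolding openin_inductive_limit by blast
    show "openin ?S {f \<in> E. \<Phi> f \<in> U}"
      unfolding openin_inductive_limit
    proof (intro conjI ballI)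
      show "{f \<in> E. \<Phi> f \<in> U} \<subseteq> (\<Union>r\<in>R. topspace (norm_topology (X r) (N r)))"
        by (auto simp: E_def)
      fix f assume f: "f \<in> {f \<in> E. \<Phi> f \<in> U}"
      then obtain V where V: "ind_lim_nbhd Q (\<lambda>t. norm_topology (Y t) (M t)) V"
        "\<And>g. g \<in> V \<Longrightarrow> (\<lambda>i. \<Phi> f i + g i) \<in> U" using U[of "\<Phi> f"] by blast
      have "(\<lambda>i. f i + g i) \<in> {f \<in> E. \<Phi> f \<in> U}" if "g \<in> {f \<in> E. \<Phi> f \<in> V}" for g
        using f that lin[of f g 1 1] \<Phi>[of f g 1 1] V(2)[of "\<Phi> g"] by simp
      with nbhd[OF V(1)]
      show "\<exists>V. ind_lim_nbhd R (\<lambda>r. norm_topology (X r) (N r)) V \<and>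
          (\<forall>g\<in>V. (\<lambda>i. f i + g i) \<in> {f \<in> E. \<Phi> f \<in> U})" by blast
    qed
  qed
qed

lemma openin_projective_limit_step:
  assumes "r \<in> R" "openin (T r) W"
  shows "openin (projective_limit_topology R T) (W \<inter> (\<Inter>r\<in>R. topspace (T r)))"
  unfolding projective_limit_topology_def
  by (rule topology_generated_by_Basis) (use assms in blast)

text \<open>
  For projective limits the quantifiers are exchanged: every step of the codomain has to be controlled
  by some step of the domain.
\<close>

lemma continuous_map_projective_limit:
  fixes R :: "'r set" and X :: "'r \<Rightarrow> ('i \<Rightarrow> complex) set" and Y :: "'q \<Rightarrow> ('j \<Rightarrow> complex) set"
  defines "E \<equiv> \<Inter>r\<in>R. X r"
  assumes q: "\<And>r. r \<in> R \<Longrightarrow> quasi_norm (X r) (N r)"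
    and "R \<noteq> {}" "Q \<noteq> {}"
    and lin: "\<And>f g. f \<in> E \<Longrightarrow> g \<in> E \<Longrightarrow> (\<lambda>i. f i - g i) \<in> E"
    and \<Phi>: "\<And>f g. f \<in> E \<Longrightarrow> g \<in> E \<Longrightarrow> \<Phi> (\<lambda>i. f i - g i) = (\<lambda>j. \<Phi> f j - \<Phi> g j)"
    and bound: "\<And>t. t \<in> Q \<Longrightarrow> \<exists>r\<in>R. \<exists>C>0. \<forall>f\<in>E. \<Phi> f \<in> Y t \<and> M t (\<Phi> f) \<le> C * N r f"
  shows "continuous_map (projective_limit_topology R (\<lambda>r. norm_topology (X r) (N r)))
           (projective_limit_topology Q (\<lambda>t. norm_topology (Y t) (M t))) \<Phi>"
    (is "continuous_map ?S ?T \<Phi>")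
proof -
  have S: "topspace ?S = E"
    using topspace_projective_limit[OF \<open>R \<noteq> {}\<close>, of "\<lambda>r. norm_topology (X r) (N r)"]
    by (simp add: E_def)
  have into: "\<Phi> f \<in> (\<Inter>t\<in>Q. Y t)" if "f \<in> E" for f using bound that by blast
  let ?I = "\<Inter>t\<in>Q. topspace (norm_topology (Y t) (M t))"
  show ?thesis
    unfolding projective_limit_topology_def[of Q]
  proof (rule continuous_on_generated_topo)
    have "topspace ?T = \<Union>{W \<inter> ?I |W. \<exists>r\<in>Q. openin (norm_topology (Y r) (M r)) W}"
      unfolding projective_limit_topology_def[of Q] by (rule topology_generated_by_topspace)
    then show "\<Phi> ` topspace ?S \<subseteq> \<Union>{W \<inter> ?I |W. \<exists>r\<in>Q. openin (norm_topology (Y r) (M r)) W}"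
      unfolding topspace_projective_limit[OF \<open>Q \<noteq> {}\<close>] S using into by auto
    fix U assume "U \<in> {W \<inter> ?I |W. \<exists>r\<in>Q. openin (norm_topology (Y r) (M r)) W}"
    then obtain W t where U: "U = W \<inter> ?I" and t: "t \<in> Q" "openin (norm_topology (Y t) (M t)) W"
      by blast
    obtain r C where r: "r \<in> R" "C > 0" "\<And>f. f \<in> E \<Longrightarrow> \<Phi> f \<in> Y t \<and> M t (\<Phi> f) \<le> C * N r f"
      using bound[OF t(1)] by blast
    show "openin ?S (\<Phi> -` U \<inter> topspace ?S)"
    proof (subst openin_subopen, intro ballI)
      fix f assume f: "f \<in> \<Phi> -` U \<inter> topspace ?S"
      then have fE: "f \<in> E" and fW: "\<Phi> f \<in> W" using S U by auto
      obtain \<epsilon> where e: "\<epsilon> > 0" "\<And>g. g \<in> Y t \<Longrightarrow> M t (\<lambda>i. g i - \<Phi> f i) < \<epsilon> \<Longrightarrow> g \<in> W"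
        using openin_norm_topologyD[OF t(2) fW] by blast
      have "\<exists>A. openin (norm_topology (X r) (N r)) A \<and> f \<in> A \<and> A \<subseteq> {g. g \<in> E \<longrightarrow> \<Phi> g \<in> W}"
      proof (rule norm_topology_ball_nbhd[OF q[OF r(1)]])
        show "f \<in> X r" using fE r(1) by (auto simp: E_def)
        show "\<epsilon> / C > 0" using e r by simp
        fix g assume g: "g \<in> X r" "N r (\<lambda>i. g i - f i) < \<epsilon> / C"
        have "\<Phi> g \<in> W" if gE: "g \<in> E"
        proof (rule e(2))
          show "\<Phi> g \<in> Y t" using r(3)[OF gE] by simp
          have "M t (\<lambda>i. \<Phi> g i - \<Phi> f i) \<le> C * N r (\<lambda>i. g i - f i)"
            using r(3)[OF lin[OF gE fE]] \<Phi>[OF gE fE] by simp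
          also have "\<dots> < \<epsilon>" using g(2) r(2) by (simp add: field_simps)
          finally show "M t (\<lambda>i. \<Phi> g i - \<Phi> f i) < \<epsilon>" .
        qed
        then show "g \<in> {g. g \<in> E \<longrightarrow> \<Phi> g \<in> W}" by simp
      qed
      then obtain A where A: "openin (norm_topology (X r) (N r)) A" "f \<in> A"
        "\<And>g. g \<in> A \<Longrightarrow> g \<in> E \<Longrightarrow> \<Phi> g \<in> W" by blast
      have "openin ?S (A \<inter> E)"
        using openin_projective_limit_step[where T = "\<lambda>r. norm_topology (X r) (N r)", OF r(1) A(1)]
        by (simp add: E_def)
      moreover have "A \<inter> E \<subseteq> \<Phi> -` U \<inter> topspace ?S" using A(3) into U S by auto
      ultimately show "\<exists>A. openin ?S A \<and> f \<in> A \<and> A \<subseteq> \<Phi> -` U \<inter> topspace ?S"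
        using A(2) fE by blast
    qed
  qed
qed

lemma limitin_inductive_limit:
  assumes f: "f \<in> topspace (inductive_limit_topology R (\<lambda>r. norm_topology (X r) (N r)))"
    and r: "r \<in> R" and conv: "\<And>n. (\<lambda>i. u n i - f i) \<in> X r"
      "(\<lambda>n. N r (\<lambda>i. u n i - f i)) \<longlonglongrightarrow> 0"
  shows "limitin (inductive_limit_topology R (\<lambda>r. norm_topology (X r) (N r))) u f sequentially"
  unfolding limitin_def
proof (intro conjI allI impI f)
  fix U assume U: "openin (inductive_limit_topology R (\<lambda>r. norm_topology (X r) (N r))) U \<and> f \<in> U"
  then have "\<exists>V. ind_lim_nbhd R (\<lambda>r. norm_topology (X r) (N r)) V \<and> (\<forall>g\<in>V. (\<lambda>i. f i + g i) \<in> U)"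
    unfolding openin_inductive_limit by simp
  then obtain V where V: "ind_lim_nbhd R (\<lambda>r. norm_topology (X r) (N r)) V"
    "\<And>g. g \<in> V \<Longrightarrow> (\<lambda>i. f i + g i) \<in> U" by blast
  obtain W where W: "openin (norm_topology (X r) (N r)) W" "(\<lambda>_. 0) \<in> W" "W \<subseteq> V"
    using V(1) r unfolding ind_lim_nbhd_def by meson
  obtain \<epsilon> where e: "\<epsilon> > 0" "\<And>g. g \<in> X r \<Longrightarrow> N r (\<lambda>i. g i - 0) < \<epsilon> \<Longrightarrow> g \<in> W"
    using openin_norm_topologyD[OF W(1,2)] by blast
  have "\<forall>\<^sub>F n in sequentially. N r (\<lambda>i. u n i - f i) < \<epsilon>"
    using order_tendstoD(2)[OF conv(2) e(1)] .
  then show "\<forall>\<^sub>F n in sequentially. u n \<in> U"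
  proof eventually_elim
    case (elim n)
    then have "(\<lambda>i. u n i - f i) \<in> V" using e(2)[OF conv(1)[of n]] W(3) by auto
    from V(2)[OF this] show ?case by simp
  qed
qed

text \<open>
  The open sets of a projective limit are given by generators, and containing almost all terms of the
  sequence is stable under the operations that build open sets from generators.
\<close>

lemma limitin_projective_limit:
  assumes "R \<noteq> {}" and f: "\<And>r. r \<in> R \<Longrightarrow> f \<in> X r" and u: "\<And>n r. r \<in> R \<Longrightarrow> u n \<in> X r"
    and conv: "\<And>r. r \<in> R \<Longrightarrow> (\<lambda>n. N r (\<lambda>i. u n i - f i)) \<longlonglongrightarrow> 0"
  shows "limitin (projective_limit_topology R (\<lambda>r. norm_topology (X r) (N r))) u f sequentially"
  unfolding limitin_def
proof (intro conjI allI impI)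
  show "f \<in> topspace (projective_limit_topology R (\<lambda>r. norm_topology (X r) (N r)))"
    unfolding topspace_projective_limit[OF \<open>R \<noteq> {}\<close>] using f by simp
  fix U assume U: "openin (projective_limit_topology R (\<lambda>r. norm_topology (X r) (N r))) U \<and> f \<in> U"
  then have "generate_topology_on {W \<inter> (\<Inter>r\<in>R. topspace (norm_topology (X r) (N r))) |W.
      \<exists>r\<in>R. openin (norm_topology (X r) (N r)) W} U"
    unfolding projective_limit_topology_def by (intro openin_topology_generated_by) blast
  then have "f \<in> U \<longrightarrow> (\<forall>\<^sub>F n in sequentially. u n \<in> U)"
  proof induction
    case Empty
    then show ?case by simp
  next
    case (Int a b)
    then show ?case by (simp add: eventually_conj)
  next
    case (UN K)
    show ?case
    proof
      assume "f \<in> \<Union>K"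
      then obtain k where k: "k \<in> K" "f \<in> k" by blast
      then have "\<forall>\<^sub>F n in sequentially. u n \<in> k" using UN by blast
      then show "\<forall>\<^sub>F n in sequentially. u n \<in> \<Union>K"
        by (rule eventually_mono) (use k in blast)
    qed
  next
    case (Basis s)
    then obtain W r where s: "s = W \<inter> (\<Inter>r\<in>R. topspace (norm_topology (X r) (N r)))"
      and r: "r \<in> R" "openin (norm_topology (X r) (N r)) W" by blast
    show ?case
    proof
      assume "f \<in> s"
      then have "f \<in> W" using s by simp
      then obtain \<epsilon> where e: "\<epsilon> > 0" "\<And>g. g \<in> X r \<Longrightarrow> N r (\<lambda>i. g i - f i) < \<epsilon> \<Longrightarrow> g \<in> W"
        using openin_norm_topologyD[OF r(2)] by blast
      have "\<forall>\<^sub>F n in sequentially. N r (\<lambda>i. u n i - f i) < \<epsilon>"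
        using order_tendstoD(2)[OF conv[OF r(1)] e(1)] .
      then show "\<forall>\<^sub>F n in sequentially. u n \<in> s"
      proof eventually_elim
        case (elim n)
        then show ?case using e(2)[OF u[OF r(1)]] u by (simp add: s)
      qed
    qed
  qed
  then show "\<forall>\<^sub>F n in sequentially. u n \<in> U" using U by blast
qed

text \<open>
  The set where an evaluation is smaller than \<open>\<epsilon>\<close> is absolutely convex and contains a ball of each step,
  so evaluations are continuous. They separate points, which is how uniqueness of limits in the target
  space is obtained without further study of its topology.
\<close>

lemma continuous_map_eval_inductive_limit:
  fixes Q :: "'q set" and Y :: "'q \<Rightarrow> ('j \<Rightarrow> complex) set"
  defines "E \<equiv> \<Union>t\<in>Q. Y t"
  assumes q: "\<And>t. t \<in> Q \<Longrightarrow> quasi_norm (Y t) (M t)"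
    and zero: "\<And>t. t \<in> Q \<Longrightarrow> (\<lambda>_. 0) \<in> Y t"
    and lin: "\<And>f g a b. f \<in> E \<Longrightarrow> g \<in> E \<Longrightarrow> (\<lambda>i. a * f i + b * g i) \<in> E"
    and bound: "\<And>t. t \<in> Q \<Longrightarrow> \<exists>C>0. \<forall>f\<in>Y t. norm (f z) \<le> C * M t f"
  shows "continuous_map (inductive_limit_topology Q (\<lambda>t. norm_topology (Y t) (M t))) euclidean (\<lambda>f. f z)"
    (is "continuous_map ?T _ _")
proof -
  have T: "topspace ?T = E"
    using topspace_inductive_limit[of Q "\<lambda>t. norm_topology (Y t) (M t)"] zero lin
    unfolding topspace_norm_topology E_def by blast
  have nbhd: "ind_lim_nbhd Q (\<lambda>t. norm_topology (Y t) (M t)) {g \<in> E. norm (g z) < \<epsilon>}" if "\<epsilon> > 0" for \<epsilon>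
    unfolding ind_lim_nbhd_def
  proof (intro conjI ballI)
    show "{g \<in> E. norm (g z) < \<epsilon>} \<subseteq> (\<Union>t\<in>Q. topspace (norm_topology (Y t) (M t)))"
      by (auto simp: E_def)
    have "norm (a * f z + b * g z) < \<epsilon>"
      if "norm (f z) < \<epsilon>" "norm (g z) < \<epsilon>" "norm a + norm b \<le> 1" for f g :: "'j \<Rightarrow> complex" and a b
    proof -
      define m where "m = max (norm (f z)) (norm (g z))"
      have "norm (a * f z + b * g z) \<le> norm a * norm (f z) + norm b * norm (g z)"
        by (metis norm_mult norm_triangle_ineq)
      also have "\<dots> \<le> norm a * m + norm b * m"
        by (intro add_mono mult_left_mono) (auto simp: m_def)
      also have "\<dots> \<le> 1 * m"
        unfolding distrib_right[symmetric]
        by (intro mult_right_mono that) (auto simp: m_def le_max_iff_disj)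
      also have "\<dots> < \<epsilon>" using that by (simp add: m_def)
      finally show ?thesis .
    qed
    then show "abs_convex {g \<in> E. norm (g z) < \<epsilon>}" unfolding abs_convex_def using lin by blast
    fix t assume t: "t \<in> Q"
    obtain C where C: "C > 0" "\<And>f. f \<in> Y t \<Longrightarrow> norm (f z) \<le> C * M t f" using bound[OF t] by blast
    show "\<exists>W. openin (norm_topology (Y t) (M t)) W \<and> (\<lambda>_. 0) \<in> W \<and> W \<subseteq> {g \<in> E. norm (g z) < \<epsilon>}"
    proof (rule norm_topology_ball_nbhd[OF q[OF t] zero[OF t]])
      show "\<epsilon> / C > 0" using C \<open>\<epsilon> > 0\<close> by simp
      fix g assume g: "g \<in> Y t" "M t (\<lambda>i. g i - 0) < \<epsilon> / C"
      have "norm (g z) \<le> C * M t g" by (rule C(2)[OF g(1)])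
      also have "\<dots> < \<epsilon>" using g(2) C(1) by (simp add: field_simps)
      finally show "g \<in> {g \<in> E. norm (g z) < \<epsilon>}" using g(1) t by (auto simp: E_def)
    qed
  qed
  show ?thesis
    unfolding continuous_map_def T
  proof (intro conjI allI impI)
    fix U :: "complex set" assume "openin euclidean U"
    then have U: "open U" by simp
    show "openin ?T {f \<in> E. f z \<in> U}"
      unfolding openin_inductive_limit
    proof (intro conjI ballI)
      show "{f \<in> E. f z \<in> U} \<subseteq> (\<Union>t\<in>Q. topspace (norm_topology (Y t) (M t)))"
        by (auto simp: E_def)
      fix f assume f: "f \<in> {f \<in> E. f z \<in> U}"
      then obtain \<epsilon> where e: "\<epsilon> > 0" "\<And>w. dist w (f z) < \<epsilon> \<Longrightarrow> w \<in> U"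
        using U unfolding open_dist by blast
      have "(\<lambda>i. f i + g i) \<in> {f \<in> E. f z \<in> U}" if "g \<in> {g \<in> E. norm (g z) < \<epsilon>}" for g
        using that f lin[of f g 1 1] e(2)[of "f z + g z"] by (simp add: dist_norm)
      with nbhd[OF e(1)] show "\<exists>V. ind_lim_nbhd Q (\<lambda>t. norm_topology (Y t) (M t)) V \<and>
          (\<forall>g\<in>V. (\<lambda>i. f i + g i) \<in> {f \<in> E. f z \<in> U})" by blast
    qed
  qed simp
qed

lemma continuous_map_eval_projective_limit:
  fixes Y :: "'q \<Rightarrow> ('j \<Rightarrow> complex) set"
  assumes "t \<in> Q" and q: "quasi_norm (Y t) (M t)" and "C > 0"
    and bound: "\<And>f g. f \<in> Y t \<Longrightarrow> g \<in> Y t \<Longrightarrow> norm (g z - f z) \<le> C * M t (\<lambda>i. g i - f i)"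
  shows "continuous_map (projective_limit_topology Q (\<lambda>t. norm_topology (Y t) (M t))) euclidean (\<lambda>f. f z)"
    (is "continuous_map ?T _ _")
proof -
  have "Q \<noteq> {}" using \<open>t \<in> Q\<close> by blast
  from topspace_projective_limit[OF this, of "\<lambda>t. norm_topology (Y t) (M t)"]
  have T: "topspace ?T = (\<Inter>t\<in>Q. Y t)" by simp
  show ?thesis
    unfolding continuous_map_def T
  proof (intro conjI allI impI)
    fix U :: "complex set" assume "openin euclidean U"
    then have U: "open U" by simp
    show "openin ?T {f \<in> (\<Inter>t\<in>Q. Y t). f z \<in> U}"
    proof (subst openin_subopen, intro ballI)
      fix f assume f: "f \<in> {f \<in> (\<Inter>t\<in>Q. Y t). f z \<in> U}"
      then obtain \<epsilon> where e: "\<epsilon> > 0" "\<And>w. dist w (f z) < \<epsilon> \<Longrightarrow> w \<in> U"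
        using U unfolding open_dist by blast
      have ft: "f \<in> Y t" using f \<open>t \<in> Q\<close> by blast
      have "\<exists>A. openin (norm_topology (Y t) (M t)) A \<and> f \<in> A \<and> A \<subseteq> {g. g z \<in> U}"
      proof (rule norm_topology_ball_nbhd[OF q ft])
        show "\<epsilon> / C > 0" using e \<open>C > 0\<close> by simp
        fix g assume g: "g \<in> Y t" "M t (\<lambda>i. g i - f i) < \<epsilon> / C"
        have "norm (g z - f z) \<le> C * M t (\<lambda>i. g i - f i)" by (rule bound[OF ft g(1)])
        also have "\<dots> < \<epsilon>" using g(2) \<open>C > 0\<close> by (simp add: field_simps)
        finally show "g \<in> {g. g z \<in> U}" using e(2) by (simp add: dist_norm)
      qed
      then obtain A where A: "openin (norm_topology (Y t) (M t)) A" "f \<in> A" "A \<subseteq> {g. g z \<in> U}" by blast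
      have "openin ?T (A \<inter> (\<Inter>t\<in>Q. Y t))"
        using openin_projective_limit_step[where T = "\<lambda>t. norm_topology (Y t) (M t)", OF \<open>t \<in> Q\<close> A(1)]
        by simp
      then show "\<exists>A. openin ?T A \<and> f \<in> A \<and> A \<subseteq> {f \<in> (\<Inter>t\<in>Q. Y t). f z \<in> U}"
        using A f by (intro exI[of _ "A \<inter> (\<Inter>t\<in>Q. Y t)"]) auto
    qed
  qed simp
qed

text \<open>
  Two homeomorphisms that agree on a sequentially dense set agree after composition with every point
  evaluation, hence everywhere.
\<close>

lemma extends_uniquely_by_density:
  fixes \<Phi> :: "'a \<Rightarrow> 'z \<Rightarrow> complex"
  assumes maps: "homeomorphic_maps X Y \<Phi> \<Psi>"
    and S: "S \<subseteq> topspace X" and agree: "\<And>x. x \<in> S \<Longrightarrow> \<Phi> x = f x"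
    and dense: "\<And>x. x \<in> topspace X \<Longrightarrow> \<exists>u. (\<forall>n. u n \<in> S) \<and> limitin X u x sequentially"
    and eval: "\<And>z. continuous_map Y euclidean (\<lambda>F. F z)"
  shows "extends_uniquely_to_homeomorphism f S X Y"
  unfolding extends_uniquely_to_homeomorphism_def
proof (intro conjI ex1I)
  show "S \<subseteq> topspace X" by (rule S)
  have \<Phi>: "homeomorphic_map X Y \<Phi>" using maps homeomorphic_maps_map by blast
  let ?\<Phi> = "restrict \<Phi> (topspace X)"
  show "?\<Phi> \<in> extensional (topspace X)" by simp
  show "homeomorphic_map X Y ?\<Phi>" by (rule homeomorphic_map_eq[OF \<Phi>]) simp
  show "\<forall>x\<in>S. ?\<Phi> x = f x" using S agree by auto
  fix \<Theta>
  assume \<Theta>: "\<Theta> \<in> extensional (topspace X) \<and> homeomorphic_map X Y \<Theta> \<and> (\<forall>x\<in>S. \<Theta> x = f x)"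
  have ev: "continuous_map X euclidean (\<lambda>x. \<Xi> x z)" if "homeomorphic_map X Y \<Xi>" for \<Xi> z
    using continuous_map_compose[OF homeomorphic_imp_continuous_map[OF that] eval[of z]]
    by (simp add: o_def)
  have "\<Theta> x = \<Phi> x" if x: "x \<in> topspace X" for x
  proof
    fix z
    obtain u where u: "\<And>n. u n \<in> S" "limitin X u x sequentially" using dense[OF x] by blast
    have "(\<lambda>n. \<Xi> (u n) z) \<longlonglongrightarrow> \<Xi> x z" if "homeomorphic_map X Y \<Xi>" for \<Xi>
      using continuous_map_limit[OF ev[OF that, of z] u(2)] by (simp add: o_def)
    from this[of \<Theta>] this[OF \<Phi>] \<Theta> u(1) agree
    have "(\<lambda>n. f (u n) z) \<longlonglongrightarrow> \<Theta> x z" "(\<lambda>n. f (u n) z) \<longlonglongrightarrow> \<Phi> x z" by auto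
    then show "\<Theta> x z = \<Phi> x z" by (rule LIMSEQ_unique)
  qed
  with \<Theta> show "\<Theta> = ?\<Phi>" by (auto simp: restrict_def extensional_def fun_eq_iff)
qed

section \<open>Sums over multi-indices\<close>

definition coord_upd :: "'a ^ 'd::finite \<Rightarrow> 'd \<Rightarrow> 'a \<Rightarrow> 'a ^ 'd" where
  "coord_upd z i w = (\<chi> j. if j = i then w else z $ j)"

lemma coord_upd_nth [simp]: "coord_upd z i w $ j = (if j = i then w else z $ j)"
  by (simp add: coord_upd_def)

lemma coord_upd_upd [simp]: "coord_upd (coord_upd z i v) i w = coord_upd z i w"
  by (simp add: vec_eq_iff)

lemma coord_upd_same [simp]: "coord_upd z i (z $ i) = z"
  by (simp add: vec_eq_iff)

lemma coord_upd_commute: "i \<noteq> j \<Longrightarrow> coord_upd (coord_upd z i v) j w = coord_upd (coord_upd z j w) i v"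
  by (simp add: vec_eq_iff)

definition multi_indices_on :: "'d::finite set \<Rightarrow> (nat ^ 'd) set" where
  "multi_indices_on S = {\<alpha>. \<forall>j. j \<notin> S \<longrightarrow> \<alpha> $ j = 0}"

lemma multi_indices_on_UNIV [simp]: "multi_indices_on UNIV = UNIV"
  by (simp add: multi_indices_on_def)

lemma multi_indices_on_empty [simp]: "multi_indices_on {} = {0}"
  by (auto simp: multi_indices_on_def vec_eq_iff)

text \<open>
  This bijection reduces sums over multi-indices to iterated sums, one coordinate at a time; all
  inductions over coordinates below rest on it.
\<close>

lemma bij_betw_multi_indices_insert:
  assumes "i \<notin> S"
  shows "bij_betw (\<lambda>(n, \<beta>). coord_upd \<beta> i n) (UNIV \<times> multi_indices_on S)
           (multi_indices_on (insert i S))"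
proof (rule bij_betw_byWitness[where f' = "\<lambda>\<alpha>. (\<alpha> $ i, coord_upd \<alpha> i 0)"])
  have "coord_upd \<beta> i 0 = \<beta>" if "\<beta> \<in> multi_indices_on S" for \<beta>
    using that assms by (auto simp: multi_indices_on_def vec_eq_iff)
  then show "\<forall>a\<in>UNIV \<times> multi_indices_on S.
      ((case a of (n, \<beta>) \<Rightarrow> coord_upd \<beta> i n) $ i, coord_upd (case a of (n, \<beta>) \<Rightarrow> coord_upd \<beta> i n) i 0) = a"
    by auto
qed (auto simp: multi_indices_on_def)

lemma prod_coord_upd_insert:
  fixes g :: "'d::finite \<Rightarrow> nat \<Rightarrow> 'a::comm_monoid_mult"
  assumes "i \<notin> S"
  shows "(\<Prod>j\<in>insert i S. g j (coord_upd \<beta> i n $ j)) = g i n * (\<Prod>j\<in>S. g j (\<beta> $ j))"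
proof -
  have "(\<Prod>j\<in>S. g j (coord_upd \<beta> i n $ j)) = (\<Prod>j\<in>S. g j (\<beta> $ j))"
    using assms by (intro prod.cong) auto
  then show ?thesis using assms by (simp add: finite_subset[OF subset_UNIV])
qed

text \<open>
  A sum of products over all multi-indices factorises. It is the source of every convergence statement
  about multi-index sums in this development.
\<close>

lemma has_sum_multi_indices_prod:
  fixes f :: "'d::finite \<Rightarrow> nat \<Rightarrow> real"
  assumes nonneg: "\<And>j n. f j n \<ge> 0" and f: "\<And>j. (f j has_sum F j) UNIV"
  shows "((\<lambda>\<alpha>. \<Prod>j\<in>S. f j (\<alpha> $ j)) has_sum (\<Prod>j\<in>S. F j)) (multi_indices_on S)"
proof (induction S rule: finite_induct[OF finite_subset[OF subset_UNIV finite_class.finite_UNIV]])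
  case 1
  show ?case by (rule has_sum_finiteI) simp_all
next
  case (2 i S)
  let ?P = "\<lambda>\<beta>. \<Prod>j\<in>S. f j (\<beta> $ j)"
  have inner: "((\<lambda>\<beta>. (\<lambda>(n, \<beta>). f i n * ?P \<beta>) (n, \<beta>)) has_sum (f i n * (\<Prod>j\<in>S. F j)))
      (multi_indices_on S)" for n
    using has_sum_cmult_right[OF 2(3)] by simp
  have outer: "((\<lambda>n. f i n * (\<Prod>j\<in>S. F j)) has_sum (F i * (\<Prod>j\<in>S. F j))) UNIV"
    using has_sum_cmult_left[OF f] by simp
  have "(\<lambda>(n, \<beta>). f i n * ?P \<beta>) summable_on (UNIV \<times> multi_indices_on S)"
    by (rule summable_on_SigmaI[OF inner has_sum_imp_summable[OF outer]])
      (auto intro!: mult_nonneg_nonneg prod_nonneg nonneg)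
  from has_sum_SigmaI[OF inner outer this]
  have "((\<lambda>x. \<Prod>j\<in>insert i S. f j ((\<lambda>(n, \<beta>). coord_upd \<beta> i n) x $ j)) has_sum (F i * (\<Prod>j\<in>S. F j)))
      (UNIV \<times> multi_indices_on S)"
    by (rule has_sum_cong[THEN iffD1, rotated]) (auto simp: prod_coord_upd_insert[OF 2(2), of f] simp del: coord_upd_nth)
  from has_sum_reindex_bij_betw[OF bij_betw_multi_indices_insert[OF 2(2)], THEN iffD1, OF this]
  show ?case using 2 by simp
qed

section \<open>Power series of entire functions of several variables\<close>

lemma norm_le_sum_norm_nth: "norm (z :: complex ^ 'd::finite) \<le> (\<Sum>j\<in>UNIV. norm (z $ j))"
  unfolding norm_vec_def by (rule L2_set_le_sum) simp

lemma norm_coord_upd_le: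
  fixes z :: "complex ^ 'd::finite"
  shows "norm (coord_upd z i w) \<le> norm z + norm w"
proof -
  have "norm (coord_upd z i 0) \<le> norm z" by (rule norm_le_componentwise_cart) simp
  moreover have "coord_upd z i w = coord_upd z i 0 + axis i w" by (simp add: vec_eq_iff axis_def)
  moreover have "norm (axis i w :: complex ^ 'd) \<le> norm w"
    using norm_le_sum_norm_nth[of "axis i w :: complex ^ 'd"]
    by (simp add: axis_def if_distrib[of norm] cong: if_cong)
  ultimately show ?thesis using norm_triangle_ineq[of "coord_upd z i 0" "axis i w"] by simp
qed

lemma continuous_on_coord_upd [continuous_intros]:
  assumes "continuous_on A f" "continuous_on A g"
  shows "continuous_on A (\<lambda>x. coord_upd (f x) i (g x) :: complex ^ 'd::finite)"
  unfolding coord_upd_def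
proof (rule continuous_on_vec_lambda)
  fix j
  show "continuous_on A (\<lambda>x. if j = i then g x else f x $ j)"
    by (cases "j = i") (simp_all add: assms continuous_on_component)
qed

lemma continuous_bounded_on_cball:
  fixes F :: "'a::euclidean_space \<Rightarrow> 'b::real_normed_vector"
  assumes "continuous_on UNIV F"
  obtains M where "M > 0" "\<And>z. norm z \<le> B \<Longrightarrow> norm (F z) \<le> M"
proof -
  have "compact (F ` cball 0 B)"
    using assms by (intro compact_continuous_image) (auto intro: continuous_on_subset)
  then have "bounded (F ` cball 0 B)" by (rule compact_imp_bounded)
  then obtain M where "M > 0" "\<forall>x\<in>F ` cball 0 B. norm x \<le> M" unfolding bounded_pos by blast
  then show thesis by (intro that[of M]) auto
qed

text \<open>
  Unlike total differentiability, this property passes easily to partial derivatives and to the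
  Taylor coefficients in one variable, which makes the expansion by induction over the variables possible.
\<close>

definition separately_holomorphic :: "(complex ^ 'd::finite \<Rightarrow> complex) \<Rightarrow> bool" where
  "separately_holomorphic F \<longleftrightarrow>
     continuous_on UNIV F \<and> (\<forall>i z. (\<lambda>w. F (coord_upd z i w)) holomorphic_on UNIV)"

definition partial_deriv :: "'d::finite \<Rightarrow> (complex ^ 'd \<Rightarrow> complex) \<Rightarrow> complex ^ 'd \<Rightarrow> complex" where
  "partial_deriv i F z = deriv (\<lambda>w. F (coord_upd z i w)) (z $ i)"

text \<open>
  Cauchy's inequality on discs of radius 1 bounds the second derivative by \<open>2M\<close>; the rest is Taylor's
  formula. The point is uniformity in \<open>f\<close>: only the bound \<open>M\<close> enters.
\<close>

lemma difference_quotient_bound: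
  assumes f: "f holomorphic_on UNIV" and M: "\<And>w. w \<in> cball a 2 \<Longrightarrow> norm (f w) \<le> M"
    and h: "h \<noteq> 0" "norm h \<le> 1"
  shows "norm ((f (a + h) - f a) / h - deriv f a) \<le> 2 * M * norm h"
proof -
  have hol: "f holomorphic_on A" for A using f by (rule holomorphic_on_subset) simp
  have hol': "(deriv ^^ i) f holomorphic_on UNIV" for i
    using f by (rule holomorphic_higher_deriv) simp
  have "norm ((deriv ^^ 0) f (a + h) - (\<Sum>i\<le>1. (deriv ^^ i) f a * ((a + h) - a) ^ i / fact i))
      \<le> 2 * M * norm ((a + h) - a) ^ Suc 1 / fact 1"
  proof (rule complex_Taylor[where S = "cball a 1" and f = "\<lambda>i. (deriv ^^ i) f"])
    fix i x
    show "((deriv ^^ i) f has_field_derivative (deriv ^^ Suc i) f x) (at x within cball a 1)"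
      using holomorphic_derivI[OF hol'[of i] open_UNIV UNIV_I, of x]
      by (simp add: has_field_derivative_at_within)
  next
    fix x assume x: "x \<in> cball a 1"
    have "norm ((deriv ^^ 2) f x) \<le> fact 2 * M / 1 ^ 2"
    proof (rule Cauchy_inequality)
      fix w assume "norm (x - w) = 1"
      then have "w \<in> cball a 2"
        using x norm_triangle_ineq[of "a - x" "x - w"] by (simp add: dist_norm)
      then show "norm (f w) \<le> M" by (rule M)
    qed (use hol holomorphic_on_imp_continuous_on in auto)
    then show "cmod ((deriv ^^ Suc 1) f x) \<le> 2 * M" by (simp add: numeral_2_eq_2)
  qed (use h in \<open>auto simp: dist_norm\<close>)
  then have "norm (f (a + h) - f a - deriv f a * h) \<le> 2 * M * (norm h)\<^sup>2"
    by (simp add: algebra_simps power2_eq_square)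
  moreover have "(f (a + h) - f a) / h - deriv f a = (f (a + h) - f a - deriv f a * h) / h"
    using h by (simp add: field_simps)
  ultimately show ?thesis
    using h by (simp add: norm_divide divide_le_eq power2_eq_square mult.assoc)
qed

text \<open>
  A partial derivative is the limit of difference quotients along \<open>h = 1 / (n + 1)\<close>, and by the previous
  lemma this limit is uniform on bounded sets. Uniform limits preserve both continuity and
  holomorphy in each variable.
\<close>

lemma separately_holomorphic_partial_deriv:
  fixes F :: "complex ^ 'd::finite \<Rightarrow> complex"
  assumes F: "separately_holomorphic F"
  shows "separately_holomorphic (partial_deriv i F)"
proof -
  have cont: "continuous_on A F" for A
    using F unfolding separately_holomorphic_def by (blast intro: continuous_on_subset)
  have hol: "(\<lambda>w. F (coord_upd z j w)) holomorphic_on A" for z j A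
    using F unfolding separately_holomorphic_def by (blast intro: holomorphic_on_subset)
  define h where "h n = complex_of_real (1 / (real n + 1))" for n
  have h: "h n \<noteq> 0" "norm (h n) \<le> 1" for n
  proof -
    have "real n + 1 > 0" by simp
    then have "0 < 1 / (real n + 1)" "1 / (real n + 1) \<le> 1" by simp_all
    then show "h n \<noteq> 0" "norm (h n) \<le> 1"
      unfolding h_def norm_of_real of_real_eq_0_iff by simp_all
  qed
  have h0: "(\<lambda>n. norm (h n)) \<longlonglongrightarrow> 0"
  proof -
    have "norm (h n) = 1 / (real n + 1)" for n unfolding h_def norm_of_real by simp
    then show ?thesis using LIMSEQ_inverse_real_of_nat by (simp add: inverse_eq_divide add.commute)
  qed
  define D where "D n z = (F (coord_upd z i (z $ i + h n)) - F z) / h n" for n z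
  have lim: "uniform_limit (cball 0 B) D (partial_deriv i F) sequentially" for B
  proof (rule uniform_limitI)
    fix e :: real assume e: "e > 0"
    obtain M where M: "M > 0" "\<And>z. norm z \<le> 2 * \<bar>B\<bar> + 2 \<Longrightarrow> norm (F z) \<le> M"
      using continuous_bounded_on_cball[OF cont] by blast
    have "\<forall>\<^sub>F n in sequentially. norm (h n) < e / (2 * M)"
      using order_tendstoD(2)[OF h0] e M by simp
    then show "\<forall>\<^sub>F n in sequentially. \<forall>z\<in>cball 0 B. dist (D n z) (partial_deriv i F z) < e"
    proof eventually_elim
      case (elim n)
      show ?case
      proof
        fix z :: "complex ^ 'd" assume z: "z \<in> cball 0 B"
        have "norm ((F (coord_upd z i (z $ i + h n)) - F (coord_upd z i (z $ i))) / h n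
            - deriv (\<lambda>w. F (coord_upd z i w)) (z $ i)) \<le> 2 * M * norm (h n)"
        proof (rule difference_quotient_bound[OF hol _ h])
          fix w assume w: "w \<in> cball (z $ i) 2"
          have "norm w \<le> norm (z $ i) + 2"
            using w norm_triangle_ineq2[of w "z $ i"] by (simp add: dist_norm norm_minus_commute)
          also have "norm (z $ i) \<le> norm z" by (rule Finite_Cartesian_Product.norm_nth_le)
          finally show "norm (F (coord_upd z i w)) \<le> M"
            using z norm_coord_upd_le[of z i w] by (intro M(2)) simp
        qed
        also have "\<dots> < e" using elim M e by (simp add: field_simps)
        finally show "dist (D n z) (partial_deriv i F z) < e"
          by (simp add: dist_norm D_def partial_deriv_def)
      qed
    qed
  qed
  have contD: "continuous_on A (D n)" for A n
    unfolding D_def using h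
    by (intro continuous_intros continuous_on_compose2[OF cont[of UNIV]] cont) auto
  have holD: "(\<lambda>w. D n (coord_upd z j w)) holomorphic_on UNIV" for n z j
  proof (cases "j = i")
    case True
    have "(\<lambda>w. w + h n) holomorphic_on UNIV" by (intro holomorphic_intros)
    from holomorphic_on_compose[OF this hol]
    have "(\<lambda>w. F (coord_upd z i (w + h n))) holomorphic_on UNIV" by (simp add: o_def)
    then have "(\<lambda>w. (F (coord_upd z i (w + h n)) - F (coord_upd z i w)) / h n) holomorphic_on UNIV"
      using h by (intro holomorphic_intros hol) auto
    then show ?thesis unfolding D_def using True by simp
  next
    case False
    have "(\<lambda>w. (F (coord_upd (coord_upd z i (z $ i + h n)) j w) - F (coord_upd z j w)) / h n)
        holomorphic_on UNIV"
      using h by (intro holomorphic_intros hol) auto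
    then show ?thesis unfolding D_def using False by (simp add: coord_upd_commute[of i j])
  qed
  show ?thesis
    unfolding separately_holomorphic_def
  proof (intro conjI allI)
    have "isCont (partial_deriv i F) z" for z
    proof -
      have "continuous_on (cball 0 (norm z + 1)) (partial_deriv i F)"
        by (rule uniform_limit_theorem[OF _ lim]) (use contD in auto)
      then show ?thesis
        by (rule continuous_on_interior) (simp add: interior_cball)
    qed
    then show "continuous_on UNIV (partial_deriv i F)" by (simp add: continuous_at_imp_continuous_on)
    fix j and z :: "complex ^ 'd"
    show "(\<lambda>w. partial_deriv i F (coord_upd z j w)) holomorphic_on UNIV"
    proof (rule holomorphic_uniform_sequence[OF open_UNIV holD])
      fix x :: complex
      have "uniform_limit (cball x 1) (\<lambda>n w. D n (coord_upd z j w))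
          (\<lambda>w. partial_deriv i F (coord_upd z j w)) sequentially"
      proof (rule uniform_limitI)
        fix e :: real assume "e > 0"
        have sub: "coord_upd z j w \<in> cball 0 (norm z + (norm x + 1))" if "w \<in> cball x 1" for w
        proof -
          have "norm w \<le> norm x + 1"
            using that norm_triangle_ineq2[of w x] by (simp add: dist_norm norm_minus_commute)
          then show ?thesis using norm_coord_upd_le[of z j w] by simp
        qed
        have "\<forall>\<^sub>F n in sequentially. \<forall>y\<in>cball 0 (norm z + (norm x + 1)). dist (D n y) (partial_deriv i F y) < e"
          using uniform_limitD[OF lim \<open>e > 0\<close>] .
        then show "\<forall>\<^sub>F n in sequentially. \<forall>w\<in>cball x 1.
            dist (D n (coord_upd z j w)) (partial_deriv i F (coord_upd z j w)) < e"
          by (rule eventually_mono) (use sub in blast)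
      qed
      then show "\<exists>d>0. cball x d \<subseteq> UNIV \<and> uniform_limit (cball x d) (\<lambda>n w. D n (coord_upd z j w))
          (\<lambda>w. partial_deriv i F (coord_upd z j w)) sequentially"
        by (intro exI[of _ 1]) simp
    qed
  qed
qed

definition taylor_slice :: "'d::finite \<Rightarrow> nat \<Rightarrow> (complex ^ 'd \<Rightarrow> complex) \<Rightarrow> complex ^ 'd \<Rightarrow> complex" where
  "taylor_slice i n F z = (deriv ^^ n) (\<lambda>w. F (coord_upd z i w)) 0 / fact n"

lemma funpow_partial_deriv:
  "(partial_deriv i ^^ n) F z = (deriv ^^ n) (\<lambda>w. F (coord_upd z i w)) (z $ i)"
proof (induction n arbitrary: z)
  case (Suc n)
  then have "(partial_deriv i ^^ Suc n) F z =
      deriv (\<lambda>w. (deriv ^^ n) (\<lambda>v. F (coord_upd (coord_upd z i w) i v)) (coord_upd z i w $ i)) (z $ i)"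
    unfolding funpow.simps(2) o_apply partial_deriv_def[of i "(partial_deriv i ^^ n) F"] by simp
  then show ?case by simp
qed simp

lemma separately_holomorphic_taylor_slice:
  fixes F :: "complex ^ 'd::finite \<Rightarrow> complex"
  assumes "separately_holomorphic F"
  shows "separately_holomorphic (taylor_slice i n F)"
proof -
  have "separately_holomorphic ((partial_deriv i ^^ n) F)"
    by (induction n) (use assms separately_holomorphic_partial_deriv in auto)
  then have G: "continuous_on UNIV ((partial_deriv i ^^ n) F)"
    "\<And>j z. (\<lambda>w. (partial_deriv i ^^ n) F (coord_upd z j w)) holomorphic_on UNIV"
    unfolding separately_holomorphic_def by auto
  have eq: "taylor_slice i n F z = (partial_deriv i ^^ n) F (coord_upd z i 0) / fact n" for z
    by (simp add: taylor_slice_def funpow_partial_deriv)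
  show ?thesis
    unfolding separately_holomorphic_def eq
  proof (intro conjI allI)
    show "continuous_on UNIV (\<lambda>z. (partial_deriv i ^^ n) F (coord_upd z i 0) / fact n)"
      by (intro continuous_intros continuous_on_compose2[OF G(1)]) auto
    fix j and z :: "complex ^ 'd"
    show "(\<lambda>w. (partial_deriv i ^^ n) F (coord_upd (coord_upd z j w) i 0) / fact n) holomorphic_on UNIV"
    proof (cases "j = i")
      case True
      then show ?thesis by simp
    next
      case False
      then have "(\<lambda>w. (partial_deriv i ^^ n) F (coord_upd (coord_upd z j w) i 0) / fact n) =
          (\<lambda>w. (partial_deriv i ^^ n) F (coord_upd (coord_upd z i 0) j w) / fact n)"
        by (simp add: coord_upd_commute[of j i])
      then show ?thesis by (auto intro!: holomorphic_intros G)
    qed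
  qed
qed

text \<open>
  The radius 0 is admitted, with the convention \<open>0 ^ 0 = 1\<close>. This spares a case distinction later, where
  the radii are chosen as \<open>sqrt (\<alpha> $ j)\<close>.
\<close>

lemma Cauchy_inequality_taylor_slice:
  fixes F :: "complex ^ 'd::finite \<Rightarrow> complex"
  assumes F: "separately_holomorphic F" and "\<rho> \<ge> 0"
    and M: "\<And>w. norm w = \<rho> \<Longrightarrow> norm (F (coord_upd z i w)) \<le> M"
  shows "norm (taylor_slice i n F z) * \<rho> ^ n \<le> M"
proof -
  have hol: "(\<lambda>w. F (coord_upd z i w)) holomorphic_on A" for A
    using F unfolding separately_holomorphic_def by (blast intro: holomorphic_on_subset)
  have "norm (F (coord_upd z i (of_real \<rho>))) \<le> M" by (rule M) (simp add: \<open>\<rho> \<ge> 0\<close>)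
  then have "M \<ge> 0" by (rule order_trans[OF norm_ge_zero])
  show ?thesis
  proof (cases "\<rho> = 0")
    case True
    then show ?thesis using M[of 0] \<open>M \<ge> 0\<close> by (cases n) (auto simp: taylor_slice_def)
  next
    case False
    then have "\<rho> > 0" using \<open>\<rho> \<ge> 0\<close> by simp
    have "norm ((deriv ^^ n) (\<lambda>w. F (coord_upd z i w)) 0) \<le> fact n * M / \<rho> ^ n"
      by (rule Cauchy_inequality) (use hol \<open>\<rho> > 0\<close> M holomorphic_on_imp_continuous_on in auto)
    then show ?thesis using \<open>\<rho> > 0\<close> by (simp add: taylor_slice_def norm_divide field_simps)
  qed
qed

lemma summable_on_multi_indices_geometric:
  fixes x :: "'d::finite \<Rightarrow> real"
  assumes "\<And>j. 0 \<le> x j" "\<And>j. x j < 1"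
  shows "(\<lambda>\<alpha>. \<Prod>j\<in>S. x j ^ (\<alpha> $ j)) summable_on multi_indices_on S"
proof (rule has_sum_imp_summable, rule has_sum_multi_indices_prod[where f = "\<lambda>j n. x j ^ n"])
  fix j
  show "((\<lambda>n. x j ^ n) has_sum (1 / (1 - x j))) UNIV"
    by (rule norm_summable_imp_has_sum) (use assms[of j] geometric_sums[of "x j"] in \<open>auto simp: norm_power\<close>)
qed (use assms in simp)

text \<open>
  Induction over the set \<open>S\<close> of active variables. In the induction step \<open>F\<close> is expanded in the new
  variable \<open>z $ i\<close>, and the induction hypothesis expands each Taylor coefficient in the remaining ones.
  Cauchy's inequality is carried through the induction for two reasons: applied on a torus of larger
  radius it yields the absolute convergence that allows the iterated sum to be rewritten as a single
  sum, and it is the estimate for coefficients that the growth conditions will be fed into. It is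
  stated on the torus, not on the polydisc, because the weights for \<open>s \<ge> 1/2\<close> decay in \<open>|z|\<close> relative to
  the Gaussian factor and are evaluated exactly on a torus.
\<close>

lemma separately_holomorphic_power_series_on:
  fixes F :: "complex ^ 'd::finite \<Rightarrow> complex"
  assumes "separately_holomorphic F"
  shows "\<exists>c. (\<forall>z. (\<forall>j. j \<notin> S \<longrightarrow> z $ j = 0) \<longrightarrow>
             ((\<lambda>\<alpha>. c \<alpha> * (\<Prod>j\<in>S. z $ j ^ (\<alpha> $ j))) has_sum F z) (multi_indices_on S)) \<and>
           (\<forall>\<rho> M. (\<forall>j. \<rho> j \<ge> 0) \<longrightarrow>
             (\<forall>z. (\<forall>j\<in>S. norm (z $ j) = \<rho> j) \<and> (\<forall>j. j \<notin> S \<longrightarrow> z $ j = 0) \<longrightarrow> norm (F z) \<le> M) \<longrightarrow>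
             (\<forall>\<alpha>\<in>multi_indices_on S. norm (c \<alpha>) * (\<Prod>j\<in>S. \<rho> j ^ (\<alpha> $ j)) \<le> M))"
    (is "\<exists>c. ?expansion S F c \<and> ?Cauchy S F c")
  using finite_subset[OF subset_UNIV finite_class.finite_UNIV, of S] assms
proof (induction S arbitrary: F rule: finite_induct)
  case empty
  have "?expansion {} F (\<lambda>_. F 0)"
  proof (intro allI impI)
    fix z :: "complex ^ 'd" assume "\<forall>j. j \<notin> {} \<longrightarrow> z $ j = 0"
    then have "z = 0" by (simp add: vec_eq_iff)
    show "((\<lambda>\<alpha>. F 0 * (\<Prod>j\<in>{}. z $ j ^ (\<alpha> $ j))) has_sum F z) (multi_indices_on {})"
      unfolding \<open>z = 0\<close> by (rule has_sum_finiteI) simp_all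
  qed
  moreover have "?Cauchy {} F (\<lambda>_. F 0)"
  proof (intro allI impI ballI)
    fix \<rho> M and \<alpha> :: "nat ^ 'd"
    assume "\<forall>z. (\<forall>j\<in>{}. norm (z $ j) = \<rho> j) \<and> (\<forall>j. j \<notin> {} \<longrightarrow> z $ j = 0) \<longrightarrow> norm (F z) \<le> M"
    then have "norm (F 0) \<le> M" by (elim allE[of _ 0]) simp
    then show "norm (F 0) * (\<Prod>j\<in>{}. \<rho> j ^ (\<alpha> $ j)) \<le> M" by simp
  qed
  ultimately have "?expansion {} F (\<lambda>_. F 0) \<and> ?Cauchy {} F (\<lambda>_. F 0)" by (rule conjI)
  then show ?case by (rule exI[of _ "\<lambda>_. F 0"])
next
  case (insert i S)
  let ?G = "\<lambda>n. taylor_slice i n F"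
  have "\<exists>c. ?expansion S (?G n) c \<and> ?Cauchy S (?G n) c" for n
    by (rule insert.IH) (rule separately_holomorphic_taylor_slice[OF insert.prems])
  then have "\<exists>c'. \<forall>n. ?expansion S (?G n) (c' n) \<and> ?Cauchy S (?G n) (c' n)"
    by (intro choice allI)
  then obtain c' where c': "\<And>n. ?expansion S (?G n) (c' n)" "\<And>n. ?Cauchy S (?G n) (c' n)"
    by blast
  define c where "c \<alpha> = c' (\<alpha> $ i) (coord_upd \<alpha> i 0)" for \<alpha>
  have c_upd: "c (coord_upd \<beta> i n) = c' n \<beta>" if "\<beta> \<in> multi_indices_on S" for \<beta> n
  proof -
    have "coord_upd \<beta> i 0 = \<beta>"
      using that insert.hyps by (auto simp: multi_indices_on_def vec_eq_iff)
    then show ?thesis by (simp add: c_def)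
  qed
  note bij = bij_betw_multi_indices_insert[OF insert.hyps(2)]
  have hol: "(\<lambda>w. F (coord_upd z i w)) holomorphic_on A" for z A
    using insert.prems unfolding separately_holomorphic_def by (blast intro: holomorphic_on_subset)
  have Cauchy: "?Cauchy (insert i S) F c"
  proof (intro allI impI ballI)
    fix \<rho> M \<alpha>
    assume \<rho>: "\<forall>j. \<rho> j \<ge> (0::real)" and \<alpha>: "\<alpha> \<in> multi_indices_on (insert i S)"
      and M: "\<forall>z. (\<forall>j\<in>insert i S. norm (z $ j) = \<rho> j) \<and> (\<forall>j. j \<notin> insert i S \<longrightarrow> z $ j = 0) \<longrightarrow>
        norm (F z) \<le> M"
    have "\<alpha> \<in> (\<lambda>(n, \<beta>). coord_upd \<beta> i n) ` (UNIV \<times> multi_indices_on S)"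
      using \<alpha> by (simp only: bij_betw_imp_surj_on[OF bij])
    then obtain n \<beta> where \<beta>: "\<beta> \<in> multi_indices_on S" and \<alpha>_eq: "\<alpha> = coord_upd \<beta> i n"
      by (elim imageE SigmaE) simp
    have slice: "norm (?G n z) * \<rho> i ^ n \<le> M"
      if "\<forall>j\<in>S. norm (z $ j) = \<rho> j" "\<forall>j. j \<notin> S \<longrightarrow> z $ j = 0" for z
    proof (rule Cauchy_inequality_taylor_slice[OF insert.prems])
      show "\<rho> i \<ge> 0" using \<rho> by simp
      fix w :: complex assume "norm w = \<rho> i"
      then show "norm (F (coord_upd z i w)) \<le> M"
        by (intro M[rule_format] conjI ballI allI impI) (use that in auto)
    qed
    have "norm (F (\<chi> j. if j \<in> insert i S then of_real (\<rho> j) else 0)) \<le> M"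
      by (intro M[rule_format] conjI ballI allI impI) (simp_all add: \<rho>)
    then have "M \<ge> 0" by (rule order_trans[OF norm_ge_zero])
    have "norm (c' n \<beta>) * (\<rho> i ^ n * (\<Prod>j\<in>S. \<rho> j ^ (\<beta> $ j))) \<le> M"
    proof (cases "\<rho> i ^ n = 0")
      case True
      show ?thesis unfolding True using \<open>M \<ge> 0\<close> by simp
    next
      case False
      moreover have "\<rho> i ^ n \<ge> 0" using \<rho> by simp
      ultimately have pos: "\<rho> i ^ n > 0" by linarith
      have "norm (c' n \<beta>) * (\<Prod>j\<in>S. \<rho> j ^ (\<beta> $ j)) \<le> M / \<rho> i ^ n"
      proof (rule c'(2)[of n, rule_format, OF _ _ \<beta>])
        show "\<rho> j \<ge> 0" for j using \<rho> by (rule spec)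
        show "norm (?G n z) \<le> M / \<rho> i ^ n"
          if "(\<forall>j\<in>S. norm (z $ j) = \<rho> j) \<and> (\<forall>j. j \<notin> S \<longrightarrow> z $ j = 0)" for z
          unfolding pos_le_divide_eq[OF pos] using that by (elim conjE) (rule slice)
      qed
      then show ?thesis unfolding pos_le_divide_eq[OF pos] by (simp only: mult_ac)
    qed
    then show "norm (c \<alpha>) * (\<Prod>j\<in>insert i S. \<rho> j ^ (\<alpha> $ j)) \<le> M"
      unfolding \<alpha>_eq c_upd[OF \<beta>]
      by (simp only: prod_coord_upd_insert[OF insert.hyps(2), of "\<lambda>j n. \<rho> j ^ n" \<beta> n])
  qed
  have "?expansion (insert i S) F c"
  proof (intro allI impI)
    fix z :: "complex ^ 'd" assume z: "\<forall>j. j \<notin> insert i S \<longrightarrow> z $ j = 0"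
    let ?t = "\<lambda>\<alpha>. c \<alpha> * (\<Prod>j\<in>insert i S. z $ j ^ (\<alpha> $ j))"
    \<comment> \<open>Any radii larger than those of \<open>z\<close> give domination by a geometric series.\<close>
    define \<rho> where "\<rho> j = 2 * norm (z $ j) + 1" for j
    have \<rho>: "\<rho> j > 0" for j by (simp add: \<rho>_def add_nonneg_pos)
    have "continuous_on UNIV F" using insert.prems by (simp add: separately_holomorphic_def)
    then obtain M where M: "\<And>z. norm z \<le> (\<Sum>j\<in>UNIV. \<rho> j) \<Longrightarrow> norm (F z) \<le> M"
      using continuous_bounded_on_cball by blast
    have FM: "norm (F y) \<le> M"
      if y: "\<forall>j\<in>insert i S. norm (y $ j) = \<rho> j" "\<forall>j. j \<notin> insert i S \<longrightarrow> y $ j = 0" for y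
    proof (rule M)
      have "norm (y $ j) \<le> \<rho> j" for j using y \<rho>[of j] by (cases "j \<in> insert i S") auto
      then show "norm y \<le> (\<Sum>j\<in>UNIV. \<rho> j)"
        by (intro order_trans[OF norm_le_sum_norm_nth] sum_mono)
    qed
    have bound: "norm (c \<alpha>) * (\<Prod>j\<in>insert i S. \<rho> j ^ (\<alpha> $ j)) \<le> M"
      if "\<alpha> \<in> multi_indices_on (insert i S)" for \<alpha>
    proof (rule Cauchy[rule_format, OF _ _ that])
      show "\<rho> j \<ge> 0" for j using \<rho> by (rule less_imp_le)
      show "norm (F y) \<le> M"
        if "(\<forall>j\<in>insert i S. norm (y $ j) = \<rho> j) \<and> (\<forall>j. j \<notin> insert i S \<longrightarrow> y $ j = 0)" for y
        using that by (elim conjE) (rule FM)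
    qed
    have "(\<lambda>\<alpha>. norm (?t \<alpha>)) summable_on multi_indices_on (insert i S)"
    proof (rule Infinite_Sum.abs_summable_on_comparison_test')
      show "(\<lambda>\<alpha>. M * (\<Prod>j\<in>insert i S. (norm (z $ j) / \<rho> j) ^ (\<alpha> $ j)))
          summable_on multi_indices_on (insert i S)"
      proof (intro summable_on_cmult_right summable_on_multi_indices_geometric)
        fix j
        show "0 \<le> norm (z $ j) / \<rho> j" using \<rho>[of j] by simp
        show "norm (z $ j) / \<rho> j < 1" using \<rho>[of j] unfolding \<rho>_def by (simp add: add_nonneg_pos)
      qed
      fix \<alpha> assume \<alpha>: "\<alpha> \<in> multi_indices_on (insert i S)"
      let ?r = "\<Prod>j\<in>insert i S. \<rho> j ^ (\<alpha> $ j)" and ?z = "\<Prod>j\<in>insert i S. norm (z $ j) ^ (\<alpha> $ j)"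
      have r: "?r > 0" by (intro prod_pos) (simp add: \<rho>)
      have cancel: "a * b = (a * r) * (b / r)" if "r > 0" for a b r :: real using that by simp
      have "norm (?t \<alpha>) = norm (c \<alpha>) * ?z" by (simp only: norm_mult norm_power prod_norm[symmetric])
      also have "\<dots> = (norm (c \<alpha>) * ?r) * (?z / ?r)" by (rule cancel[OF r])
      also have "\<dots> \<le> M * (?z / ?r)"
        by (intro mult_right_mono bound[OF \<alpha>] divide_nonneg_pos r prod_nonneg) simp
      finally show "norm (?t \<alpha>) \<le> M * (\<Prod>j\<in>insert i S. (norm (z $ j) / \<rho> j) ^ (\<alpha> $ j))"
        by (simp only: power_divide prod_dividef)
    qed
    then have "?t summable_on multi_indices_on (insert i S)" by (rule abs_summable_summable)
    then obtain l where l: "(?t has_sum l) (multi_indices_on (insert i S))"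
      unfolding summable_on_def by blast
    let ?z = "coord_upd z i 0" and ?x = "z $ i"
    have "((\<lambda>x. ?t ((\<lambda>(n, \<beta>). coord_upd \<beta> i n) x)) has_sum l) (UNIV \<times> multi_indices_on S)"
      using l by (rule has_sum_reindex_bij_betw[OF bij, THEN iffD2])
    \<comment> \<open>Summing over \<open>\<beta>\<close> first gives the Taylor series of \<open>F\<close> in the variable \<open>z $ i\<close>.\<close>
    moreover have "((\<lambda>\<beta>. ?t ((\<lambda>(n, \<beta>). coord_upd \<beta> i n) (n, \<beta>))) has_sum (?G n ?z * ?x ^ n))
        (multi_indices_on S)" for n
    proof -
      have "((\<lambda>\<beta>. c' n \<beta> * (\<Prod>j\<in>S. ?z $ j ^ (\<beta> $ j))) has_sum ?G n ?z) (multi_indices_on S)"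
        by (rule c'(1)[rule_format]) (use z in auto)
      from has_sum_cmult_left[OF this, of "?x ^ n"]
      show ?thesis
      proof (rule has_sum_cong[THEN iffD1, rotated])
        fix \<beta> assume \<beta>: "\<beta> \<in> multi_indices_on S"
        have "(\<Prod>j\<in>S. ?z $ j ^ (\<beta> $ j)) = (\<Prod>j\<in>S. z $ j ^ (\<beta> $ j))"
          using insert.hyps by (intro prod.cong) auto
        then show "c' n \<beta> * (\<Prod>j\<in>S. ?z $ j ^ (\<beta> $ j)) * ?x ^ n = ?t ((\<lambda>(n, \<beta>). coord_upd \<beta> i n) (n, \<beta>))"
          unfolding prod.case c_upd[OF \<beta>]
          by (simp only: prod_coord_upd_insert[OF insert.hyps(2), of "\<lambda>j n. z $ j ^ n"])
            (simp add: mult_ac)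
      qed
    qed
    ultimately have "((\<lambda>n. ?G n ?z * ?x ^ n) has_sum l) UNIV" by (rule has_sum_SigmaD)
    then have "(\<lambda>n. ?G n ?z * ?x ^ n) sums l" by (rule has_sum_imp_sums)
    moreover have "(\<lambda>n. ?G n ?z * ?x ^ n) sums F z"
      using holomorphic_power_series[OF hol[of z], of ?x 0 "norm ?x + 1"]
      by (simp add: taylor_slice_def)
    ultimately have "l = F z" by (rule sums_unique2)
    then show "(?t has_sum F z) (multi_indices_on (insert i S))" using l by simp
  qed
  with Cauchy show ?case by blast
qed

lemma power_series_zero_unique:
  fixes a :: "nat \<Rightarrow> complex"
  assumes "\<And>x. (\<lambda>n. a n * x ^ n) sums 0"
  shows "a n = 0"
proof (cases "n = 0")
  case True
  show ?thesis using sums_unique2[OF assms[of 0] powser_sums_zero] True by simp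
next
  case False
  show ?thesis
  proof (rule ccontr)
    assume "a n \<noteq> 0"
    show False
    proof (rule powser_0_nonzero[of 1 0 a "\<lambda>_. 0" n])
      fix s :: real
      assume "s > 0" "\<And>z::complex. z \<in> cball 0 s - {0} \<Longrightarrow> (0::complex) \<noteq> 0"
      from this(2)[of "of_real s"] this(1) show False by simp
    qed (use assms \<open>a n \<noteq> 0\<close> False in simp_all)
  qed
qed

text \<open>
  Freezing all variables but one gives a power series in one variable that vanishes identically, so
  all its coefficients, which are power series in the other variables, vanish.
\<close>

lemma multi_power_series_zero_unique:
  fixes c :: "nat ^ 'd::finite \<Rightarrow> complex"
  assumes "\<And>z. ((\<lambda>\<alpha>. c \<alpha> * (\<Prod>j\<in>S. z $ j ^ (\<alpha> $ j))) has_sum 0) (multi_indices_on S)"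
    and "\<alpha> \<in> multi_indices_on S"
  shows "c \<alpha> = 0"
  using finite_subset[OF subset_UNIV finite_class.finite_UNIV, of S] assms
proof (induction S arbitrary: c \<alpha> rule: finite_induct)
  case empty
  have "((\<lambda>\<alpha>. c \<alpha>) has_sum c 0) {0}" by (rule has_sum_finiteI) simp_all
  with empty have "c 0 = 0" using has_sum_unique by fastforce
  then show ?case using empty by simp
next
  case (insert i S)
  note bij = bij_betw_multi_indices_insert[OF insert.hyps(2)]
  have "\<alpha> \<in> (\<lambda>(n, \<beta>). coord_upd \<beta> i n) ` (UNIV \<times> multi_indices_on S)"
    using insert.prems(2) by (simp only: bij_betw_imp_surj_on[OF bij])
  then obtain n \<beta> where \<beta>: "\<beta> \<in> multi_indices_on S" and \<alpha>_eq: "\<alpha> = coord_upd \<beta> i n"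
    by (elim imageE SigmaE) simp
  have "((\<lambda>\<beta>. c (coord_upd \<beta> i n) * (\<Prod>j\<in>S. z $ j ^ (\<beta> $ j))) has_sum 0) (multi_indices_on S)" for z n
  proof -
    let ?f = "\<lambda>n \<beta>. c (coord_upd \<beta> i n) * (\<Prod>j\<in>S. z $ j ^ (\<beta> $ j))"
    have all: "((\<lambda>(n, \<beta>). ?f n \<beta> * x ^ n) has_sum 0) (UNIV \<times> multi_indices_on S)" for x
    proof -
      have "((\<lambda>p. c ((\<lambda>(n, \<beta>). coord_upd \<beta> i n) p) *
          (\<Prod>j\<in>insert i S. coord_upd z i x $ j ^ ((\<lambda>(n, \<beta>). coord_upd \<beta> i n) p $ j))) has_sum 0)
          (UNIV \<times> multi_indices_on S)"
        using insert.prems(1)[of "coord_upd z i x"] by (rule has_sum_reindex_bij_betw[OF bij, THEN iffD2])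
      then show ?thesis
      proof (rule has_sum_cong[THEN iffD1, rotated], clarify)
        fix n \<beta>
        have "(\<Prod>j\<in>S. coord_upd z i x $ j ^ (\<beta> $ j)) = (\<Prod>j\<in>S. z $ j ^ (\<beta> $ j))"
          using insert.hyps by (intro prod.cong) auto
        then show "c (coord_upd \<beta> i n) *
          (\<Prod>j\<in>insert i S. coord_upd z i x $ j ^ (coord_upd \<beta> i n $ j)) = ?f n \<beta> * x ^ n"
          by (simp only: prod_coord_upd_insert[OF insert.hyps(2), of "\<lambda>j n. coord_upd z i x $ j ^ n"])
            (simp add: mult_ac)
      qed
    qed
    have "?f n summable_on multi_indices_on S" for n
      using summable_on_SigmaD1[OF has_sum_imp_summable[OF all[of 1]], of n] by simp
    then have sum: "(?f n has_sum infsum (?f n) (multi_indices_on S)) (multi_indices_on S)" for n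
      by (rule has_sum_infsum)
    have "(\<lambda>n. infsum (?f n) (multi_indices_on S) * x ^ n) sums 0" for x
    proof (rule has_sum_imp_sums, rule has_sum_SigmaD[OF all])
      show "((\<lambda>\<beta>. case (n, \<beta>) of (n, \<beta>) \<Rightarrow> ?f n \<beta> * x ^ n) has_sum
          infsum (?f n) (multi_indices_on S) * x ^ n) (multi_indices_on S)" for n
        using has_sum_cmult_left[OF sum] by simp
    qed
    then have "infsum (?f n) (multi_indices_on S) = 0" by (rule power_series_zero_unique)
    with sum[of n] show ?thesis by simp
  qed
  from insert.IH[OF this \<beta>] show ?case by (simp add: \<alpha>_eq)
qed

section \<open>The extended map and its inverse\<close>

text \<open>
  The extension of \<open>\<P>\<close> to infinite series. The sum is meaningful as soon as the coefficients are
  bounded, which covers all sequence spaces of the theorem.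
\<close>

definition bargmann :: "'d::finite power_series \<Rightarrow> complex ^ 'd \<Rightarrow> complex" where
  "bargmann c z = (\<Sum>\<^sub>\<infinity>\<alpha>. c \<alpha> * e_fun \<alpha> z)"

lemma mi_fact_pos: "mi_fact \<alpha> > 0"
  unfolding mi_fact_def by (intro prod_pos) simp

text \<open>
  Comparison by the inequality of arithmetic and geometric means, after splitting the term as
  \<open>(2B)^k / sqrt k!\<close> times \<open>2^-k\<close>: the squares of the two factors are terms of an exponential and of a
  geometric series.
\<close>

lemma summable_power_div_sqrt_fact:
  fixes B :: real
  assumes "B \<ge> 0"
  shows "summable (\<lambda>k. B ^ k / sqrt (fact k))"
proof (rule summable_comparison_test_ev)
  have "summable (\<lambda>k. ((4 * B\<^sup>2) ^ k / fact k + (1 / 4) ^ k) / 2)"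
    using summable_exp[of "4 * B\<^sup>2"]
    by (intro summable_divide summable_add summable_geometric) (simp_all add: field_simps)
  then show "summable (\<lambda>k. ((4 * B\<^sup>2) ^ k / fact k + (1 / 4) ^ k) / 2)" .
  have am_gm: "u * v \<le> (u\<^sup>2 + v\<^sup>2) / 2" for u v :: real using sum_squares_bound[of u v] by simp
  have "B ^ k / sqrt (fact k) \<le> ((4 * B\<^sup>2) ^ k / fact k + (1 / 4) ^ k) / 2" for k
  proof -
    let ?u = "(2 * B) ^ k / sqrt (fact k)" and ?v = "(1 / 2 :: real) ^ k"
    have "B ^ k / sqrt (fact k) = ?u * ?v" by (simp add: power_mult_distrib power_divide)
    also have "\<dots> \<le> (?u\<^sup>2 + ?v\<^sup>2) / 2" by (rule am_gm)
    also have "?u\<^sup>2 = (4 * B\<^sup>2) ^ k / fact k"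
    proof -
      have "((2 * B) ^ k)\<^sup>2 = ((2 * B)\<^sup>2) ^ k" by (simp only: power_mult[symmetric] mult.commute)
      then show ?thesis by (simp add: power_divide power_mult_distrib)
    qed
    also have "?v\<^sup>2 = (1 / 4) ^ k"
    proof -
      have "((1 / 2 :: real) ^ k)\<^sup>2 = ((1 / 2)\<^sup>2) ^ k" by (simp only: power_mult[symmetric] mult.commute)
      then show ?thesis by (simp add: power2_eq_square)
    qed
    finally show ?thesis .
  qed
  then show "\<forall>\<^sub>F k in sequentially. norm (B ^ k / sqrt (fact k)) \<le> ((4 * B\<^sup>2) ^ k / fact k + (1 / 4) ^ k) / 2"
    using assms by simp
qed

lemma prod_power_div_sqrt_fact:
  "(\<Prod>j\<in>UNIV. f j ^ (\<alpha> $ j) / sqrt (fact (\<alpha> $ j))) = (\<Prod>j\<in>UNIV. f j ^ (\<alpha> $ j)) / sqrt (mi_fact \<alpha>)"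
proof -
  have "(\<Prod>j\<in>A. sqrt (fact (\<alpha> $ j))) = sqrt (\<Prod>j\<in>A. fact (\<alpha> $ j))" for A
    by (induction A rule: infinite_finite_induct) (simp_all add: real_sqrt_mult)
  then show ?thesis by (simp add: prod_dividef mi_fact_def)
qed

lemma prod_power_eq_power_mi_size: "(\<Prod>j\<in>UNIV. x ^ (\<alpha> $ j)) = (x::'a::comm_monoid_mult) ^ mi_size \<alpha>"
  by (simp add: mi_size_def power_sum)

lemma summable_on_power_div_sqrt_mi_fact:
  fixes B :: real
  assumes "B \<ge> 0"
  shows "(\<lambda>\<alpha> :: nat ^ 'd::finite. B ^ mi_size \<alpha> / sqrt (mi_fact \<alpha>)) summable_on UNIV"
proof -
  have "(\<lambda>k. B ^ k / sqrt (fact k)) summable_on UNIV"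
    using assms summable_power_div_sqrt_fact by (intro summable_nonneg_imp_summable_on) auto
  then have "((\<lambda>\<alpha> :: nat ^ 'd. \<Prod>j\<in>UNIV. B ^ (\<alpha> $ j) / sqrt (fact (\<alpha> $ j))) has_sum
      (\<Prod>j\<in>(UNIV :: 'd set). infsum (\<lambda>k. B ^ k / sqrt (fact k)) UNIV)) (multi_indices_on UNIV)"
    using assms by (intro has_sum_multi_indices_prod[where f = "\<lambda>j k. B ^ k / sqrt (fact k)"]) auto
  then show ?thesis
    by (auto simp: prod_power_div_sqrt_fact[of "\<lambda>_. B"] prod_power_eq_power_mi_size
        dest: has_sum_imp_summable)
qed

lemma norm_e_fun: "norm (e_fun \<alpha> z) = (\<Prod>j\<in>UNIV. norm (z $ j) ^ (\<alpha> $ j)) / sqrt (mi_fact \<alpha>)"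
  using mi_fact_pos[of \<alpha>] by (simp add: e_fun_def norm_divide norm_power prod_norm[symmetric])

lemma norm_e_fun_le:
  assumes "\<And>j. norm (z $ j) \<le> B"
  shows "norm (e_fun \<alpha> z) \<le> B ^ mi_size \<alpha> / sqrt (mi_fact \<alpha>)"
  unfolding norm_e_fun prod_power_eq_power_mi_size[symmetric]
  using mi_fact_pos[of \<alpha>] assms by (intro divide_right_mono prod_mono conjI power_mono) auto

lemma summable_on_bargmann:
  assumes c: "\<And>\<alpha>. norm (c \<alpha>) \<le> K"
  shows "(\<lambda>\<alpha>. norm (c \<alpha> * e_fun \<alpha> z)) summable_on UNIV"
proof (rule Infinite_Sum.abs_summable_on_comparison_test')
  show "(\<lambda>\<alpha>. K * (norm z ^ mi_size \<alpha> / sqrt (mi_fact \<alpha>))) summable_on UNIV"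
    by (intro summable_on_cmult_right summable_on_power_div_sqrt_mi_fact) simp
  fix \<alpha>
  have "K \<ge> 0" using c[of 0] norm_ge_zero order_trans by blast
  then show "norm (c \<alpha> * e_fun \<alpha> z) \<le> K * (norm z ^ mi_size \<alpha> / sqrt (mi_fact \<alpha>))"
    unfolding norm_mult
    by (intro mult_mono c norm_e_fun_le) (simp_all add: Finite_Cartesian_Product.norm_nth_le)
qed

lemma has_sum_bargmann:
  assumes c: "\<And>\<alpha>. norm (c \<alpha>) \<le> K"
  shows "((\<lambda>\<alpha>. c \<alpha> * e_fun \<alpha> z) has_sum bargmann c z) UNIV"
  unfolding bargmann_def
  by (rule has_sum_infsum[OF abs_summable_summable[OF summable_on_bargmann]]) (rule c)

lemma bargmann_finite_series:
  assumes "c \<in> finite_series"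
  shows "bargmann c = \<P> c"
proof
  fix z
  have "bargmann c z = (\<Sum>\<^sub>\<infinity>\<alpha>\<in>{\<alpha>. c \<alpha> \<noteq> 0}. c \<alpha> * e_fun \<alpha> z)"
    unfolding bargmann_def by (rule infsum_cong_neutral) auto
  then show "bargmann c z = \<P> c z" using assms by (simp add: \<P>_def finite_series_def)
qed

definition e_fun_deriv :: "nat ^ 'd::finite \<Rightarrow> complex ^ 'd \<Rightarrow> complex ^ 'd \<Rightarrow> complex" where
  "e_fun_deriv \<alpha> z h =
     (\<Sum>i\<in>UNIV. (of_nat (\<alpha> $ i) * z $ i ^ (\<alpha> $ i - 1) * h $ i) * (\<Prod>j\<in>UNIV - {i}. z $ j ^ (\<alpha> $ j)))
     / complex_of_real (sqrt (mi_fact \<alpha>))"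

lemma has_derivative_e_fun: "(e_fun \<alpha> has_derivative e_fun_deriv \<alpha> z) (at z within S)"
proof -
  have "((\<lambda>z. z $ i ^ (\<alpha> $ i)) has_derivative (\<lambda>h. of_nat (\<alpha> $ i) * z $ i ^ (\<alpha> $ i - 1) * h $ i))
      (at z within S)" for i
    by (auto intro!: derivative_eq_intros bounded_linear_imp_has_derivative[OF bounded_linear_vec_nth]
        simp: mult_ac)
  then have prod: "((\<lambda>z. \<Prod>i\<in>UNIV. z $ i ^ (\<alpha> $ i)) has_derivative
      (\<lambda>h. \<Sum>i\<in>UNIV. (of_nat (\<alpha> $ i) * z $ i ^ (\<alpha> $ i - 1) * h $ i) * (\<Prod>j\<in>UNIV - {i}. z $ j ^ (\<alpha> $ j))))
      (at z within S)"
    by (intro has_derivative_prod)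
  let ?c = "inverse (complex_of_real (sqrt (mi_fact \<alpha>)))"
  have eq: "e_fun \<alpha> = (\<lambda>z. ?c * (\<Prod>i\<in>UNIV. z $ i ^ (\<alpha> $ i)))"
    "e_fun_deriv \<alpha> z = (\<lambda>h. ?c * (\<Sum>i\<in>UNIV. (of_nat (\<alpha> $ i) * z $ i ^ (\<alpha> $ i - 1) * h $ i) *
      (\<Prod>j\<in>UNIV - {i}. z $ j ^ (\<alpha> $ j))))"
    by (simp_all add: fun_eq_iff e_fun_def e_fun_deriv_def divide_inverse mult.commute)
  show ?thesis unfolding eq by (rule has_derivative_mult_right[OF prod])
qed

lemma e_fun_deriv_scale: "e_fun_deriv \<alpha> z (a *s h) = a * e_fun_deriv \<alpha> z h"
  by (simp add: e_fun_deriv_def sum_distrib_left mult_ac sum_divide_distrib)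

text \<open>
  The factor \<open>2 ^ |\<alpha>|\<close> absorbs the exponents produced by differentiation, so the derived series is
  dominated by a series of the same shape with \<open>2B\<close> in place of \<open>B\<close>.
\<close>

lemma norm_e_fun_deriv_le:
  fixes z h :: "complex ^ 'd::finite"
  assumes z: "norm z \<le> B" and "B \<ge> 1"
  shows "norm (e_fun_deriv \<alpha> z h) \<le>
    real CARD('d) * ((2 * B) ^ mi_size \<alpha> / sqrt (mi_fact \<alpha>)) * norm h"
proof -
  have comp: "norm (z $ i) \<le> B" for i using Finite_Cartesian_Product.norm_nth_le z order_trans by blast
  have "norm ((of_nat (\<alpha> $ i) * z $ i ^ (\<alpha> $ i - 1) * h $ i) * (\<Prod>j\<in>UNIV - {i}. z $ j ^ (\<alpha> $ j)))
      \<le> (2 * B) ^ mi_size \<alpha> * norm h" for i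
  proof -
    have le: "\<alpha> $ i \<le> mi_size \<alpha>" unfolding mi_size_def by (rule member_le_sum) auto
    have "norm (z $ i ^ (\<alpha> $ i - 1)) \<le> B ^ (\<alpha> $ i)"
      using power_mono[OF comp[of i], of "\<alpha> $ i - 1"] power_increasing[of "\<alpha> $ i - 1" "\<alpha> $ i" B] \<open>B \<ge> 1\<close>
      by (simp add: norm_power)
    moreover have "norm (\<Prod>j\<in>UNIV - {i}. z $ j ^ (\<alpha> $ j)) \<le> (\<Prod>j\<in>UNIV - {i}. B ^ (\<alpha> $ j))"
      unfolding prod_norm[symmetric] norm_power by (intro prod_mono conjI power_mono comp) auto
    moreover have "norm (h $ i) \<le> norm h" by (rule Finite_Cartesian_Product.norm_nth_le)
    moreover have "real (\<alpha> $ i) \<le> 2 ^ mi_size \<alpha>"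
      using le of_nat_less_two_power[of "mi_size \<alpha>", where 'a = real] by linarith
    ultimately have "norm ((of_nat (\<alpha> $ i) * z $ i ^ (\<alpha> $ i - 1) * h $ i) * (\<Prod>j\<in>UNIV - {i}. z $ j ^ (\<alpha> $ j)))
        \<le> (2 ^ mi_size \<alpha> * B ^ (\<alpha> $ i) * norm h) * (\<Prod>j\<in>UNIV - {i}. B ^ (\<alpha> $ j))"
      unfolding norm_mult norm_of_nat using \<open>B \<ge> 1\<close>
      by (intro mult_mono) (auto intro!: mult_nonneg_nonneg)
    also have "\<dots> = 2 ^ mi_size \<alpha> * norm h * (\<Prod>j\<in>UNIV. B ^ (\<alpha> $ j))"
      by (subst prod.remove[of UNIV i]) auto
    also have "\<dots> = (2 * B) ^ mi_size \<alpha> * norm h"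
      by (simp add: prod_power_eq_power_mi_size power_mult_distrib)
    finally show ?thesis .
  qed
  then have "norm (\<Sum>i\<in>UNIV. (of_nat (\<alpha> $ i) * z $ i ^ (\<alpha> $ i - 1) * h $ i) * (\<Prod>j\<in>UNIV - {i}. z $ j ^ (\<alpha> $ j)))
      \<le> (\<Sum>i\<in>(UNIV :: 'd set). (2 * B) ^ mi_size \<alpha> * norm h)"
    by (intro order_trans[OF norm_sum] sum_mono)
  then show ?thesis
    using mi_fact_pos[of \<alpha>] by (simp add: e_fun_deriv_def norm_divide divide_right_mono mult.assoc)
qed

lemma infinite_UNIV_multi_index: "infinite (UNIV :: (nat ^ 'd::finite) set)"
proof
  assume "finite (UNIV :: (nat ^ 'd) set)"
  then have "finite (range (\<lambda>n. (\<chi> _. n) :: nat ^ 'd))" by (rule finite_subset[rotated]) simp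
  moreover have "inj (\<lambda>n. (\<chi> _. n) :: nat ^ 'd)" by (auto simp: inj_def vec_eq_iff)
  ultimately show False using finite_imageD infinite_UNIV_nat by blast
qed

text \<open>
  Termwise differentiation on a ball, along an enumeration of the multi-indices. The derivatives
  are complex linear because those of the terms are.
\<close>

lemma entire_bargmann:
  fixes c :: "'d::finite power_series"
  assumes c: "\<And>\<alpha>. norm (c \<alpha>) \<le> K"
  shows "entire (bargmann c)"
  unfolding entire_def
proof
  fix z :: "complex ^ 'd"
  have "K \<ge> 0" using c[of 0] norm_ge_zero order_trans by blast
  define \<phi> where "\<phi> = from_nat_into (UNIV :: (nat ^ 'd) set)"
  have bij: "bij_betw \<phi> UNIV UNIV"
    unfolding \<phi>_def by (intro bij_betw_from_nat_into infinite_UNIV_multi_index) simp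
  define B where "B = norm z + 1"
  define m where "m n = K * (real CARD('d) * ((2 * B) ^ mi_size (\<phi> n) / sqrt (mi_fact (\<phi> n))))" for n
  have "B \<ge> 1" by (simp add: B_def)
  have "(\<lambda>n. (2 * B) ^ mi_size (\<phi> n) / sqrt (mi_fact (\<phi> n))) summable_on UNIV"
    unfolding summable_on_reindex_bij_betw[OF bij, of "\<lambda>\<alpha>. (2 * B) ^ mi_size \<alpha> / sqrt (mi_fact \<alpha>)"]
    using \<open>B \<ge> 1\<close> by (intro summable_on_power_div_sqrt_mi_fact) simp
  then have m: "summable m"
    unfolding m_def by (intro summable_mult summable_on_imp_summable)
  let ?S = "ball 0 B :: (complex ^ 'd) set"
  let ?f' = "\<lambda>n x h. c (\<phi> n) * e_fun_deriv (\<phi> n) x h"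
  let ?D = "\<lambda>x h. \<Sum>n. ?f' n x h"
  have f': "norm (?f' n x h) \<le> m n * norm h" if "x \<in> ?S" for n x h
    unfolding norm_mult m_def mult.assoc[of K]
    using that \<open>B \<ge> 1\<close> \<open>K \<ge> 0\<close> by (intro mult_mono c norm_e_fun_deriv_le) auto
  have sum_f': "summable (\<lambda>n. ?f' n x h)" if "x \<in> ?S" for x h
    by (rule summable_comparison_test'[OF summable_mult2[OF m, of "norm h"]]) (use f'[OF that] in auto)
  have sums: "(\<lambda>n. c (\<phi> n) * e_fun (\<phi> n) x) sums bargmann c x" for x
    by (rule has_sum_imp_sums, rule has_sum_reindex_bij_betw[OF bij, THEN iffD2], rule has_sum_bargmann)
      (rule c)
  have "\<exists>g. \<forall>x\<in>?S. (\<lambda>n. c (\<phi> n) * e_fun (\<phi> n) x) sums g x \<and> (g has_derivative ?D x) (at x within ?S)"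
  proof (rule has_derivative_series[where f' = ?f'])
    show "convex ?S" by simp
    show "z \<in> ?S" by (simp add: B_def)
    show "(\<lambda>n. c (\<phi> n) * e_fun (\<phi> n) z) sums bargmann c z" by (rule sums)
    show "((\<lambda>x. c (\<phi> n) * e_fun (\<phi> n) x) has_derivative ?f' n x) (at x within ?S)" for n x
      by (intro has_derivative_mult_right has_derivative_e_fun)
    fix e :: real assume "e > 0"
    have "(\<lambda>n. \<Sum>k. m (k + n)) \<longlonglongrightarrow> 0" by (rule suminf_exist_split2[OF m])
    from order_tendstoD(2)[OF this \<open>e > 0\<close>]
    show "\<forall>\<^sub>F n in sequentially. \<forall>x\<in>?S. \<forall>h. norm (sum (\<lambda>i. ?f' i x h) {..<n} - ?D x h) \<le> e * norm h"
    proof eventually_elim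
      case (elim n)
      show ?case
      proof (intro ballI allI)
        fix x h assume x: "x \<in> ?S"
        have "norm (sum (\<lambda>i. ?f' i x h) {..<n} - ?D x h) = norm (\<Sum>k. ?f' (k + n) x h)"
          using suminf_minus_initial_segment[OF sum_f'[OF x], of n h]
          by (simp add: norm_minus_commute)
        also have "\<dots> \<le> (\<Sum>k. m (k + n) * norm h)"
          by (rule norm_suminf_le) (use f'[OF x] m in \<open>auto intro!: summable_mult2 summable_ignore_initial_segment\<close>)
        also have "\<dots> = (\<Sum>k. m (k + n)) * norm h"
          by (rule suminf_mult2[symmetric]) (intro summable_ignore_initial_segment m)
        also have "\<dots> \<le> e * norm h" using elim by (intro mult_right_mono) auto
        finally show "norm (sum (\<lambda>i. ?f' i x h) {..<n} - ?D x h) \<le> e * norm h" .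
      qed
    qed
  qed
  then obtain g where g: "\<And>x. x \<in> ?S \<Longrightarrow> (\<lambda>n. c (\<phi> n) * e_fun (\<phi> n) x) sums g x"
    "\<And>x. x \<in> ?S \<Longrightarrow> (g has_derivative ?D x) (at x within ?S)" by blast
  have zS: "z \<in> ?S" by (simp add: B_def)
  have "(bargmann c has_derivative ?D z) (at z within ?S)"
    by (rule has_derivative_transform[OF zS _ g(2)[OF zS]]) (rule sums_unique2[OF sums g(1)])
  then have "(bargmann c has_derivative ?D z) (at z)"
    by (simp only: at_within_open[OF zS open_ball])
  moreover have "?D z (a *s v) = a * ?D z v" for a v
  proof -
    have "?f' n z (a *s v) = a * ?f' n z v" for n by (simp only: e_fun_deriv_scale mult.left_commute)
    then show ?thesis by (simp only: suminf_mult[OF sum_f'[OF zS]])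
  qed
  ultimately show "\<exists>D. (bargmann c has_derivative D) (at z) \<and> (\<forall>a v. D (a *s v) = a * D v)" by blast
qed

lemma entire_imp_separately_holomorphic:
  assumes "entire F"
  shows "separately_holomorphic (F :: complex ^ 'd::finite \<Rightarrow> complex)"
  unfolding separately_holomorphic_def
proof (intro conjI allI)
  show "continuous_on UNIV F"
    using assms unfolding entire_def
    by (metis continuous_at_imp_continuous_on has_derivative_continuous)
  fix i z
  have "\<exists>f'. ((\<lambda>w. F (coord_upd z i w)) has_field_derivative f') (at w)" for w
  proof -
    obtain D where D: "(F has_derivative D) (at (coord_upd z i w))" "\<And>a v. D (a *s v) = a * D v"
      using assms unfolding entire_def by meson
    have "linear (axis i :: complex \<Rightarrow> complex ^ 'd)"
      by (auto intro!: linearI simp: vec_eq_iff axis_def)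
    then have "((\<lambda>w. c + axis i w) has_derivative (\<lambda>v. 0 + axis i v)) (at w)" for c :: "complex ^ 'd"
      by (intro has_derivative_add has_derivative_const linear_imp_has_derivative)
    moreover obtain c where "coord_upd z i = (\<lambda>w. c + axis i w)"
    proof
      show "coord_upd z i = (\<lambda>w. coord_upd z i 0 + axis i w)"
        by (simp add: fun_eq_iff vec_eq_iff axis_def)
    qed
    ultimately have "(coord_upd z i has_derivative axis i) (at w)" by simp
    from diff_chain_at[OF this D(1)]
    have "((\<lambda>w. F (coord_upd z i w)) has_derivative (\<lambda>v. D (axis i v))) (at w)" by (simp add: o_def)
    moreover have "(\<lambda>v. D (axis i v)) = (*) (D (axis i 1))"
    proof
      fix v
      have "axis i v = v *s (axis i 1 :: complex ^ 'd)"
        by (simp add: vec_eq_iff axis_def vector_scalar_mult_def)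
      then show "D (axis i v) = D (axis i 1) * v" by (simp only: D(2) mult.commute)
    qed
    ultimately have "((\<lambda>w. F (coord_upd z i w)) has_field_derivative D (axis i 1)) (at w)"
      unfolding has_field_derivative_def by (simp only:)
    then show ?thesis by (rule exI)
  qed
  then show "(\<lambda>w. F (coord_upd z i w)) holomorphic_on UNIV"
    by (auto simp: holomorphic_on_def field_differentiable_def)
qed

lemma series_coefficients_unique:
  assumes "\<And>z. ((\<lambda>\<alpha>. c \<alpha> * e_fun \<alpha> z) has_sum F z) UNIV" "\<And>z. ((\<lambda>\<alpha>. c' \<alpha> * e_fun \<alpha> z) has_sum F z) UNIV"
  shows "c = c'"
proof
  fix \<alpha>
  have "(c \<alpha> - c' \<alpha>) / complex_of_real (sqrt (mi_fact \<alpha>)) = 0"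
  proof (rule multi_power_series_zero_unique[where S = UNIV])
    fix z
    have "((\<lambda>\<alpha>. c \<alpha> * e_fun \<alpha> z - c' \<alpha> * e_fun \<alpha> z) has_sum (F z - F z)) UNIV"
      using has_sum_add[OF assms(1)[of z] has_sum_uminusI[OF assms(2)[of z]]]
      by simp
    then show "((\<lambda>\<alpha>. (c \<alpha> - c' \<alpha>) / complex_of_real (sqrt (mi_fact \<alpha>)) * (\<Prod>j\<in>UNIV. z $ j ^ (\<alpha> $ j)))
        has_sum 0) (multi_indices_on UNIV)"
      by (simp add: e_fun_def algebra_simps diff_divide_distrib)
  qed simp
  then show "c \<alpha> = c' \<alpha>" using mi_fact_pos[of \<alpha>] by simp
qed

text \<open>
  The inverse map. For an entire function the coefficients exist and are unique.
\<close>

definition series_coeffs :: "(complex ^ 'd::finite \<Rightarrow> complex) \<Rightarrow> 'd power_series" where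
  "series_coeffs F = (THE c. \<forall>z. ((\<lambda>\<alpha>. c \<alpha> * e_fun \<alpha> z) has_sum F z) UNIV)"

lemma series_coeffs_eqI:
  assumes "\<And>z. ((\<lambda>\<alpha>. c \<alpha> * e_fun \<alpha> z) has_sum F z) UNIV"
  shows "series_coeffs F = c"
  unfolding series_coeffs_def
  by (rule the_equality) (use assms series_coefficients_unique in blast)+

lemma
  fixes F :: "complex ^ 'd::finite \<Rightarrow> complex"
  assumes F: "entire F"
  shows has_sum_series_coeffs: "((\<lambda>\<alpha>. series_coeffs F \<alpha> * e_fun \<alpha> z) has_sum F z) UNIV"
    and Cauchy_inequality_series_coeffs:
      "\<lbrakk>\<And>j. \<rho> j \<ge> 0; \<And>z. (\<And>j. norm (z $ j) = \<rho> j) \<Longrightarrow> norm (F z) \<le> M\<rbrakk> \<Longrightarrow>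
        norm (series_coeffs F \<alpha>) * (\<Prod>j\<in>UNIV. \<rho> j ^ (\<alpha> $ j)) \<le> M * sqrt (mi_fact \<alpha>)"
proof -
  have "\<exists>c. (\<forall>z. ((\<lambda>\<alpha>. c \<alpha> * (\<Prod>j\<in>UNIV. z $ j ^ (\<alpha> $ j))) has_sum F z) UNIV) \<and>
      (\<forall>\<rho> M. (\<forall>j. \<rho> j \<ge> 0) \<longrightarrow> (\<forall>z. (\<forall>j. norm (z $ j) = \<rho> j) \<longrightarrow> norm (F z) \<le> M) \<longrightarrow>
        (\<forall>\<alpha>. norm (c \<alpha>) * (\<Prod>j\<in>UNIV. \<rho> j ^ (\<alpha> $ j)) \<le> M))"
    (is "\<exists>c. ?expansion c \<and> ?Cauchy c")
    using separately_holomorphic_power_series_on[OF entire_imp_separately_holomorphic[OF F], of UNIV]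
    by simp
  then obtain c where c: "?expansion c" and Cauchy: "?Cauchy c" by (elim exE conjE)
  define c' where "c' \<alpha> = c \<alpha> * complex_of_real (sqrt (mi_fact \<alpha>))" for \<alpha>
  have c': "((\<lambda>\<alpha>. c' \<alpha> * e_fun \<alpha> z) has_sum F z) UNIV" for z
  proof -
    have "c' \<alpha> * e_fun \<alpha> z = c \<alpha> * (\<Prod>j\<in>UNIV. z $ j ^ (\<alpha> $ j))" for \<alpha>
      using mi_fact_pos[of \<alpha>] by (simp add: c'_def e_fun_def)
    then show ?thesis using c[rule_format, of z] by simp
  qed
  then have eq: "series_coeffs F = c'" by (rule series_coeffs_eqI)
  show "((\<lambda>\<alpha>. series_coeffs F \<alpha> * e_fun \<alpha> z) has_sum F z) UNIV" unfolding eq by (rule c')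
  assume \<rho>: "\<And>j. \<rho> j \<ge> 0" and M: "\<And>z. (\<And>j. norm (z $ j) = \<rho> j) \<Longrightarrow> norm (F z) \<le> M"
  have "norm (c \<alpha>) * (\<Prod>j\<in>UNIV. \<rho> j ^ (\<alpha> $ j)) \<le> M"
    by (intro Cauchy[rule_format] \<rho> M)
  then have "norm (c \<alpha>) * (\<Prod>j\<in>UNIV. \<rho> j ^ (\<alpha> $ j)) * sqrt (mi_fact \<alpha>) \<le> M * sqrt (mi_fact \<alpha>)"
    using mi_fact_pos[of \<alpha>] by (intro mult_right_mono) simp_all
  moreover have "norm (c' \<alpha>) = norm (c \<alpha>) * sqrt (mi_fact \<alpha>)"
    using mi_fact_pos[of \<alpha>] by (simp add: c'_def norm_mult)
  ultimately show "norm (series_coeffs F \<alpha>) * (\<Prod>j\<in>UNIV. \<rho> j ^ (\<alpha> $ j)) \<le> M * sqrt (mi_fact \<alpha>)"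
    unfolding eq by (simp only: mult_ac)
qed

lemma series_coeffs_linear:
  assumes "entire F" "entire G"
  shows "series_coeffs (\<lambda>z. a * F z + b * G z) = (\<lambda>\<alpha>. a * series_coeffs F \<alpha> + b * series_coeffs G \<alpha>)"
proof (rule series_coeffs_eqI)
  fix z
  show "((\<lambda>\<alpha>. (a * series_coeffs F \<alpha> + b * series_coeffs G \<alpha>) * e_fun \<alpha> z) has_sum (a * F z + b * G z)) UNIV"
    using has_sum_add[OF has_sum_cmult_right[OF has_sum_series_coeffs[OF assms(1)], of a]
        has_sum_cmult_right[OF has_sum_series_coeffs[OF assms(2)], of b]]
    by (simp add: algebra_simps)
qed

lemma bargmann_linear:
  assumes "\<And>\<alpha>. norm (c \<alpha>) \<le> K" "\<And>\<alpha>. norm (c' \<alpha>) \<le> K'"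
  shows "bargmann (\<lambda>\<alpha>. a * c \<alpha> + b * c' \<alpha>) = (\<lambda>z. a * bargmann c z + b * bargmann c' z)"
proof
  fix z
  have "((\<lambda>\<alpha>. c \<alpha> * e_fun \<alpha> z) has_sum bargmann c z) UNIV"
    "((\<lambda>\<alpha>. c' \<alpha> * e_fun \<alpha> z) has_sum bargmann c' z) UNIV"
    by (rule has_sum_bargmann, rule assms)+
  from has_sum_add[OF has_sum_cmult_right[OF this(1), of a] has_sum_cmult_right[OF this(2), of b]]
  have "((\<lambda>\<alpha>. (a * c \<alpha> + b * c' \<alpha>) * e_fun \<alpha> z) has_sum (a * bargmann c z + b * bargmann c' z)) UNIV"
    by (simp add: algebra_simps)
  then show "bargmann (\<lambda>\<alpha>. a * c \<alpha> + b * c' \<alpha>) z = a * bargmann c z + b * bargmann c' z"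
    unfolding bargmann_def[of "\<lambda>\<alpha>. a * c \<alpha> + b * c' \<alpha>"] by (rule infsumI)
qed

section \<open>Weights for coefficients and for functions\<close>

definition exp_weight :: "real \<Rightarrow> real \<Rightarrow> nat ^ 'd::finite \<Rightarrow> real" where
  "exp_weight r a \<alpha> = exp (- r * real (mi_size \<alpha>) powr a)"

text \<open>
  The analytic content of the theorem is reduced to two estimates between a weight \<open>u\<close> for coefficients
  and a weight \<open>w\<close> for functions: boundedness of the extended map and of its inverse. The weights
  enter with the supremum norm on both sides; the exponent \<open>p\<close> is dealt with separately.
\<close>

definition series_bound :: "(nat ^ 'd::finite \<Rightarrow> real) \<Rightarrow> (complex ^ 'd \<Rightarrow> real) \<Rightarrow> bool" where
  "series_bound u w \<longleftrightarrow> (\<exists>C>0. \<forall>c K. K \<ge> 0 \<longrightarrow> (\<forall>\<alpha>. norm (c \<alpha>) \<le> K * u \<alpha>) \<longrightarrow>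
     (\<forall>z. norm (bargmann c z) \<le> C * K * w z))"

definition coeff_bound :: "(complex ^ 'd::finite \<Rightarrow> real) \<Rightarrow> (nat ^ 'd \<Rightarrow> real) \<Rightarrow> bool" where
  "coeff_bound w u \<longleftrightarrow> (\<exists>C>0. \<forall>F K. K \<ge> 0 \<longrightarrow> entire F \<longrightarrow> (\<forall>z. norm (F z) \<le> K * w z) \<longrightarrow>
     (\<forall>\<alpha>. norm (series_coeffs F \<alpha>) \<le> C * K * u \<alpha>))"

lemma series_boundI:
  fixes u :: "nat ^ 'd::finite \<Rightarrow> real"
  assumes "C > 0"
    and g: "\<And>z \<alpha>. u \<alpha> * norm (e_fun \<alpha> z) \<le> g z \<alpha>" "\<And>z. (g z has_sum S z) UNIV" "\<And>z. S z \<le> C * w z"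
  shows "series_bound u w"
  unfolding series_bound_def
proof (intro exI conjI allI impI)
  fix c :: "nat ^ 'd \<Rightarrow> complex" and K :: real and z
  assume K: "K \<ge> 0" and c: "\<forall>\<alpha>. norm (c \<alpha>) \<le> K * u \<alpha>"
  have le: "norm (c \<alpha> * e_fun \<alpha> z) \<le> K * g z \<alpha>" for \<alpha>
  proof -
    have "norm (c \<alpha> * e_fun \<alpha> z) \<le> (K * u \<alpha>) * norm (e_fun \<alpha> z)"
      unfolding norm_mult by (intro mult_right_mono) (simp_all add: c)
    also have "\<dots> = K * (u \<alpha> * norm (e_fun \<alpha> z))" by simp
    also have "\<dots> \<le> K * g z \<alpha>" by (intro mult_left_mono g K)
    finally show ?thesis .
  qed
  have sum: "((\<lambda>\<alpha>. K * g z \<alpha>) has_sum (K * S z)) UNIV" by (intro has_sum_cmult_right g)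
  have "norm (bargmann c z) \<le> K * S z"
    unfolding bargmann_def by (rule norm_infsum_le[OF _ sum le]) 
      (rule has_sum_infsum[OF abs_summable_summable[OF
          Infinite_Sum.abs_summable_on_comparison_test'[OF has_sum_imp_summable[OF sum] le]]])
  also have "\<dots> \<le> K * (C * w z)" by (intro mult_left_mono g K)
  finally show "norm (bargmann c z) \<le> C * K * w z" by (simp only: mult_ac)
qed (rule \<open>C > 0\<close>)

text \<open>
  Cauchy's inequality on a torus whose radii may depend on the multi-index. A radius may
  vanish only where the exponent does, so that the monomial stays positive on the torus.
\<close>

lemma coeff_boundI:
  fixes u :: "nat ^ 'd::finite \<Rightarrow> real"
  assumes "C > 0" and \<rho>: "\<And>\<alpha> j. \<rho> \<alpha> j > 0 \<or> (\<rho> \<alpha> j = 0 \<and> \<alpha> $ j = 0)"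
    and w: "\<And>\<alpha> z. (\<And>j. norm (z $ j) = \<rho> \<alpha> j) \<Longrightarrow>
      w z * sqrt (mi_fact \<alpha>) \<le> C * u \<alpha> * (\<Prod>j\<in>UNIV. \<rho> \<alpha> j ^ (\<alpha> $ j))"
  shows "coeff_bound w u"
  unfolding coeff_bound_def
proof (intro exI conjI allI impI)
  fix F :: "complex ^ 'd \<Rightarrow> complex" and K :: real and \<alpha>
  assume K: "K \<ge> 0" and F: "entire F" and bound: "\<forall>z. norm (F z) \<le> K * w z"
  have pos: "(\<Prod>j\<in>UNIV. \<rho> \<alpha> j ^ (\<alpha> $ j)) > 0"
  proof (rule prod_pos)
    fix j
    show "0 < \<rho> \<alpha> j ^ (\<alpha> $ j)" using \<rho>[of \<alpha> j] by (elim disjE conjE) simp_all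
  qed
  have "norm (series_coeffs F \<alpha>) * (\<Prod>j\<in>UNIV. \<rho> \<alpha> j ^ (\<alpha> $ j))
      \<le> (K * (C * u \<alpha> * (\<Prod>j\<in>UNIV. \<rho> \<alpha> j ^ (\<alpha> $ j)) / sqrt (mi_fact \<alpha>))) * sqrt (mi_fact \<alpha>)"
  proof (rule Cauchy_inequality_series_coeffs[OF F])
    show "\<rho> \<alpha> j \<ge> 0" for j using \<rho>[of \<alpha> j] by (elim disjE conjE) simp_all
    fix z :: "complex ^ 'd" assume "\<And>j. norm (z $ j) = \<rho> \<alpha> j"
    from w[OF this] have "w z \<le> C * u \<alpha> * (\<Prod>j\<in>UNIV. \<rho> \<alpha> j ^ (\<alpha> $ j)) / sqrt (mi_fact \<alpha>)"
      by (subst pos_le_divide_eq) (simp_all add: mi_fact_pos)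
    then have "K * w z \<le> K * (C * u \<alpha> * (\<Prod>j\<in>UNIV. \<rho> \<alpha> j ^ (\<alpha> $ j)) / sqrt (mi_fact \<alpha>))"
      using K by (rule mult_left_mono)
    with bound[rule_format, of z]
    show "norm (F z) \<le> K * (C * u \<alpha> * (\<Prod>j\<in>UNIV. \<rho> \<alpha> j ^ (\<alpha> $ j)) / sqrt (mi_fact \<alpha>))"
      by (rule order_trans)
  qed
  also have "\<dots> = (C * K * u \<alpha>) * (\<Prod>j\<in>UNIV. \<rho> \<alpha> j ^ (\<alpha> $ j))"
    using mi_fact_pos[of \<alpha>] by simp
  finally show "norm (series_coeffs F \<alpha>) \<le> C * K * u \<alpha>"
    using pos by (rule mult_right_le_imp_le)
qed (rule \<open>C > 0\<close>)

lemma LIMSEQ_bounded: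
  fixes f :: "nat \<Rightarrow> real"
  assumes "f \<longlonglongrightarrow> l"
  obtains C where "C > 0" "\<And>n. f n \<le> C"
proof -
  have "Bseq f" using assms by (intro convergent_imp_Bseq convergentI)
  then obtain C where C: "C > 0" "\<forall>n. norm (f n) \<le> C" by (rule BseqE)
  show thesis
  proof (rule that[OF C(1)])
    show "f n \<le> C" for n using C(2)[rule_format, of n] by simp
  qed
qed

lemma power_le_exp_powr:
  assumes "a > 0" "r > 0"
  obtains C where "C > 0" "\<And>n::nat. (1 + real n) ^ k \<le> C * exp (r * real n powr a)"
proof -
  have "((\<lambda>x. (1 + x) powr real k * exp (- r * x powr a)) \<longlongrightarrow> 0) at_top"
    using assms by real_asymp
  then have "(\<lambda>n. (1 + real n) powr real k * exp (- r * real n powr a)) \<longlonglongrightarrow> 0"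
    by (rule filterlim_compose[OF _ filterlim_real_sequentially])
  then obtain C where C: "C > 0" "\<And>n. (1 + real n) powr real k * exp (- r * real n powr a) \<le> C"
    by (rule LIMSEQ_bounded) blast
  show thesis
  proof (rule that[OF C(1)])
    fix n
    have "(1 + real n) ^ k * exp (- r * real n powr a) \<le> C" using C(2)[of n] by (simp add: powr_realpow)
    then show "(1 + real n) ^ k \<le> C * exp (r * real n powr a)" by (simp add: exp_minus field_simps)
  qed
qed

text \<open>
  As \<open>n ln n\<close> grows slower than \<open>n powr a\<close> for \<open>a > 1\<close>, the normalising factors \<open>sqrt \<alpha>!\<close> are negligible
  against the weights when \<open>s < 1/2\<close>.
\<close>

lemma sqrt_self_power_le_exp_powr:
  assumes "a > 1" "r > 0"
  obtains C where "C > 0" "\<And>n::nat. sqrt (real n ^ n) \<le> C * exp (r * real n powr a)"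
proof -
  have "((\<lambda>x. exp (x * ln x / 2) * exp (- r * x powr a)) \<longlongrightarrow> 0) at_top"
    using assms by real_asymp
  then have "(\<lambda>n. exp (real n * ln (real n) / 2) * exp (- r * real n powr a)) \<longlonglongrightarrow> 0"
    by (rule filterlim_compose[OF _ filterlim_real_sequentially])
  then obtain C where C: "C > 0" "\<And>n. exp (real n * ln (real n) / 2) * exp (- r * real n powr a) \<le> C"
    by (rule LIMSEQ_bounded) blast
  show thesis
  proof (rule that[OF C(1)])
    fix n :: nat
    have "sqrt (real n ^ n) = exp (real n * ln (real n) / 2)"
    proof (cases "n = 0")
      case False
      then have "exp (real n * ln (real n) / 2) ^ 2 = real n ^ n"
        by (simp add: exp_of_nat_mult[symmetric] exp_of_nat_mult flip: exp_double)
      then show ?thesis by (metis exp_ge_zero real_sqrt_unique)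
    qed simp
    then show "sqrt (real n ^ n) \<le> C * exp (r * real n powr a)"
      using C(2)[of n] by (simp add: exp_minus field_simps)
  qed
qed

lemma component_le_mi_size: "\<alpha> $ j \<le> mi_size \<alpha>"
  unfolding mi_size_def by (rule member_le_sum) auto

lemma mi_fact_ge_1: "mi_fact \<alpha> \<ge> 1"
  unfolding mi_fact_def by (intro prod_ge_1) (simp add: fact_ge_1)

lemma mi_fact_le: "mi_fact \<alpha> \<le> real (mi_size \<alpha>) ^ mi_size \<alpha>"
proof -
  have "mi_fact \<alpha> \<le> (\<Prod>j\<in>UNIV. real (mi_size \<alpha>) ^ (\<alpha> $ j))"
    unfolding mi_fact_def
  proof (intro prod_mono conjI)
    fix j
    have "fact (\<alpha> $ j) \<le> real (\<alpha> $ j) ^ (\<alpha> $ j)"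
      using fact_le_power[of "\<alpha> $ j", where 'a = real] by simp
    also have "\<dots> \<le> real (mi_size \<alpha>) ^ (\<alpha> $ j)"
      by (intro power_mono) (simp_all add: component_le_mi_size)
    finally show "fact (\<alpha> $ j) \<le> real (mi_size \<alpha>) ^ (\<alpha> $ j)" .
  qed simp
  then show ?thesis by (simp only: prod_power_eq_power_mi_size)
qed

text \<open>
  The exponential beats every power of \<open>1 + |\<alpha>|\<close>, in particular the product of the \<open>(1 + \<alpha> $ j)\<^sup>2\<close>.
\<close>

lemma summable_on_exp_weight:
  assumes "a > 0" "r > 0"
  shows "exp_weight r a summable_on (UNIV :: (nat ^ 'd::finite) set)"
proof -
  obtain C where C: "C > 0" "\<And>n::nat. (1 + real n) ^ (2 * CARD('d)) \<le> C * exp (r * real n powr a)"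
    using power_le_exp_powr[OF assms] by blast
  let ?g = "\<lambda>k. 1 / (1 + real k)\<^sup>2"
  have "summable ?g"
    using inverse_power_summable[of 2, where 'a = real] summable_Suc_iff[of "\<lambda>k. inverse ((real k)\<^sup>2)"]
    by (simp add: inverse_eq_divide add.commute)
  then have g: "(?g has_sum infsum ?g UNIV) UNIV"
    by (intro has_sum_infsum summable_nonneg_imp_summable_on) simp_all
  have "((\<lambda>\<alpha> :: nat ^ 'd. \<Prod>j\<in>UNIV. ?g (\<alpha> $ j)) has_sum (\<Prod>j\<in>(UNIV::'d set). infsum ?g UNIV))
      (multi_indices_on UNIV)"
    by (rule has_sum_multi_indices_prod[where f = "\<lambda>j. ?g"]) (simp, rule g)
  then have "(\<lambda>\<alpha> :: nat ^ 'd. \<Prod>j\<in>UNIV. ?g (\<alpha> $ j)) summable_on UNIV"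
    by (simp only: multi_indices_on_UNIV has_sum_imp_summable)
  from summable_on_cmult_right[OF this, of C]
  show ?thesis
  proof (rule summable_on_comparison_test)
    fix \<alpha> :: "nat ^ 'd"
    have "(\<Prod>j\<in>(UNIV::'d set). (1 + real (\<alpha> $ j))\<^sup>2) \<le> (\<Prod>j\<in>(UNIV::'d set). (1 + real (mi_size \<alpha>))\<^sup>2)"
      by (intro prod_mono conjI power_mono) (simp_all add: component_le_mi_size)
    also have "\<dots> = (1 + real (mi_size \<alpha>)) ^ (2 * CARD('d))" by (simp add: power_mult)
    also note C(2)
    finally have le: "(\<Prod>j\<in>UNIV. (1 + real (\<alpha> $ j))\<^sup>2) \<le> C * exp (r * real (mi_size \<alpha>) powr a)" .
    have pos: "(\<Prod>j\<in>UNIV. (1 + real (\<alpha> $ j))\<^sup>2) > 0" by (intro prod_pos) auto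
    have eq: "(\<Prod>j\<in>UNIV. ?g (\<alpha> $ j)) = 1 / (\<Prod>j\<in>UNIV. (1 + real (\<alpha> $ j))\<^sup>2)"
      by (simp only: prod_dividef prod.neutral_const)
    show "exp_weight r a \<alpha> \<le> C * (\<Prod>j\<in>UNIV. ?g (\<alpha> $ j))"
      unfolding eq exp_weight_def using le pos C(1) by (simp add: exp_minus field_simps)
  qed (simp add: exp_weight_def)
qed

lemma exp_weight_decay:
  assumes "r \<ge> 0" "a > 0" "mi_size \<alpha> > n"
  shows "exp_weight (2 * r) a \<alpha> \<le> exp (- r * real n powr a) * exp_weight r a \<alpha>"
proof -
  have "r * real n powr a \<le> r * real (mi_size \<alpha>) powr a"
    using assms by (intro mult_left_mono powr_mono2) auto
  then show ?thesis unfolding exp_weight_def by (simp flip: exp_add)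
qed

section \<open>Estimates for \<open>0 < s < 1/2\<close>\<close>

lemma japanese_ge_1: "japanese z \<ge> 1"
  by (simp add: japanese_def)

lemma norm_nth_le_japanese: "norm (z $ j) \<le> japanese z"
proof -
  have "norm (z $ j) \<le> norm z" by (rule Finite_Cartesian_Product.norm_nth_le)
  also have "\<dots> \<le> japanese z" unfolding japanese_def by (rule real_le_rsqrt) simp
  finally show ?thesis .
qed

lemma norm_e_fun_le_japanese: "norm (e_fun \<alpha> z) \<le> japanese z ^ mi_size \<alpha>"
proof -
  have "norm (e_fun \<alpha> z) \<le> japanese z ^ mi_size \<alpha> / sqrt (mi_fact \<alpha>)"
    by (intro norm_e_fun_le norm_nth_le_japanese)
  also have "\<dots> \<le> japanese z ^ mi_size \<alpha> / 1"
    using japanese_ge_1[of z] mi_fact_ge_1[of \<alpha>] by (intro divide_left_mono) auto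
  finally show ?thesis by simp
qed

lemma norm_vec_sum: "(norm z)\<^sup>2 = (\<Sum>j\<in>UNIV. (norm (z $ j))\<^sup>2)"
  unfolding norm_vec_def L2_set_def by (simp add: sum_nonneg)

lemma japanese_le_torus:
  fixes z :: "complex ^ 'd::finite"
  assumes "\<And>j. norm (z $ j) = \<rho>" "\<rho> \<ge> 1"
  shows "japanese z \<le> sqrt (1 + real CARD('d)) * \<rho>"
proof -
  have "1 \<le> \<rho>\<^sup>2" using assms(2) by simp
  then have "1 + (norm z)\<^sup>2 \<le> (1 + real CARD('d)) * \<rho>\<^sup>2"
    by (simp add: norm_vec_sum assms(1) algebra_simps)
  then have "japanese z \<le> sqrt ((1 + real CARD('d)) * \<rho>\<^sup>2)"
    unfolding japanese_def by (rule real_sqrt_le_mono)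
  then show ?thesis using assms(2) by (simp add: real_sqrt_mult)
qed

text \<open>
  Young's inequality for the conjugate exponents \<open>a\<close> and \<open>a / (a - 1)\<close>, with a constant that is not
  optimal. What matters is its behaviour: as \<open>q\<close> runs through the positive numbers, so does
  \<open>q powr (- 1 / (a - 1))\<close>, in the opposite direction. Hence it serves both kinds of limits.
\<close>

lemma mult_le_powr_conjugate:
  fixes x L :: real
  assumes "x \<ge> 0" "L \<ge> 0" "q > 0" "a > 1"
  shows "x * L \<le> q * x powr a + q powr (- 1 / (a - 1)) * L powr (a / (a - 1))"
proof (cases "L \<le> q * x powr (a - 1)")
  case True
  then have "x * L \<le> x * (q * x powr (a - 1))" using assms by (intro mult_left_mono)
  also have "\<dots> = q * x powr a"
    using assms by (cases "x = 0") (simp_all add: powr_diff)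
  also have "\<dots> \<le> q * x powr a + q powr (- 1 / (a - 1)) * L powr (a / (a - 1))" by simp
  finally show ?thesis .
next
  case False
  then have "x powr (a - 1) \<le> L / q" using assms by (simp add: field_simps)
  have "q * x powr (a - 1) \<ge> 0" using assms by simp
  with False have "L > 0" by linarith
  have "x = (x powr (a - 1)) powr (1 / (a - 1))" using assms by (simp add: powr_powr)
  also have "\<dots> \<le> (L / q) powr (1 / (a - 1))"
    using \<open>x powr (a - 1) \<le> L / q\<close> assms by (intro powr_mono2) auto
  finally have "x * L \<le> (L / q) powr (1 / (a - 1)) * L" using assms by (intro mult_right_mono)
  also have "\<dots> = q powr (- 1 / (a - 1)) * (L powr (1 / (a - 1)) * L powr 1)"
    using assms \<open>L > 0\<close> by (simp add: powr_divide powr_minus_divide)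
  also have "L powr (1 / (a - 1)) * L powr 1 = L powr (a / (a - 1))"
    using assms by (simp only: powr_add[symmetric]) (simp add: field_simps)
  also have "q powr (- 1 / (a - 1)) * L powr (a / (a - 1)) \<le>
      q * x powr a + q powr (- 1 / (a - 1)) * L powr (a / (a - 1))" using assms by simp
  finally show ?thesis .
qed

lemma powr_add_le:
  fixes x y :: real
  assumes "x \<ge> 0" "y \<ge> 0" "p \<ge> 0"
  shows "(x + y) powr p \<le> 2 powr p * (x powr p + y powr p)"
proof -
  have "(x + y) powr p \<le> (2 * max x y) powr p" using assms by (intro powr_mono2) auto
  also have "\<dots> = 2 powr p * max x y powr p" using assms by (simp add: powr_mult)
  also have "\<dots> \<le> 2 powr p * (x powr p + y powr p)"
    by (intro mult_left_mono) (auto simp: max_def)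
  finally show ?thesis .
qed

text \<open>
  The two exponents in the theorem for \<open>s < 1/2\<close> are conjugate: this explains the exponent
  \<open>1 / (1 - 2s)\<close> in the weight.
\<close>

lemma conjugate_exponent:
  fixes s a :: real
  assumes "0 < s" "s < 1 / 2" "a = 1 / (2 * s)"
  shows "a > 1" "1 / (1 - 2 * s) = a / (a - 1)"
proof -
  show "a > 1" using assms by simp
  have "a - 1 = (1 - 2 * s) / (2 * s)" using assms by (simp add: diff_divide_distrib)
  then show "1 / (1 - 2 * s) = a / (a - 1)" using assms by simp
qed

text \<open>
  With \<open>n = |\<alpha>|\<close> and \<open>L = ln \<langle>z\<rangle>\<close> every term is at most \<open>exp (n L - r n powr a)\<close>. Half of the decay pays for
  the summation over \<open>\<alpha>\<close>, the other half goes into Young's inequality.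
\<close>

lemma series_bound_log_growth:
  fixes s a r R :: real
  assumes s: "0 < s" "s < 1 / 2" and a: "a = 1 / (2 * s)" and "r > 0"
    and R: "(r / 2) powr (- 1 / (a - 1)) \<le> R"
  shows "series_bound (exp_weight r a :: nat ^ 'd::finite \<Rightarrow> real) (\<omega>\<^sub>1 R s)"
proof -
  note conj = conjugate_exponent[OF s a]
  define S where "S = infsum (exp_weight (r / 2) a) (UNIV :: (nat ^ 'd) set)"
  have S: "(exp_weight (r / 2) a has_sum S) (UNIV :: (nat ^ 'd) set)"
    unfolding S_def using conj \<open>r > 0\<close> by (intro has_sum_infsum summable_on_exp_weight) auto
  then have "S \<ge> 0" by (rule has_sum_nonneg) (simp add: exp_weight_def)
  show ?thesis
  proof (rule series_boundI)
    show "S + 1 > 0" using \<open>S \<ge> 0\<close> by simp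
    fix z :: "complex ^ 'd"
    let ?L = "ln (japanese z)"
    have \<omega>: "\<omega>\<^sub>1 R s z = exp (R * ?L powr (a / (a - 1)))" using s conj by (simp add: \<omega>\<^sub>1_def)
    show "((\<lambda>\<alpha> :: nat ^ 'd. \<omega>\<^sub>1 R s z * exp_weight (r / 2) a \<alpha>) has_sum (\<omega>\<^sub>1 R s z * S)) UNIV"
      by (rule has_sum_cmult_right[OF S])
    show "\<omega>\<^sub>1 R s z * S \<le> (S + 1) * \<omega>\<^sub>1 R s z" by (simp add: \<omega> algebra_simps)
    fix \<alpha> :: "nat ^ 'd"
    let ?n = "real (mi_size \<alpha>)"
    have L: "?L \<ge> 0" using japanese_ge_1[of z] by simp
    have "?n * ?L \<le> r / 2 * ?n powr a + (r / 2) powr (- 1 / (a - 1)) * ?L powr (a / (a - 1))"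
      using L conj \<open>r > 0\<close> by (intro mult_le_powr_conjugate) auto
    also have "\<dots> \<le> r / 2 * ?n powr a + R * ?L powr (a / (a - 1))"
      using R by (intro add_left_mono mult_right_mono) auto
    finally have young: "?n * ?L \<le> r / 2 * ?n powr a + R * ?L powr (a / (a - 1))" .
    have "japanese z ^ mi_size \<alpha> = exp (?n * ?L)"
      using japanese_ge_1[of z] by (simp add: exp_of_nat_mult)
    then have "exp_weight r a \<alpha> * norm (e_fun \<alpha> z) \<le> exp_weight r a \<alpha> * exp (?n * ?L)"
      using norm_e_fun_le_japanese[of \<alpha> z] by (intro mult_left_mono) (auto simp: exp_weight_def)
    also have "\<dots> \<le> \<omega>\<^sub>1 R s z * exp_weight (r / 2) a \<alpha>"
      unfolding \<omega> exp_weight_def using young by (simp flip: exp_add)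
    finally show "exp_weight r a \<alpha> * norm (e_fun \<alpha> z) \<le> \<omega>\<^sub>1 R s z * exp_weight (r / 2) a \<alpha>" .
  qed
qed

text \<open>
  Cauchy's inequality on the torus of radius \<open>exp (4 r n powr (a - 1))\<close>, which gains the factor
  \<open>exp (- 4 r n powr a)\<close>. The hypothesis on \<open>R\<close> says that the growth of the function on this torus costs
  at most \<open>exp (2 r n powr a)\<close> up to a constant; a factor \<open>exp (r n powr a)\<close> pays for the factorials, and the
  decay \<open>exp (- r n powr a)\<close> is left.
\<close>

lemma coeff_bound_log_growth:
  fixes s a r R :: real
  assumes s: "0 < s" "s < 1 / 2" and a: "a = 1 / (2 * s)" and "r > 0" "R \<ge> 0"
    and R: "R * 2 powr (a / (a - 1)) * (4 * r) powr (a / (a - 1)) \<le> 2 * r"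
  shows "coeff_bound (\<omega>\<^sub>1 R s) (exp_weight r a :: nat ^ 'd::finite \<Rightarrow> real)"
proof -
  note conj = conjugate_exponent[OF s a]
  define b where "b = a / (a - 1)"
  have b: "b > 0" "(a - 1) * b = a" using conj by (simp_all add: b_def)
  obtain C where C: "C > 0" "\<And>n::nat. sqrt (real n ^ n) \<le> C * exp (r * real n powr a)"
    using sqrt_self_power_le_exp_powr[OF conj(1) \<open>r > 0\<close>] by blast
  define \<kappa> where "\<kappa> = ln (sqrt (1 + real CARD('d)))"
  have "\<kappa> \<ge> 0" by (simp add: \<kappa>_def)
  define \<rho> where "\<rho> \<alpha> j = exp (4 * r * real (mi_size \<alpha>) powr (a - 1))"
    for \<alpha> :: "nat ^ 'd" and j :: 'd
  let ?D = "R * 2 powr b * \<kappa> powr b"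
  show ?thesis
  proof (rule coeff_boundI[where \<rho> = \<rho>])
    show "C * exp ?D > 0" using C by simp
    show "\<rho> \<alpha> j > 0 \<or> (\<rho> \<alpha> j = 0 \<and> \<alpha> $ j = 0)" for \<alpha> j by (simp add: \<rho>_def)
    fix \<alpha> :: "nat ^ 'd" and z :: "complex ^ 'd"
    assume z: "\<And>j. norm (z $ j) = \<rho> \<alpha> j"
    let ?n = "real (mi_size \<alpha>)" and ?L = "ln (japanese z)"
    have "sqrt (mi_fact \<alpha>) \<le> sqrt (?n ^ mi_size \<alpha>)" by (intro real_sqrt_le_mono mi_fact_le)
    then have fact: "sqrt (mi_fact \<alpha>) \<le> C * exp (r * ?n powr a)" using C(2) by (rule order_trans)
    have "japanese z \<le> sqrt (1 + real CARD('d)) * exp (4 * r * ?n powr (a - 1))"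
      by (rule japanese_le_torus) (use z \<open>r > 0\<close> in \<open>auto simp: \<rho>_def\<close>)
    then have "?L \<le> ln (sqrt (1 + real CARD('d)) * exp (4 * r * ?n powr (a - 1)))"
      using japanese_ge_1[of z] by (subst ln_le_cancel_iff) (auto intro!: mult_pos_pos)
    also have "\<dots> = 4 * r * ?n powr (a - 1) + \<kappa>" by (simp add: ln_mult \<kappa>_def)
    finally have "?L powr b \<le> (4 * r * ?n powr (a - 1) + \<kappa>) powr b"
      using japanese_ge_1[of z] b by (intro powr_mono2) auto
    also have "\<dots> \<le> 2 powr b * ((4 * r * ?n powr (a - 1)) powr b + \<kappa> powr b)"
      using b \<open>\<kappa> \<ge> 0\<close> \<open>r > 0\<close> by (intro powr_add_le) auto
    also have "(4 * r * ?n powr (a - 1)) powr b = (4 * r) powr b * ?n powr a"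
      using \<open>r > 0\<close> by (simp add: powr_mult powr_powr b)
    finally have "R * ?L powr b \<le> R * (2 powr b * ((4 * r) powr b * ?n powr a + \<kappa> powr b))"
      using \<open>R \<ge> 0\<close> by (rule mult_left_mono)
    also have "\<dots> = (R * 2 powr b * (4 * r) powr b) * ?n powr a + ?D" by (simp add: algebra_simps)
    also have "\<dots> \<le> (2 * r) * ?n powr a + ?D"
      using R unfolding b_def[symmetric] by (intro add_right_mono mult_right_mono) auto
    finally have "exp (R * ?L powr b) \<le> exp (2 * r * ?n powr a + ?D)" by simp
    moreover have "\<omega>\<^sub>1 R s z = exp (R * ?L powr b)" using s conj by (simp add: \<omega>\<^sub>1_def b_def)
    ultimately have "\<omega>\<^sub>1 R s z * sqrt (mi_fact \<alpha>) \<le> exp (2 * r * ?n powr a + ?D) * (C * exp (r * ?n powr a))"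
      using fact mi_fact_pos[of \<alpha>] by (intro mult_mono) (simp_all add: less_imp_le)
    also have "\<dots> = C * exp ?D * exp_weight r a \<alpha> * exp (4 * r * ?n powr a)"
      by (simp add: exp_weight_def flip: exp_add)
    also have "4 * r * ?n powr a = ?n * (4 * r * ?n powr (a - 1))"
      by (cases "mi_size \<alpha> = 0") (simp_all add: powr_diff)
    also have "exp (?n * (4 * r * ?n powr (a - 1))) = (\<Prod>j\<in>UNIV. \<rho> \<alpha> j ^ (\<alpha> $ j))"
      by (simp add: \<rho>_def prod_power_eq_power_mi_size exp_of_nat_mult)
    finally show "\<omega>\<^sub>1 R s z * sqrt (mi_fact \<alpha>) \<le>
        C * exp ?D * exp_weight r a \<alpha> * (\<Prod>j\<in>UNIV. \<rho> \<alpha> j ^ (\<alpha> $ j))" .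
  qed
qed

section \<open>Estimates for \<open>s \<ge> 1/2\<close>\<close>

text \<open>
  The sum factorises over the coordinates into exponential series. For \<open>t = 1\<close> it is the reproducing kernel
  on the diagonal, and \<open>t = 1/2\<close> serves to estimate the part of low degree.
\<close>

lemma has_sum_norm_e_fun_squared:
  fixes z :: "complex ^ 'd::finite" and t :: real
  assumes "t \<ge> 0"
  shows "((\<lambda>\<alpha>. (norm (e_fun \<alpha> z))\<^sup>2 * t ^ mi_size \<alpha>) has_sum exp (t * (norm z)\<^sup>2)) UNIV"
proof -
  let ?f = "\<lambda>j k. (t * (norm (z $ j))\<^sup>2) ^ k / fact k"
  have f: "(?f j has_sum exp (t * (norm (z $ j))\<^sup>2)) UNIV" for j
    using exp_converges[of "t * (norm (z $ j))\<^sup>2"] summable_norm_exp[of "t * (norm (z $ j))\<^sup>2"]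
    by (intro norm_summable_imp_has_sum) (simp_all add: divide_inverse mult.commute)
  have "((\<lambda>\<alpha>. \<Prod>j\<in>UNIV. ?f j (\<alpha> $ j)) has_sum (\<Prod>j\<in>UNIV. exp (t * (norm (z $ j))\<^sup>2)))
      (multi_indices_on UNIV)"
    by (rule has_sum_multi_indices_prod[where f = ?f, OF _ f]) (use assms in simp)
  moreover have "(\<Prod>j\<in>UNIV. exp (t * (norm (z $ j))\<^sup>2)) = exp (t * (norm z)\<^sup>2)"
    by (simp add: norm_vec_sum sum_distrib_left exp_sum)
  moreover have "(\<Prod>j\<in>UNIV. ?f j (\<alpha> $ j)) = (norm (e_fun \<alpha> z))\<^sup>2 * t ^ mi_size \<alpha>" for \<alpha>
  proof -
    have "(\<Prod>j\<in>UNIV. ?f j (\<alpha> $ j)) =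
        (\<Prod>j\<in>UNIV. t ^ (\<alpha> $ j)) * (\<Prod>j\<in>UNIV. (norm (z $ j) ^ (\<alpha> $ j))\<^sup>2) / mi_fact \<alpha>"
      by (simp only: prod_dividef mi_fact_def power_mult_distrib prod.distrib)
        (simp only: power_mult[symmetric] mult.commute)
    also have "(\<Prod>j\<in>UNIV. (norm (z $ j) ^ (\<alpha> $ j))\<^sup>2) = (\<Prod>j\<in>UNIV. norm (z $ j) ^ (\<alpha> $ j))\<^sup>2"
      by (simp only: prod_power_distrib)
    finally show ?thesis
      using mi_fact_pos[of \<alpha>] by (simp add: norm_e_fun prod_power_eq_power_mi_size power_divide)
  qed
  ultimately show ?thesis by simp
qed

text \<open>
  Beyond the point \<open>m\<close> where the two sides balance, the linear term dominates.
\<close>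

lemma powr_le_linear:
  fixes a R \<epsilon> :: real
  assumes "0 < a" "a < 1" "R \<ge> 0" "\<epsilon> > 0"
  obtains B where "B \<ge> 0" "\<And>x. x \<ge> 0 \<Longrightarrow> R * x powr a \<le> \<epsilon> * x + B"
proof -
  define m where "m = (R / \<epsilon>) powr (1 / (1 - a))"
  have "R * x powr a \<le> \<epsilon> * x + R * m powr a" if x: "x \<ge> 0" for x
  proof (cases "x \<le> m")
    case True
    then have "R * x powr a \<le> R * m powr a" using assms x by (intro mult_left_mono powr_mono2) auto
    then show ?thesis using assms x by (simp add: add_increasing)
  next
    case False
    then have "x > 0" using powr_ge_zero[of "R / \<epsilon>" "1 / (1 - a)"] unfolding m_def by linarith
    have "R / \<epsilon> = m powr (1 - a)" using assms by (simp add: m_def powr_powr)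
    also have "\<dots> \<le> x powr (1 - a)" using False assms by (intro powr_mono2) (auto simp: m_def)
    finally have "R \<le> \<epsilon> * x powr (1 - a)" using assms by (simp add: field_simps)
    then have "R * x powr a \<le> (\<epsilon> * x powr (1 - a)) * x powr a" by (intro mult_right_mono) auto
    also have "\<dots> = \<epsilon> * x" using \<open>x > 0\<close> by (simp add: mult.assoc flip: powr_add)
    finally show ?thesis using assms by (simp add: add_increasing2)
  qed
  then show thesis using assms by (intro that[of "R * m powr a"]) auto
qed

lemma \<omega>\<^sub>1_gaussian:
  assumes "s \<ge> 1 / 2"
  shows "\<omega>\<^sub>1 R s z = exp ((norm z)\<^sup>2 / 2 - R * (norm z)\<^sup>2 powr (1 / (2 * s)))"
proof -
  have "norm z powr (1 / s) = (norm z powr 2) powr (1 / (2 * s))"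
    using assms by (simp add: powr_powr del: powr_numeral)
  then show ?thesis using assms by (simp add: \<omega>\<^sub>1_def)
qed

text \<open>
  With \<open>x = |z|\<^sup>2\<close> the sums of \<open>|e\<^sub>\<alpha>(z)|\<^sup>2 exp (- x)\<close> over \<open>|\<alpha>| = n\<close> are Poisson probabilities,
  concentrated near \<open>n = x\<close>. Above \<open>x/2\<close> the weight is evaluated at \<open>x/2\<close>; below, it is replaced by a geometric factor
  that makes the sum exponentially smaller than \<open>exp x\<close>.
\<close>

lemma exp_weight_le_tail_split:
  fixes x :: real
  assumes "x \<ge> 0" "r \<ge> 0" "a > 0"
  shows "exp_weight r a \<alpha> \<le> 2 powr (x / 2) * (1 / 2) ^ mi_size \<alpha> + exp (- r * (x / 2) powr a)"
proof (cases "real (mi_size \<alpha>) \<le> x / 2")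
  case True
  have "exp_weight r a \<alpha> \<le> 1" using assms by (simp add: exp_weight_def)
  also have "1 \<le> 2 powr (x / 2 - real (mi_size \<alpha>))" using True by (intro ge_one_powr_ge_zero) auto
  also have "\<dots> = 2 powr (x / 2) * (1 / 2) ^ mi_size \<alpha>"
    by (simp add: powr_diff powr_realpow power_one_over)
  finally show ?thesis by (simp add: add_increasing2)
next
  case False
  then have "(x / 2) powr a \<le> real (mi_size \<alpha>) powr a" using assms by (intro powr_mono2) auto
  then have "exp_weight r a \<alpha> \<le> exp (- r * (x / 2) powr a)"
    using assms by (simp add: exp_weight_def mult_left_mono)
  then show ?thesis by (simp add: add_increasing)
qed

text \<open>
  Split \<open>u |e|\<close> into a square \<open>u |e|\<^sup>2\<close>, whose sum is close to a Gaussian, and the summable weight \<open>u\<close>; the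
  inequality of arithmetic and geometric means with a parameter \<open>\<tau>\<close> depending on \<open>z\<close> replaces the
  inequality of Cauchy and Schwarz. The contribution of low degrees is \<open>exp (x (1 + ln 2) / 2)\<close>. For
  \<open>s > 1/2\<close> the loss \<open>R x powr a\<close> is sublinear and any \<open>R\<close> is affordable, for \<open>s = 1/2\<close> it is linear and \<open>R\<close>
  has to be small. Accordingly the second part of the theorem leaves out \<open>s = 1/2\<close>.
\<close>

lemma series_bound_gaussian:
  fixes s a r R :: real
  assumes s: "s \<ge> 1 / 2" and a: "a = 1 / (2 * s)" and "r > 0" "R > 0"
    and R: "2 * R * 2 powr a \<le> r" and R': "s > 1 / 2 \<or> 4 * R \<le> 1 - ln 2"
  shows "series_bound (exp_weight r a :: nat ^ 'd::finite \<Rightarrow> real) (\<omega>\<^sub>1 R s)"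
proof -
  have a0: "a > 0" "a \<le> 1" using s by (simp_all add: a)
  have ln2: "ln 2 < (1::real)" using ln_2_less_1 .
  obtain B where B: "\<And>x. x \<ge> 0 \<Longrightarrow> 2 * R * x powr a \<le> (1 - ln 2) / 2 * x + B"
  proof (cases "s > 1 / 2")
    case True
    then have "a < 1" using a by simp
    then show thesis
      by (rule powr_le_linear[of a "2 * R" "(1 - ln 2) / 2", OF a0(1)]) (use \<open>R > 0\<close> ln2 that in auto)
  next
    case False
    then have "a = 1" using s a by simp
    have "2 * R * x powr a \<le> (1 - ln 2) / 2 * x + 0" if "x \<ge> 0" for x
    proof -
      have "2 * R * x \<le> (1 - ln 2) / 2 * x" using R' False that by (intro mult_right_mono) auto
      then show ?thesis using that by (simp add: \<open>a = 1\<close>)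
    qed
    then show thesis by (rule that)
  qed
  define S where "S = infsum (exp_weight r a) (UNIV :: (nat ^ 'd) set)"
  have S: "(exp_weight r a has_sum S) (UNIV :: (nat ^ 'd) set)"
    unfolding S_def using a0 \<open>r > 0\<close> by (intro has_sum_infsum summable_on_exp_weight) auto
  then have "S \<ge> 0" by (rule has_sum_nonneg) (simp add: exp_weight_def)
  define x where "x z = (norm z)\<^sup>2" for z :: "complex ^ 'd"
  \<comment> \<open>This \<open>\<tau>\<close> is \<open>1 / \<omega>\<^sub>1\<close>, so the weighted square and the remaining weight both contribute at most a multiple of \<open>\<omega>\<^sub>1\<close>.\<close>
  define \<tau> where "\<tau> z = exp (R * x z powr a - x z / 2)" for z :: "complex ^ 'd"
  define E where "E z = exp (- r * (x z / 2) powr a)" for z :: "complex ^ 'd"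
  have x: "x z \<ge> 0" for z by (simp add: x_def)
  have \<omega>: "\<omega>\<^sub>1 R s z = exp (x z / 2 - R * x z powr a)" for z
    by (simp add: \<omega>\<^sub>1_gaussian[OF s] x_def a)
  have \<omega>\<tau>: "\<omega>\<^sub>1 R s z = 1 / \<tau> z" for z by (simp add: \<omega> \<tau>_def flip: exp_minus')
  have \<tau>: "\<tau> z > 0" for z by (simp add: \<tau>_def)
  let ?g = "\<lambda>z \<alpha>. \<tau> z / 2 * (2 powr (x z / 2) * ((norm (e_fun \<alpha> z))\<^sup>2 * (1 / 2) ^ mi_size \<alpha>) +
    E z * ((norm (e_fun \<alpha> z))\<^sup>2 * 1 ^ mi_size \<alpha>)) + 1 / (2 * \<tau> z) * exp_weight r a \<alpha>"
  let ?S = "\<lambda>z. \<tau> z / 2 * (2 powr (x z / 2) * exp (1 / 2 * x z) + E z * exp (1 * x z)) + 1 / (2 * \<tau> z) * S"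
  show ?thesis
  proof (rule series_boundI)
    show "(exp B + 1 + S) / 2 > 0" using add_pos_nonneg[OF add_pos_pos[OF exp_gt_zero zero_less_one] \<open>S \<ge> 0\<close>] by simp
    fix z :: "complex ^ 'd"
    show "(?g z has_sum ?S z) UNIV"
      unfolding x_def
      by (intro has_sum_add has_sum_cmult_right has_sum_norm_e_fun_squared S) simp_all
    show "?S z \<le> (exp B + 1 + S) / 2 * \<omega>\<^sub>1 R s z"
    proof -
      have "2 powr (x z / 2) * exp (1 / 2 * x z) = exp ((1 + ln 2) / 2 * x z)"
        by (simp add: powr_def algebra_simps add_divide_distrib flip: exp_add)
      also have "(1 + ln 2) / 2 * x z \<le> B + (x z - 2 * R * x z powr a)"
        using B[OF x, of z] by (simp add: field_simps)
      finally have "2 powr (x z / 2) * exp (1 / 2 * x z) \<le> exp B * exp (x z - 2 * R * x z powr a)"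
        by (simp flip: exp_add)
      moreover have "E z * exp (1 * x z) \<le> exp (x z - 2 * R * x z powr a)"
      proof -
        have "2 * R * x z powr a = 2 * R * 2 powr a * (x z / 2) powr a"
          using x by (simp add: powr_divide)
        also have "\<dots> \<le> r * (x z / 2) powr a" using R by (intro mult_right_mono) auto
        finally show ?thesis by (simp add: E_def flip: exp_add)
      qed
      ultimately have "2 powr (x z / 2) * exp (1 / 2 * x z) + E z * exp (1 * x z)
          \<le> (exp B + 1) * exp (x z - 2 * R * x z powr a)" by (simp add: algebra_simps)
      also have "exp (x z - 2 * R * x z powr a) = 1 / \<tau> z * (1 / \<tau> z)"
        by (simp add: \<tau>_def algebra_simps flip: exp_add exp_minus')
      finally have "?S z \<le> \<tau> z / 2 * ((exp B + 1) * (1 / \<tau> z * (1 / \<tau> z))) + 1 / (2 * \<tau> z) * S"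
        using \<tau>[of z] by (intro add_right_mono mult_left_mono) auto
      also have "\<dots> = (exp B + 1 + S) / 2 * \<omega>\<^sub>1 R s z"
        using \<tau>[of z] by (simp add: \<omega>\<tau> field_simps)
      finally show ?thesis .
    qed
    fix \<alpha> :: "nat ^ 'd"
    let ?u = "exp_weight r a \<alpha>" and ?e = "norm (e_fun \<alpha> z)"
    have u: "?u > 0" by (simp add: exp_weight_def)
    have "0 \<le> (\<tau> z * ?e - 1)\<^sup>2" by simp
    then have "2 * \<tau> z * ?e \<le> \<tau> z * \<tau> z * ?e\<^sup>2 + 1" by (simp add: power2_eq_square algebra_simps)
    then have "?e \<le> (\<tau> z * \<tau> z * ?e\<^sup>2 + 1) / (2 * \<tau> z)"
      using \<tau>[of z] by (subst pos_le_divide_eq) (simp_all add: mult.commute mult.left_commute)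
    also have "\<dots> = \<tau> z / 2 * ?e\<^sup>2 + 1 / (2 * \<tau> z)" using \<tau>[of z] by (simp add: field_simps)
    finally have "?u * ?e \<le> ?u * (\<tau> z / 2 * ?e\<^sup>2 + 1 / (2 * \<tau> z))" using u by (intro mult_left_mono) auto
    also have "\<dots> = \<tau> z / 2 * (?u * ?e\<^sup>2) + 1 / (2 * \<tau> z) * ?u" by (simp add: algebra_simps)
    also have "?u * ?e\<^sup>2 \<le> (2 powr (x z / 2) * (1 / 2) ^ mi_size \<alpha> + E z) * ?e\<^sup>2"
      unfolding E_def using x \<open>r > 0\<close> a0 by (intro mult_right_mono exp_weight_le_tail_split) auto
    also have "\<dots> = 2 powr (x z / 2) * (?e\<^sup>2 * (1 / 2) ^ mi_size \<alpha>) + E z * (?e\<^sup>2 * 1 ^ mi_size \<alpha>)"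
      by (simp add: algebra_simps)
    finally show "?u * ?e \<le> ?g z \<alpha>"
      using \<tau>[of z] by (simp add: mult_left_mono)
  qed
qed

text \<open>
  A weak form of Stirling's formula. The induction step is the inequality \<open>(1 - 1/n)^n \<le> 1/e\<close>.
\<close>

lemma fact_mult_exp_le: "fact k * exp (real k) \<le> exp 1 * (1 + real k) * real k ^ k"
proof (cases "k = 0")
  case False
  then have "k \<ge> 1" by simp
  then have "fact k * exp (real k) \<le> exp 1 * real k * real k ^ k"
  proof (induction k rule: dec_induct)
    case base
    then show ?case by simp
  next
    case (step k)
    have "(1 - 1 / real (Suc k)) ^ Suc k \<le> exp (- 1)"
      by (rule exp_ge_one_minus_x_over_n_power_n) auto
    moreover have "1 - 1 / real (Suc k) = real k / real (Suc k)" by (simp add: field_simps)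
    ultimately have "exp 1 * real k ^ Suc k \<le> real (Suc k) ^ Suc k"
      by (simp add: power_divide exp_minus field_simps del: power_Suc of_nat_Suc)
    then have e: "(real (Suc k) * exp 1) * (exp 1 * real k ^ Suc k) \<le>
        (real (Suc k) * exp 1) * real (Suc k) ^ Suc k"
      by (rule mult_left_mono) simp
    have "fact (Suc k) * exp (real (Suc k)) = (real (Suc k) * exp 1) * (fact k * exp (real k))"
      by (simp add: exp_add algebra_simps)
    also have "\<dots> \<le> (real (Suc k) * exp 1) * (exp 1 * real k * real k ^ k)"
      by (intro mult_left_mono step) simp
    also have "\<dots> = (real (Suc k) * exp 1) * (exp 1 * real k ^ Suc k)" by (simp only: power_Suc mult_ac)
    also note e
    finally show ?case by (simp only: mult_ac)
  qed
  also have "\<dots> \<le> exp 1 * (1 + real k) * real k ^ k" by (intro mult_right_mono mult_left_mono) auto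
  finally show ?thesis .
qed simp

text \<open>
  The radii \<open>sqrt (\<alpha> $ j)\<close> minimise \<open>exp (|z|\<^sup>2 / 2) / |z\<^sup>\<alpha>|\<close>. On that torus \<open>|z|\<^sup>2 = |\<alpha>|\<close> exactly, and by
  Stirling's formula the Gaussian factor, the monomial and \<open>sqrt \<alpha>!\<close> cancel up to a power of \<open>1 + |\<alpha>|\<close>,
  which half of the decay \<open>exp (- R |\<alpha>| powr a)\<close> absorbs.
\<close>

lemma coeff_bound_gaussian:
  fixes s a R :: real
  assumes s: "s \<ge> 1 / 2" and a: "a = 1 / (2 * s)" and "R > 0"
  shows "coeff_bound (\<omega>\<^sub>1 R s) (exp_weight (R / 2) a :: nat ^ 'd::finite \<Rightarrow> real)"
proof -
  have a0: "a > 0" using s by (simp add: a)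
  obtain C where C: "C > 0" "\<And>n::nat. (1 + real n) ^ CARD('d) \<le> C * exp (R / 2 * real n powr a)"
    using power_le_exp_powr[of a "R / 2"] a0 \<open>R > 0\<close> by auto
  let ?D = "exp 1 ^ CARD('d) * C"
  define \<rho> where "\<rho> \<alpha> j = sqrt (real (\<alpha> $ j))" for \<alpha> :: "nat ^ 'd" and j
  show ?thesis
  proof (rule coeff_boundI[where \<rho> = \<rho>])
    show "?D > 0" using C by simp
    show "\<rho> \<alpha> j > 0 \<or> (\<rho> \<alpha> j = 0 \<and> \<alpha> $ j = 0)" for \<alpha> j by (auto simp: \<rho>_def)
    fix \<alpha> :: "nat ^ 'd" and z :: "complex ^ 'd"
    assume z: "\<And>j. norm (z $ j) = \<rho> \<alpha> j"
    let ?n = "real (mi_size \<alpha>)" and ?P = "\<Prod>j\<in>UNIV. real (\<alpha> $ j) ^ (\<alpha> $ j)"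
    have "(norm z)\<^sup>2 = ?n" by (simp add: norm_vec_sum z \<rho>_def mi_size_def)
    then have \<omega>: "\<omega>\<^sub>1 R s z = exp (?n / 2 - R * ?n powr a)" by (simp add: \<omega>\<^sub>1_gaussian[OF s] a)
    have "exp ?n * mi_fact \<alpha> = (\<Prod>j\<in>UNIV. fact (\<alpha> $ j) * exp (real (\<alpha> $ j)))"
      by (simp add: mi_size_def mi_fact_def prod.distrib exp_sum mult.commute)
    also have "\<dots> \<le> (\<Prod>j\<in>UNIV. exp 1 * (1 + ?n) * real (\<alpha> $ j) ^ (\<alpha> $ j))"
    proof (intro prod_mono conjI)
      fix j
      have "exp 1 * (1 + real (\<alpha> $ j)) * real (\<alpha> $ j) ^ (\<alpha> $ j) \<le> exp 1 * (1 + ?n) * real (\<alpha> $ j) ^ (\<alpha> $ j)"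
        using component_le_mi_size[of \<alpha> j] by (intro mult_right_mono mult_left_mono) auto
      then show "fact (\<alpha> $ j) * exp (real (\<alpha> $ j)) \<le> exp 1 * (1 + ?n) * real (\<alpha> $ j) ^ (\<alpha> $ j)"
        by (rule order_trans[OF fact_mult_exp_le])
    qed simp
    also have "\<dots> = (exp 1 * (1 + ?n)) ^ CARD('d) * ?P" by (simp add: prod.distrib)
    finally have "sqrt (exp ?n * mi_fact \<alpha>) \<le> sqrt ((exp 1 * (1 + ?n)) ^ CARD('d) * ?P)"
      by (rule real_sqrt_le_mono)
    also have "\<dots> = sqrt ((exp 1 * (1 + ?n)) ^ CARD('d)) * sqrt ?P" by (rule real_sqrt_mult)
    also have "sqrt ((exp 1 * (1 + ?n)) ^ CARD('d)) \<le> (exp 1 * (1 + ?n)) ^ CARD('d)"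
    proof (rule real_le_lsqrt)
      have "1 \<le> (exp 1 * (1 + ?n)) ^ CARD('d)"
        by (intro one_le_power) (use mult_mono[of 1 "exp 1" 1 "1 + ?n"] in simp)
      then show "(exp 1 * (1 + ?n)) ^ CARD('d) \<le> ((exp 1 * (1 + ?n)) ^ CARD('d))\<^sup>2"
        by (rule self_le_power) simp
    qed simp
    also have "(exp 1 * (1 + ?n)) ^ CARD('d) = exp 1 ^ CARD('d) * (1 + ?n) ^ CARD('d)"
      by (rule power_mult_distrib)
    also have "\<dots> \<le> exp 1 ^ CARD('d) * (C * exp (R / 2 * ?n powr a))"
      by (intro mult_left_mono C) simp
    finally have "sqrt (exp ?n * mi_fact \<alpha>) \<le> ?D * exp (R / 2 * ?n powr a) * sqrt ?P"
      by (simp add: mult_right_mono prod_nonneg mult.assoc)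
    moreover have "sqrt (exp ?n) = exp (?n / 2)" by (rule real_sqrt_unique) (simp_all flip: exp_double)
    ultimately have main: "exp (?n / 2) * sqrt (mi_fact \<alpha>) \<le> ?D * exp (R / 2 * ?n powr a) * sqrt ?P"
      by (simp add: real_sqrt_mult)
    have P: "sqrt ?P = (\<Prod>j\<in>UNIV. \<rho> \<alpha> j ^ (\<alpha> $ j))"
    proof -
      have "sqrt (\<Prod>j\<in>A. real (\<alpha> $ j) ^ (\<alpha> $ j)) = (\<Prod>j\<in>A. \<rho> \<alpha> j ^ (\<alpha> $ j))" for A
        by (induction A rule: infinite_finite_induct) (simp_all add: real_sqrt_mult real_sqrt_power \<rho>_def)
      then show ?thesis .
    qed
    have "\<omega>\<^sub>1 R s z * sqrt (mi_fact \<alpha>) = exp (- R * ?n powr a) * (exp (?n / 2) * sqrt (mi_fact \<alpha>))"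
    proof -
      have "exp (?n / 2 - R * ?n powr a) = exp (- R * ?n powr a) * exp (?n / 2)" by (simp flip: exp_add)
      then show ?thesis unfolding \<omega> by (simp only: mult.assoc)
    qed
    also have "\<dots> \<le> exp (- R * ?n powr a) * (?D * exp (R / 2 * ?n powr a) * sqrt ?P)"
      by (intro mult_left_mono main) simp
    also have "\<dots> = ?D * (exp (- R * ?n powr a) * exp (R / 2 * ?n powr a)) * sqrt ?P" by simp
    also have "exp (- R * ?n powr a) * exp (R / 2 * ?n powr a) = exp_weight (R / 2) a \<alpha>"
      by (simp add: exp_weight_def flip: exp_add)
    finally show "\<omega>\<^sub>1 R s z * sqrt (mi_fact \<alpha>) \<le>
        ?D * exp_weight (R / 2) a \<alpha> * (\<Prod>j\<in>UNIV. \<rho> \<alpha> j ^ (\<alpha> $ j))" unfolding P .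
  qed
qed

section \<open>Estimates for \<open>s = 0\<close>\<close>

text \<open>
  The counterpart of \<^const>\<open>exp_weight\<close> for \<open>s = 0\<close>: being dominated by it means having degree at most \<open>N\<close>.
\<close>

definition degree_cutoff :: "nat \<Rightarrow> nat ^ 'd::finite \<Rightarrow> real" where
  "degree_cutoff N \<alpha> = (if mi_size \<alpha> \<le> N then 1 else 0)"

text \<open>
  The bounded factor \<open>2 ^ N * (1 / 2) ^ |\<alpha>|\<close> is at least 1 in degrees up to \<open>N\<close> and makes the sum
  converge.
\<close>

lemma series_bound_polynomial:
  assumes "real N \<le> R"
  shows "series_bound (degree_cutoff N :: nat ^ 'd::finite \<Rightarrow> real) (\<omega>\<^sub>1 R 0)"
proof -
  have "(\<lambda>\<alpha> :: nat ^ 'd. \<Prod>j\<in>UNIV. (1 / 2 :: real) ^ (\<alpha> $ j)) summable_on multi_indices_on UNIV"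
    by (rule summable_on_multi_indices_geometric) simp_all
  then obtain S where S: "((\<lambda>\<alpha> :: nat ^ 'd. (1 / 2 :: real) ^ mi_size \<alpha>) has_sum S) UNIV"
    unfolding summable_on_def multi_indices_on_UNIV prod_power_eq_power_mi_size by blast
  then have "S \<ge> 0" by (rule has_sum_nonneg) simp
  show ?thesis
  proof (rule series_boundI)
    show "2 ^ N * S + 1 > 0" using \<open>S \<ge> 0\<close> by (simp add: add_nonneg_pos)
    fix z :: "complex ^ 'd"
    have \<omega>: "\<omega>\<^sub>1 R 0 z = japanese z powr R"
      using japanese_ge_1[of z] by (simp add: \<omega>\<^sub>1_def powr_def)
    show "((\<lambda>\<alpha> :: nat ^ 'd. (\<omega>\<^sub>1 R 0 z * 2 ^ N) * (1 / 2) ^ mi_size \<alpha>) has_sum (\<omega>\<^sub>1 R 0 z * 2 ^ N * S)) UNIV"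
      by (rule has_sum_cmult_right[OF S])
    show "\<omega>\<^sub>1 R 0 z * 2 ^ N * S \<le> (2 ^ N * S + 1) * \<omega>\<^sub>1 R 0 z" by (simp add: \<omega> algebra_simps)
    fix \<alpha> :: "nat ^ 'd"
    show "degree_cutoff N \<alpha> * norm (e_fun \<alpha> z) \<le> \<omega>\<^sub>1 R 0 z * 2 ^ N * (1 / 2) ^ mi_size \<alpha>"
    proof (cases "mi_size \<alpha> \<le> N")
      case True
      have "norm (e_fun \<alpha> z) \<le> japanese z powr real (mi_size \<alpha>)"
        using norm_e_fun_le_japanese[of \<alpha> z] japanese_ge_1[of z] by (simp add: powr_realpow)
      also have "\<dots> \<le> japanese z powr R"
        using True assms japanese_ge_1[of z] by (intro powr_mono) auto
      finally have "norm (e_fun \<alpha> z) * 1 \<le> \<omega>\<^sub>1 R 0 z * (2 ^ N * (1 / 2) ^ mi_size \<alpha>)"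
        using True unfolding \<omega>
        by (intro mult_mono) (simp_all add: power_one_over field_simps power_increasing)
      then show ?thesis using True by (simp add: degree_cutoff_def)
    qed (simp add: degree_cutoff_def \<omega>)
  qed
qed

text \<open>
  Liouville's argument: Cauchy's inequality on tori of radius \<open>\<rho>\<close> tending to infinity kills the coefficients of degree
  larger than \<open>R\<close>, and the torus of radius 1 bounds the others.
\<close>

lemma coeff_bound_polynomial:
  assumes "R \<ge> 0" "R \<le> real N"
  shows "coeff_bound (\<omega>\<^sub>1 R 0) (degree_cutoff N :: nat ^ 'd::finite \<Rightarrow> real)"
proof -
  define D where "D = sqrt (1 + real CARD('d)) powr R"
  have bound: "norm (series_coeffs F \<alpha>) * \<rho> ^ mi_size \<alpha> \<le> K * D * \<rho> powr R * sqrt (mi_fact \<alpha>)"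
    if F: "entire F" "\<And>z. norm (F z) \<le> K * \<omega>\<^sub>1 R 0 z" and "K \<ge> 0" "\<rho> \<ge> 1"
    for F :: "complex ^ 'd \<Rightarrow> complex" and K \<rho> \<alpha>
  proof -
    have "norm (series_coeffs F \<alpha>) * (\<Prod>j\<in>UNIV. \<rho> ^ (\<alpha> $ j)) \<le> K * D * \<rho> powr R * sqrt (mi_fact \<alpha>)"
    proof (rule Cauchy_inequality_series_coeffs[OF F(1)])
      fix z :: "complex ^ 'd" assume z: "\<And>j. norm (z $ j) = \<rho>"
      have "\<omega>\<^sub>1 R 0 z = japanese z powr R"
        using japanese_ge_1[of z] by (simp add: \<omega>\<^sub>1_def powr_def)
      also have "\<dots> \<le> (sqrt (1 + real CARD('d)) * \<rho>) powr R"
        using japanese_le_torus[OF z \<open>\<rho> \<ge> 1\<close>] japanese_ge_1[of z] assms by (intro powr_mono2) auto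
      also have "\<dots> = D * \<rho> powr R" using \<open>\<rho> \<ge> 1\<close> by (simp add: D_def powr_mult)
      finally have "K * \<omega>\<^sub>1 R 0 z \<le> K * (D * \<rho> powr R)" using \<open>K \<ge> 0\<close> by (rule mult_left_mono)
      then show "norm (F z) \<le> K * D * \<rho> powr R"
        using F(2)[of z] by (simp only: mult.assoc)
    qed (use \<open>\<rho> \<ge> 1\<close> in simp)
    then show ?thesis by (simp only: prod_power_eq_power_mi_size)
  qed
  \<comment> \<open>The base \<open>N + 1\<close> instead of \<open>N\<close> keeps the powers increasing when \<open>N = 0\<close>.\<close>
  let ?C = "D * sqrt (real (N + 1) ^ (N + 1))"
  show ?thesis
    unfolding coeff_bound_def
  proof (intro exI conjI allI impI)
    show "?C > 0" by (simp add: D_def)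
    fix F :: "complex ^ 'd \<Rightarrow> complex" and K :: real and \<alpha> :: "nat ^ 'd"
    assume K: "K \<ge> 0" and F: "entire F" and le: "\<forall>z. norm (F z) \<le> K * \<omega>\<^sub>1 R 0 z"
    show "norm (series_coeffs F \<alpha>) \<le> ?C * K * degree_cutoff N \<alpha>"
    proof (cases "mi_size \<alpha> \<le> N")
      case True
      have "mi_fact \<alpha> \<le> real (mi_size \<alpha>) ^ mi_size \<alpha>" by (rule mi_fact_le)
      also have "\<dots> \<le> real (N + 1) ^ mi_size \<alpha>" using True by (intro power_mono) auto
      also have "\<dots> \<le> real (N + 1) ^ (N + 1)" using True by (intro power_increasing) auto
      finally have "sqrt (mi_fact \<alpha>) \<le> sqrt (real (N + 1) ^ (N + 1))" by (rule real_sqrt_le_mono)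
      then have "K * D * sqrt (mi_fact \<alpha>) \<le> K * D * sqrt (real (N + 1) ^ (N + 1))"
        using K by (intro mult_left_mono) (auto simp: D_def)
      moreover have "norm (series_coeffs F \<alpha>) \<le> K * D * sqrt (mi_fact \<alpha>)"
        using bound[OF F spec[OF le] K order_refl, of \<alpha>] by simp
      ultimately show ?thesis using True by (simp add: degree_cutoff_def mult_ac)
    next
      case False
      define M where "M = K * D * sqrt (mi_fact \<alpha>)"
      have "norm (series_coeffs F \<alpha>) \<le> M * \<rho> powr (R - real (mi_size \<alpha>))" if "\<rho> \<ge> 1" for \<rho>
      proof -
        have "norm (series_coeffs F \<alpha>) * \<rho> powr real (mi_size \<alpha>) \<le> M * \<rho> powr R"
          using bound[OF F spec[OF le] K that, of \<alpha>] that by (simp add: M_def powr_realpow mult_ac)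
        then have "norm (series_coeffs F \<alpha>) \<le> M * \<rho> powr R / \<rho> powr real (mi_size \<alpha>)"
          using that by (subst pos_le_divide_eq) auto
        then show ?thesis by (simp add: powr_diff)
      qed
      then have "\<forall>\<^sub>F \<rho> in at_top. norm (series_coeffs F \<alpha>) \<le> M * \<rho> powr (R - real (mi_size \<alpha>))"
        using eventually_ge_at_top[of 1] by (rule eventually_mono[rotated])
      moreover have "((\<lambda>\<rho>. M * \<rho> powr (R - real (mi_size \<alpha>))) \<longlongrightarrow> M * 0) at_top"
        using False assms
        by (intro tendsto_mult tendsto_const tendsto_neg_powr filterlim_ident) auto
      ultimately have "norm (series_coeffs F \<alpha>) \<le> M * 0"
        by (intro tendsto_lowerbound) auto
      then show ?thesis using False by (simp add: degree_cutoff_def)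
    qed
  qed
qed

section \<open>From estimates to homeomorphisms\<close>

lemma quasi_norm_SUP:
  fixes v :: "'i \<Rightarrow> real" and X :: "('i \<Rightarrow> complex) set"
  assumes v: "\<And>i. v i \<ge> 0" and bdd: "\<And>f. f \<in> X \<Longrightarrow> bdd_above (range (\<lambda>i. norm (f i) * v i))"
  shows "quasi_norm X (\<lambda>f. SUP i. norm (f i) * v i)"
  unfolding quasi_norm_def
proof (intro conjI exI ballI)
  show "(SUP i. norm ((\<lambda>_. 0 :: complex) i) * v i) = 0" by simp
  fix f g h :: "'i \<Rightarrow> complex" assume fgh: "f \<in> X" "g \<in> X" "h \<in> X"
  have bdd_diff: "bdd_above (range (\<lambda>i. norm (f i - g i) * v i))" if "f \<in> X" "g \<in> X" for f g
  proof (rule bdd_aboveI2)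
    fix i
    have "norm (f i - g i) * v i \<le> norm (f i) * v i + norm (g i) * v i"
      unfolding distrib_right[symmetric] by (intro mult_right_mono v norm_triangle_ineq4)
    also have "\<dots> \<le> (SUP i. norm (f i) * v i) + (SUP i. norm (g i) * v i)"
      by (intro add_mono cSUP_upper bdd that) simp_all
    finally show "norm (f i - g i) * v i \<le> (SUP i. norm (f i) * v i) + (SUP i. norm (g i) * v i)" .
  qed
  have "(SUP i. norm (f i - h i) * v i) \<le> (SUP i. norm (f i - g i) * v i) + (SUP i. norm (g i - h i) * v i)"
  proof (rule cSUP_least)
    fix i
    have "norm (f i - h i) \<le> norm (f i - g i) + norm (g i - h i)"
      using norm_triangle_ineq[of "f i - g i" "g i - h i"] by simp
    then have "norm (f i - h i) * v i \<le> norm (f i - g i) * v i + norm (g i - h i) * v i"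
      unfolding distrib_right[symmetric] by (intro mult_right_mono v)
    also have "\<dots> \<le> (SUP i. norm (f i - g i) * v i) + (SUP i. norm (g i - h i) * v i)"
      by (intro add_mono cSUP_upper bdd_diff fgh) simp_all
    finally show "norm (f i - h i) * v i \<le> (SUP i. norm (f i - g i) * v i) + (SUP i. norm (g i - h i) * v i)" .
  qed simp
  then show "(SUP i. norm (f i - h i) * v i) \<le> 1 * ((SUP i. norm (f i - g i) * v i) + (SUP i. norm (g i - h i) * v i))"
    by simp
qed simp

definition weighted_space :: "(complex ^ 'd::finite \<Rightarrow> real) \<Rightarrow> (complex ^ 'd \<Rightarrow> complex) set" where
  "weighted_space w = {F. entire F \<and> dominated F w}"

definition weighted_norm :: "(complex ^ 'd::finite \<Rightarrow> real) \<Rightarrow> (complex ^ 'd \<Rightarrow> complex) \<Rightarrow> real" where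
  "weighted_norm w F = (SUP z. norm (F z) / w z)"

lemma \<omega>\<^sub>1_pos: "\<omega>\<^sub>1 r s z > 0"
  by (simp add: \<omega>\<^sub>1_def)

lemma weighted_norm_upper:
  assumes w: "\<And>z. w z > 0" and F: "dominated F w"
  shows "norm (F z) \<le> weighted_norm w F * w z" "weighted_norm w F \<ge> 0"
proof -
  obtain C where C: "\<And>z. norm (F z) \<le> C * w z" using F unfolding dominated_def by blast
  have bdd: "bdd_above (range (\<lambda>z. norm (F z) / w z))"
  proof (rule bdd_aboveI2)
    show "norm (F z) / w z \<le> C" for z using C[of z] w[of z] by (simp add: pos_divide_le_eq)
  qed
  have up: "norm (F z) / w z \<le> weighted_norm w F" for z
    unfolding weighted_norm_def by (rule cSUP_upper[OF UNIV_I bdd])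
  show "norm (F z) \<le> weighted_norm w F * w z" using up[of z] w[of z] by (simp add: pos_divide_le_eq)
  have "0 \<le> norm (F 0) / w 0" using w[of 0] by simp
  also note up
  finally show "weighted_norm w F \<ge> 0" .
qed

lemma weighted_norm_least:
  assumes w: "\<And>z. w z > 0" and "K \<ge> 0" and F: "\<And>z. norm (F z) \<le> K * w z"
  shows "dominated F w" "weighted_norm w F \<le> K"
proof -
  have "norm (F z) \<le> (K + 1) * w z" for z using F[of z] w[of z] by (simp add: distrib_right)
  moreover have "K + 1 > 0" using \<open>K \<ge> 0\<close> by simp
  ultimately show "dominated F w" unfolding dominated_def by blast
  show "weighted_norm w F \<le> K"
    unfolding weighted_norm_def
  proof (rule cSUP_least)
    show "norm (F z) / w z \<le> K" for z using F[of z] w[of z] by (simp add: pos_divide_le_eq)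
  qed simp
qed

lemma quasi_norm_weighted:
  assumes w: "\<And>z. w z > 0"
  shows "quasi_norm (weighted_space w) (weighted_norm w)"
proof -
  have "weighted_norm w = (\<lambda>F. SUP z. norm (F z) * (1 / w z))"
    by (simp add: weighted_norm_def fun_eq_iff)
  moreover have "quasi_norm (weighted_space w) (\<lambda>F. SUP z. norm (F z) * (1 / w z))"
  proof (rule quasi_norm_SUP)
    fix F assume "F \<in> weighted_space w"
    then obtain C where "\<And>z. norm (F z) \<le> C * w z" unfolding weighted_space_def dominated_def by blast
    then show "bdd_above (range (\<lambda>z. norm (F z) * (1 / w z)))"
      using w by (intro bdd_aboveI2[where M = C]) (simp add: pos_divide_le_eq)
  qed (use w less_imp_le in auto)
  ultimately show ?thesis by simp
qed

text \<open>
  The next two notions compare a (quasi-)normed space of sequences with the supremum norm for a weight,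
  from either side. Up to a change of the parameter \<open>r\<close> the \<open>\<ell>\<^sup>p\<close> spaces satisfy both, whence the
  independence of \<open>p\<close>.
\<close>

definition dominated_by_norm ::
    "(nat ^ 'd::finite \<Rightarrow> complex) set \<Rightarrow> ((nat ^ 'd \<Rightarrow> complex) \<Rightarrow> real) \<Rightarrow> (nat ^ 'd \<Rightarrow> real) \<Rightarrow> bool" where
  "dominated_by_norm X N u \<longleftrightarrow>
     (\<exists>C>0. \<forall>c\<in>X. 0 \<le> N c \<and> (\<forall>\<alpha>. norm (c \<alpha>) \<le> C * N c * u \<alpha>))"

definition norm_dominated ::
    "(nat ^ 'd::finite \<Rightarrow> real) \<Rightarrow> (nat ^ 'd \<Rightarrow> complex) set \<Rightarrow> ((nat ^ 'd \<Rightarrow> complex) \<Rightarrow> real) \<Rightarrow> bool" where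
  "norm_dominated u X N \<longleftrightarrow>
     (\<exists>C>0. \<forall>c K. K \<ge> 0 \<longrightarrow> (\<forall>\<alpha>. norm (c \<alpha>) \<le> K * u \<alpha>) \<longrightarrow> c \<in> X \<and> N c \<le> C * K)"

lemma norm_dominatedE:
  assumes "norm_dominated u X N"
  obtains C where "C > 0" "\<And>c K. K \<ge> 0 \<Longrightarrow> (\<And>\<alpha>. norm (c \<alpha>) \<le> K * u \<alpha>) \<Longrightarrow> c \<in> X \<and> N c \<le> C * K"
  using assms unfolding norm_dominated_def by meson

lemma dominated_by_normE:
  assumes "dominated_by_norm X N u"
  obtains C where "C > 0" "\<And>c. c \<in> X \<Longrightarrow> 0 \<le> N c" "\<And>c \<alpha>. c \<in> X \<Longrightarrow> norm (c \<alpha>) \<le> C * N c * u \<alpha>"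
  using assms unfolding dominated_by_norm_def by blast

definition truncate_degree :: "nat \<Rightarrow> 'd::finite power_series \<Rightarrow> 'd power_series" where
  "truncate_degree n c \<alpha> = (if mi_size \<alpha> \<le> n then c \<alpha> else 0)"

lemma finite_mi_size_le: "finite {\<alpha> :: nat ^ 'd::finite. mi_size \<alpha> \<le> n}"
proof (rule finite_imageD)
  have "vec_nth ` {\<alpha> :: nat ^ 'd. mi_size \<alpha> \<le> n} \<subseteq> PiE UNIV (\<lambda>_. {..n})"
    using component_le_mi_size order_trans by (fastforce simp: PiE_def)
  then show "finite (vec_nth ` {\<alpha> :: nat ^ 'd. mi_size \<alpha> \<le> n})"
    by (rule finite_subset) (intro finite_PiE finite_class.finite_UNIV finite_atMost)
  show "inj_on vec_nth {\<alpha> :: nat ^ 'd. mi_size \<alpha> \<le> n}" by (rule inj_onI) (simp add: vec_eq_iff)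
qed

lemma truncate_degree_finite: "truncate_degree n c \<in> finite_series"
  unfolding finite_series_def
  by (auto simp: truncate_degree_def intro!: finite_subset[OF _ finite_mi_size_le[of n]] split: if_splits)

text \<open>
  The form in which finite series are dense: truncations converge, possibly only in a weaker
  norm than the one of the space that the sequence is taken from.
\<close>

definition truncations_converge ::
    "('d::finite power_series) set \<Rightarrow> 'd power_series set \<Rightarrow> ('d power_series \<Rightarrow> real) \<Rightarrow> bool" where
  "truncations_converge X Y M \<longleftrightarrow> (\<forall>c\<in>X. (\<forall>n. (\<lambda>\<alpha>. truncate_degree n c \<alpha> - c \<alpha>) \<in> Y) \<and>
     (\<lambda>n. M (\<lambda>\<alpha>. truncate_degree n c \<alpha> - c \<alpha>)) \<longlonglongrightarrow> 0)"

lemma dominated_by_norm_bounded: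
  assumes "dominated_by_norm X N u" "\<And>\<alpha>. u \<alpha> \<le> 1" "c \<in> X"
  obtains K where "\<And>\<alpha>. norm (c \<alpha>) \<le> K"
proof -
  obtain C where C: "C > 0" "0 \<le> N c" "\<And>\<alpha>. norm (c \<alpha>) \<le> C * N c * u \<alpha>"
    using assms(1,3) unfolding dominated_by_norm_def by blast
  have "norm (c \<alpha>) \<le> C * N c * 1" for \<alpha>
    using C(1,2) by (intro order_trans[OF C(3)] mult_left_mono assms(2)) simp
  then show thesis by (rule that)
qed

lemma bargmann_step_bound:
  assumes X: "dominated_by_norm X N u" and u: "\<And>\<alpha>. u \<alpha> \<le> 1" and b: "series_bound u w"
    and w: "\<And>z. w z > 0"
  shows "\<exists>C>0. \<forall>c\<in>X. bargmann c \<in> weighted_space w \<and> weighted_norm w (bargmann c) \<le> C * N c"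
proof -
  obtain A where A: "A > 0" "\<And>c. c \<in> X \<Longrightarrow> 0 \<le> N c" "\<And>c \<alpha>. c \<in> X \<Longrightarrow> norm (c \<alpha>) \<le> A * N c * u \<alpha>"
    using X unfolding dominated_by_norm_def by blast
  obtain B where B: "B > 0"
    "\<And>c K z. K \<ge> 0 \<Longrightarrow> (\<And>\<alpha>. norm (c \<alpha>) \<le> K * u \<alpha>) \<Longrightarrow> norm (bargmann c z) \<le> B * K * w z"
    using b unfolding series_bound_def by meson
  have "bargmann c \<in> weighted_space w \<and> weighted_norm w (bargmann c) \<le> B * A * N c" if c: "c \<in> X" for c
  proof -
    have le: "norm (bargmann c z) \<le> B * (A * N c) * w z" for z
      by (rule B(2)) (use A c in auto)
    have nonneg: "B * (A * N c) \<ge> 0" using A(1) A(2)[OF c] B(1) by simp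
    obtain K where "\<And>\<alpha>. norm (c \<alpha>) \<le> K" using dominated_by_norm_bounded[OF X u c] by blast
    then have "entire (bargmann c)" by (rule entire_bargmann)
    moreover have "dominated (bargmann c) w" "weighted_norm w (bargmann c) \<le> B * (A * N c)"
      by (rule weighted_norm_least[OF w nonneg], rule le)+
    ultimately show ?thesis by (simp add: weighted_space_def mult.assoc)
  qed
  moreover have "B * A > 0" using A(1) B(1) by simp
  ultimately show ?thesis by blast
qed

lemma series_coeffs_step_bound:
  assumes b: "coeff_bound w u" and X: "norm_dominated u X N" and w: "\<And>z. w z > 0"
  shows "\<exists>C>0. \<forall>F\<in>weighted_space w. series_coeffs F \<in> X \<and> N (series_coeffs F) \<le> C * weighted_norm w F"
proof -
  obtain A where A: "A > 0" "\<And>c K. K \<ge> 0 \<Longrightarrow> (\<And>\<alpha>. norm (c \<alpha>) \<le> K * u \<alpha>) \<Longrightarrow> c \<in> X \<and> N c \<le> A * K"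
    using X unfolding norm_dominated_def by meson
  obtain B where B: "B > 0" "\<And>F K \<alpha>. K \<ge> 0 \<Longrightarrow> entire F \<Longrightarrow> (\<And>z. norm (F z) \<le> K * w z) \<Longrightarrow>
      norm (series_coeffs F \<alpha>) \<le> B * K * u \<alpha>"
    using b unfolding coeff_bound_def by meson
  have "series_coeffs F \<in> X \<and> N (series_coeffs F) \<le> A * B * weighted_norm w F"
    if F: "F \<in> weighted_space w" for F
  proof -
    have F': "entire F" "dominated F w" using F by (simp_all add: weighted_space_def)
    note up = weighted_norm_upper[OF w F'(2)]
    have "norm (series_coeffs F \<alpha>) \<le> B * weighted_norm w F * u \<alpha>" for \<alpha>
      by (rule B(2)[OF up(2) F'(1) up(1)])
    from A(2)[OF _ this] show ?thesis using B(1) up(2) by (simp add: mult.assoc)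
  qed
  moreover have "A * B > 0" using A(1) B(1) by simp
  ultimately show ?thesis by blast
qed

lemma series_coeffs_bargmann:
  assumes "\<And>\<alpha>. norm (c \<alpha>) \<le> K"
  shows "series_coeffs (bargmann c) = c"
  by (rule series_coeffs_eqI, rule has_sum_bargmann, rule assms)

lemma bargmann_series_coeffs:
  assumes "entire F"
  shows "bargmann (series_coeffs F) = F"
  unfolding bargmann_def by (rule ext, rule infsumI, rule has_sum_series_coeffs[OF assms])

lemma bounded_some_topology_eq:
  "bounded_some_topology s = inductive_limit_topology {0<..}
     (\<lambda>r. norm_topology (weighted_space (\<omega>\<^sub>1 r s)) (weighted_norm (\<omega>\<^sub>1 r s)))"
  unfolding bounded_some_topology_def weighted_topology_def weighted_space_def weighted_norm_def ..

lemma bounded_every_topology_eq: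
  "bounded_every_topology s = projective_limit_topology {0<..}
     (\<lambda>r. norm_topology (weighted_space (\<omega>\<^sub>1 r s)) (weighted_norm (\<omega>\<^sub>1 r s)))"
  unfolding bounded_every_topology_def weighted_topology_def weighted_space_def weighted_norm_def ..

lemma zero_weighted_space: "(\<lambda>_. 0) \<in> weighted_space (\<omega>\<^sub>1 r s)"
proof -
  have "entire (\<lambda>_ :: complex ^ 'd. 0)"
    unfolding entire_def by (intro allI exI[of _ "\<lambda>_. 0"]) simp
  moreover have "dominated (\<lambda>_. 0) (\<omega>\<^sub>1 r s :: complex ^ 'd \<Rightarrow> real)"
    by (rule weighted_norm_least(1)[OF \<omega>\<^sub>1_pos, of 0]) simp_all
  ultimately show ?thesis by (simp add: weighted_space_def)
qed

text \<open>
  The topological skeleton of the first part: bounds between steps make the map and its inverse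
  continuous, and convergence of truncations makes the extension unique. Linearity of the target
  space is transported from the sequences.
\<close>

lemma inductive_limit_homeomorphism:
  fixes I :: "'r set" and X :: "'r \<Rightarrow> 'd::finite power_series set" and N :: "'r \<Rightarrow> 'd power_series \<Rightarrow> real"
  defines "E \<equiv> \<Union>i\<in>I. X i"
  assumes q: "\<And>i. i \<in> I \<Longrightarrow> quasi_norm (X i) (N i)"
    and zero: "\<And>i. i \<in> I \<Longrightarrow> (\<lambda>_. 0) \<in> X i"
    and lin: "\<And>c c' a b. c \<in> E \<Longrightarrow> c' \<in> E \<Longrightarrow> (\<lambda>\<alpha>. a * c \<alpha> + b * c' \<alpha>) \<in> E"
    and fwd: "\<And>i. i \<in> I \<Longrightarrow> \<exists>u R. R > 0 \<and> dominated_by_norm (X i) (N i) u \<and> (\<forall>\<alpha>. u \<alpha> \<le> 1) \<and>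
      series_bound u (\<omega>\<^sub>1 R s :: complex ^ 'd \<Rightarrow> real)"
    and bwd: "\<And>R. R > 0 \<Longrightarrow> \<exists>i\<in>I. \<exists>u. coeff_bound (\<omega>\<^sub>1 R s) u \<and> norm_dominated u (X i) (N i)"
    and fin: "finite_series \<subseteq> E"
    and trunc: "\<And>i. i \<in> I \<Longrightarrow> \<exists>j\<in>I. truncations_converge (X i) (X j) (N j)"
  shows "extends_uniquely_to_homeomorphism \<P> finite_series
    (inductive_limit_topology I (\<lambda>i. norm_topology (X i) (N i))) (bounded_some_topology s)"
    (is "extends_uniquely_to_homeomorphism _ _ ?S _")
proof -
  let ?Y = "\<lambda>R. weighted_space (\<omega>\<^sub>1 R s) :: (complex ^ 'd \<Rightarrow> complex) set"
  let ?M = "\<lambda>R. weighted_norm (\<omega>\<^sub>1 R s) :: (complex ^ 'd \<Rightarrow> complex) \<Rightarrow> real"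
  let ?T = "inductive_limit_topology {0<..} (\<lambda>R. norm_topology (?Y R) (?M R))"
  define G where "G = (\<Union>R\<in>{0<..}. ?Y R)"
  have topS: "topspace ?S = E"
    using topspace_inductive_limit[of I "\<lambda>i. norm_topology (X i) (N i)"] zero lin
    unfolding topspace_norm_topology E_def by blast
  have topT: "topspace ?T = G"
    unfolding bounded_some_topology_eq[symmetric] topspace_bounded_some
    by (auto simp: G_def weighted_space_def)
  have bounded: "\<exists>K. \<forall>\<alpha>. norm (c \<alpha>) \<le> K" if c: "c \<in> E" for c
  proof -
    obtain i where i: "i \<in> I" "c \<in> X i" using c unfolding E_def by blast
    obtain u where u: "dominated_by_norm (X i) (N i) u" "\<forall>\<alpha>. u \<alpha> \<le> 1" using fwd[OF i(1)] by blast
    show ?thesis using dominated_by_norm_bounded[OF u(1) u(2)[rule_format] i(2)] by blast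
  qed
  have linear: "bargmann (\<lambda>\<alpha>. a * c \<alpha> + b * c' \<alpha>) = (\<lambda>z. a * bargmann c z + b * bargmann c' z)"
    if c: "c \<in> E" "c' \<in> E" for a b c c'
  proof -
    obtain K K' where "\<forall>\<alpha>. norm (c \<alpha>) \<le> K" "\<forall>\<alpha>. norm (c' \<alpha>) \<le> K'"
      using bounded[OF c(1)] bounded[OF c(2)] by blast
    then show ?thesis by (intro bargmann_linear[of _ K _ K']) simp_all
  qed
  have fwd': "\<exists>R\<in>{0<..}. \<exists>C>0. \<forall>c\<in>X i. bargmann c \<in> ?Y R \<and> ?M R (bargmann c) \<le> C * N i c" if i: "i \<in> I" for i
  proof -
    obtain u R where uR: "R > 0" "dominated_by_norm (X i) (N i) u" "\<forall>\<alpha>. u \<alpha> \<le> 1"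
      "series_bound u (\<omega>\<^sub>1 R s :: complex ^ 'd \<Rightarrow> real)" using fwd[OF i] by blast
    show ?thesis
      using bargmann_step_bound[OF uR(2) uR(3)[rule_format] uR(4) \<omega>\<^sub>1_pos] uR(1)
      by (intro bexI[of _ R]) simp_all
  qed
  have bwd': "\<exists>i\<in>I. \<exists>C>0. \<forall>F\<in>?Y R. series_coeffs F \<in> X i \<and> N i (series_coeffs F) \<le> C * ?M R F"
    if R: "R \<in> {0<..}" for R
  proof -
    obtain i u where i: "i \<in> I" "coeff_bound (\<omega>\<^sub>1 R s) u" "norm_dominated u (X i) (N i)"
      using bwd[of R] R by auto
    show ?thesis
      by (rule bexI[OF _ i(1)]) (rule series_coeffs_step_bound[OF i(2,3) \<omega>\<^sub>1_pos])
  qed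
  have into: "bargmann c \<in> G" if "c \<in> E" for c using that fwd' unfolding E_def G_def by blast
  have outof: "series_coeffs F \<in> E" if "F \<in> G" for F using that bwd' unfolding E_def G_def by blast
  have entire: "entire F" if "F \<in> G" for F using that by (auto simp: G_def weighted_space_def)
  \<comment> \<open>Combine the coefficients and map back.\<close>
  have linG: "(\<lambda>z. a * F z + b * H z) \<in> G" if "F \<in> G" "H \<in> G" for F H a b
    using into[OF lin[OF outof[OF that(1)] outof[OF that(2)], of a b]]
    by (simp only: linear[OF outof[OF that(1)] outof[OF that(2)]] bargmann_series_coeffs entire that)
  have cont: "continuous_map ?S ?T bargmann"
    by (rule continuous_map_inductive_limit)
      (use q zero lin linear fwd' topT in \<open>simp_all only: E_def[symmetric] G_def[symmetric]\<close>)
  have cont': "continuous_map ?T ?S series_coeffs"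
  proof (rule continuous_map_inductive_limit)
    show "quasi_norm (?Y R) (?M R)" for R by (rule quasi_norm_weighted) (rule \<omega>\<^sub>1_pos)
    show "(\<lambda>_. 0) \<in> ?Y R" for R by (rule zero_weighted_space)
    show "topspace ?S = (\<Union>i\<in>I. X i)" using topS by (simp only: E_def)
    show "series_coeffs (\<lambda>z. a * F z + b * H z) = (\<lambda>\<alpha>. a * series_coeffs F \<alpha> + b * series_coeffs H \<alpha>)"
      if "F \<in> (\<Union>R\<in>{0<..}. ?Y R)" "H \<in> (\<Union>R\<in>{0<..}. ?Y R)" for F H a b
      using that entire unfolding G_def by (intro series_coeffs_linear) blast+
  qed (use linG bwd' in \<open>simp_all only: G_def[symmetric]\<close>)
  show ?thesis
    unfolding bounded_some_topology_eq
  proof (rule extends_uniquely_by_density[where \<Phi> = bargmann])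
    show "homeomorphic_maps ?S ?T bargmann series_coeffs"
      unfolding homeomorphic_maps_def topS topT
    proof (intro conjI cont cont' ballI)
      fix c assume "c \<in> E"
      then obtain K where "\<forall>\<alpha>. norm (c \<alpha>) \<le> K" using bounded by blast
      then show "series_coeffs (bargmann c) = c" by (intro series_coeffs_bargmann[of _ K]) simp
    qed (simp add: bargmann_series_coeffs entire)
    show "finite_series \<subseteq> topspace ?S" using fin by (simp only: topS)
    show "bargmann c = \<P> c" if "c \<in> finite_series" for c using that by (rule bargmann_finite_series)
    show "\<exists>u. (\<forall>n. u n \<in> finite_series) \<and> limitin ?S u c sequentially" if c: "c \<in> topspace ?S" for c
    proof -
      obtain i where i: "i \<in> I" "c \<in> X i" using c unfolding topS E_def by blast
      obtain j where j: "j \<in> I" "truncations_converge (X i) (X j) (N j)" using trunc[OF i(1)] by blast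
      have lim: "limitin ?S (\<lambda>n. truncate_degree n c) c sequentially"
        by (rule limitin_inductive_limit[OF c j(1)])
          (use j(2) i(2) in \<open>auto simp: truncations_converge_def\<close>)
      show ?thesis
        by (rule exI[of _ "\<lambda>n. truncate_degree n c"]) (simp add: truncate_degree_finite lim)
    qed
    show "continuous_map ?T euclidean (\<lambda>F. F z)" for z
    proof (rule continuous_map_eval_inductive_limit)
      show "quasi_norm (?Y R) (?M R)" for R by (rule quasi_norm_weighted) (rule \<omega>\<^sub>1_pos)
      show "(\<lambda>_. 0) \<in> ?Y R" for R by (rule zero_weighted_space)
      show "\<exists>C>0. \<forall>F\<in>?Y R. norm (F z) \<le> C * ?M R F" for R
      proof (intro exI[of _ "\<omega>\<^sub>1 R s z"] conjI ballI \<omega>\<^sub>1_pos)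
        fix F assume "F \<in> ?Y R"
        then have "dominated F (\<omega>\<^sub>1 R s)" by (simp add: weighted_space_def)
        from weighted_norm_upper(1)[OF _ this, of z]
        show "norm (F z) \<le> \<omega>\<^sub>1 R s z * ?M R F" by (simp add: \<omega>\<^sub>1_pos mult.commute)
      qed
    qed (use linG in \<open>simp_all only: G_def[symmetric]\<close>)
  qed
qed

text \<open>
  The skeleton of the second part. Here \<open>fwd\<close> and \<open>bwd\<close> have to provide, for a given weight on the side
  of the image, a weight on the side of the argument.
\<close>

lemma projective_limit_homeomorphism:
  fixes I :: "'r set" and X :: "'r \<Rightarrow> 'd::finite power_series set" and N :: "'r \<Rightarrow> 'd power_series \<Rightarrow> real"
  defines "E \<equiv> \<Inter>i\<in>I. X i"
  assumes "I \<noteq> {}"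
    and q: "\<And>i. i \<in> I \<Longrightarrow> quasi_norm (X i) (N i)"
    and lin: "\<And>c c'. c \<in> E \<Longrightarrow> c' \<in> E \<Longrightarrow> (\<lambda>\<alpha>. c \<alpha> - c' \<alpha>) \<in> E"
    and fwd: "\<And>R. R > 0 \<Longrightarrow> \<exists>i\<in>I. \<exists>u. dominated_by_norm (X i) (N i) u \<and> (\<forall>\<alpha>. u \<alpha> \<le> 1) \<and>
      series_bound u (\<omega>\<^sub>1 R s :: complex ^ 'd \<Rightarrow> real)"
    and bwd: "\<And>i. i \<in> I \<Longrightarrow> \<exists>u R. R > 0 \<and> coeff_bound (\<omega>\<^sub>1 R s) u \<and> norm_dominated u (X i) (N i)"
    and fin: "finite_series \<subseteq> E"
    and trunc: "\<And>i. i \<in> I \<Longrightarrow> truncations_converge E (X i) (N i)"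
  shows "extends_uniquely_to_homeomorphism \<P> finite_series
    (projective_limit_topology I (\<lambda>i. norm_topology (X i) (N i))) (bounded_every_topology s)"
    (is "extends_uniquely_to_homeomorphism _ _ ?S _")
proof -
  let ?Y = "\<lambda>R. weighted_space (\<omega>\<^sub>1 R s) :: (complex ^ 'd \<Rightarrow> complex) set"
  let ?M = "\<lambda>R. weighted_norm (\<omega>\<^sub>1 R s) :: (complex ^ 'd \<Rightarrow> complex) \<Rightarrow> real"
  let ?T = "projective_limit_topology {0<..} (\<lambda>R. norm_topology (?Y R) (?M R))"
  define G where "G = (\<Inter>R\<in>{0<..}. ?Y R)"
  have pos: "{0::real<..} \<noteq> {}" using greaterThan_iff[of "0::real" 1] zero_less_one by blast
  have topS: "topspace ?S = E"
    unfolding topspace_projective_limit[OF \<open>I \<noteq> {}\<close>] by (simp add: E_def)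
  have topT: "topspace ?T = G"
    unfolding topspace_projective_limit[OF pos] by (simp add: G_def)
  have bounded: "\<exists>K. \<forall>\<alpha>. norm (c \<alpha>) \<le> K" if c: "c \<in> E" for c
  proof -
    obtain i u where i: "i \<in> I" "dominated_by_norm (X i) (N i) u" "\<forall>\<alpha>. u \<alpha> \<le> 1"
      using fwd[OF zero_less_one] by blast
    have "c \<in> X i" using c i(1) by (simp add: E_def)
    then show ?thesis using dominated_by_norm_bounded[OF i(2) i(3)[rule_format]] by blast
  qed
  have diff: "bargmann (\<lambda>\<alpha>. c \<alpha> - c' \<alpha>) = (\<lambda>z. bargmann c z - bargmann c' z)"
    if c: "c \<in> E" "c' \<in> E" for c c'
  proof -
    obtain K K' where K: "\<forall>\<alpha>. norm (c \<alpha>) \<le> K" "\<forall>\<alpha>. norm (c' \<alpha>) \<le> K'"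
      using bounded[OF c(1)] bounded[OF c(2)] by blast
    show ?thesis using bargmann_linear[of c K c' K' 1 "-1"] K by simp
  qed
  have fwd': "\<exists>i\<in>I. \<exists>C>0. \<forall>c\<in>E. bargmann c \<in> ?Y R \<and> ?M R (bargmann c) \<le> C * N i c"
    if "R \<in> {0<..}" for R
  proof -
    obtain i u where iu: "i \<in> I" "dominated_by_norm (X i) (N i) u" "\<forall>\<alpha>. u \<alpha> \<le> 1"
      "series_bound u (\<omega>\<^sub>1 R s :: complex ^ 'd \<Rightarrow> real)" using fwd[of R] \<open>R \<in> {0<..}\<close> by auto
    have "E \<subseteq> X i" using iu(1) by (auto simp: E_def)
    then show ?thesis
      using bargmann_step_bound[OF iu(2) iu(3)[rule_format] iu(4) \<omega>\<^sub>1_pos] iu(1) by blast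
  qed
  have bwd': "\<exists>R\<in>{0<..}. \<exists>C>0. \<forall>F\<in>G. series_coeffs F \<in> X i \<and> N i (series_coeffs F) \<le> C * ?M R F"
    if i: "i \<in> I" for i
  proof -
    obtain u R where u: "R > 0" "coeff_bound (\<omega>\<^sub>1 R s) u" "norm_dominated u (X i) (N i)"
      using bwd[OF i] by blast
    then have R: "R \<in> {0<..}" by simp
    then have "G \<subseteq> ?Y R" unfolding G_def by (rule INT_lower)
    then show ?thesis using series_coeffs_step_bound[OF u(2,3) \<omega>\<^sub>1_pos] R by blast
  qed
  have outof: "series_coeffs F \<in> E" if "F \<in> G" for F using that bwd' unfolding E_def by blast
  have into: "bargmann c \<in> G" if "c \<in> E" for c using that fwd' unfolding G_def by blast
  have G1: "G \<subseteq> ?Y 1" unfolding G_def by (rule INT_lower) simp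
  have entire: "entire F" if "F \<in> G" for F using that G1 by (auto simp: weighted_space_def)
  have linG: "(\<lambda>z. F z - H z) \<in> G" if "F \<in> G" "H \<in> G" for F H
    using into[OF lin[OF outof[OF that(1)] outof[OF that(2)]]]
    by (simp only: diff[OF outof[OF that(1)] outof[OF that(2)]] bargmann_series_coeffs entire that)
  have cont: "continuous_map ?S ?T bargmann"
    by (rule continuous_map_projective_limit)
      (use q \<open>I \<noteq> {}\<close> pos lin diff fwd' in \<open>simp_all only: E_def[symmetric] not_False_eq_True\<close>)
  have cont': "continuous_map ?T ?S series_coeffs"
  proof (rule continuous_map_projective_limit)
    show "quasi_norm (?Y R) (?M R)" for R by (rule quasi_norm_weighted) (rule \<omega>\<^sub>1_pos)
    show "series_coeffs (\<lambda>z. F z - H z) = (\<lambda>\<alpha>. series_coeffs F \<alpha> - series_coeffs H \<alpha>)"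
      if "F \<in> (\<Inter>R\<in>{0<..}. ?Y R)" "H \<in> (\<Inter>R\<in>{0<..}. ?Y R)" for F H
      using series_coeffs_linear[OF entire entire, of F H 1 "-1"] that unfolding G_def by simp
  qed (use linG bwd' \<open>I \<noteq> {}\<close> pos in \<open>simp_all only: G_def[symmetric] not_False_eq_True\<close>)
  show ?thesis
    unfolding bounded_every_topology_eq
  proof (rule extends_uniquely_by_density[where \<Phi> = bargmann])
    show "homeomorphic_maps ?S ?T bargmann series_coeffs"
      unfolding homeomorphic_maps_def topS topT
    proof (intro conjI cont cont' ballI)
      fix c assume "c \<in> E"
      then obtain K where "\<forall>\<alpha>. norm (c \<alpha>) \<le> K" using bounded by blast
      then show "series_coeffs (bargmann c) = c" by (intro series_coeffs_bargmann[of _ K]) simp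
    qed (simp add: bargmann_series_coeffs entire)
    show "finite_series \<subseteq> topspace ?S" using fin by (simp only: topS)
    show "bargmann c = \<P> c" if "c \<in> finite_series" for c using that by (rule bargmann_finite_series)
    show "\<exists>u. (\<forall>n. u n \<in> finite_series) \<and> limitin ?S u c sequentially" if c: "c \<in> topspace ?S" for c
    proof -
      have cE: "c \<in> E" using c by (simp only: topS)
      have lim: "limitin ?S (\<lambda>n. truncate_degree n c) c sequentially"
      proof (rule limitin_projective_limit[OF \<open>I \<noteq> {}\<close>])
        show "c \<in> X i" if "i \<in> I" for i using cE that by (simp add: E_def)
        show "truncate_degree n c \<in> X i" if "i \<in> I" for i n
          using truncate_degree_finite fin that unfolding E_def by blast
        show "(\<lambda>n. N i (\<lambda>\<alpha>. truncate_degree n c \<alpha> - c \<alpha>)) \<longlonglongrightarrow> 0" if "i \<in> I" for i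
          using trunc[OF that] cE by (simp add: truncations_converge_def)
      qed
      show ?thesis
        by (rule exI[of _ "\<lambda>n. truncate_degree n c"]) (simp add: truncate_degree_finite lim)
    qed
    show "continuous_map ?T euclidean (\<lambda>F. F z)" for z
    proof (rule continuous_map_eval_projective_limit)
      show "(1::real) \<in> {0<..}" by simp
      show "quasi_norm (?Y 1) (?M 1)" by (rule quasi_norm_weighted) (rule \<omega>\<^sub>1_pos)
      show "\<omega>\<^sub>1 1 s z > 0" by (rule \<omega>\<^sub>1_pos)
      fix F H assume F: "F \<in> ?Y 1" and H: "H \<in> ?Y 1"
      have dF: "dominated F (\<omega>\<^sub>1 1 s)" and dH: "dominated H (\<omega>\<^sub>1 1 s)"
        using F H by (simp_all add: weighted_space_def)
      note up = weighted_norm_upper[OF \<omega>\<^sub>1_pos dF] weighted_norm_upper[OF \<omega>\<^sub>1_pos dH]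
      have "dominated (\<lambda>z. H z - F z) (\<omega>\<^sub>1 1 s)"
      proof (rule weighted_norm_least(1)[OF \<omega>\<^sub>1_pos])
        show "?M 1 H + ?M 1 F \<ge> 0" using up by simp
        show "norm (H z - F z) \<le> (?M 1 H + ?M 1 F) * \<omega>\<^sub>1 1 s z" for z
          unfolding distrib_right by (rule order_trans[OF norm_triangle_ineq4 add_mono[OF up(3) up(1)]])
      qed
      from weighted_norm_upper(1)[OF \<omega>\<^sub>1_pos this, of z]
      show "norm (H z - F z) \<le> \<omega>\<^sub>1 1 s z * ?M 1 (\<lambda>z. H z - F z)" by (simp only: mult.commute)
    qed
  qed
qed

section \<open>Weighted sequence spaces\<close>

lemma lp_norm_upper:
  assumes "p > 0" "lp_mem p f"
  shows "norm (f i) \<le> lp_norm p f" "lp_norm p f \<ge> 0"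
proof -
  have "norm (f i) \<le> lp_norm p f" for i
  proof (cases "p = \<infinity>")
    case True
    then have "bdd_above (range (\<lambda>i. norm (f i)))" using assms by (simp add: lp_mem_def)
    from cSUP_upper[OF UNIV_I this] show ?thesis using True by (simp add: lp_norm_def)
  next
    case False
    define q where "q = enn2real p"
    have q: "q > 0" using assms(1) False by (simp add: q_def enn2real_positive_iff less_top)
    have sum: "(\<lambda>i. norm (f i) powr q) summable_on UNIV" using assms(2) False by (simp add: lp_mem_def q_def)
    have "norm (f i) powr q \<le> (\<Sum>\<^sub>\<infinity>i. norm (f i) powr q)"
      using finite_sum_le_infsum[OF sum, of "{i}"] by simp
    then have "(norm (f i) powr q) powr (1 / q) \<le> (\<Sum>\<^sub>\<infinity>i. norm (f i) powr q) powr (1 / q)"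
      using q by (intro powr_mono2) auto
    then show ?thesis using q False by (simp add: powr_powr lp_norm_def q_def)
  qed
  from this[of i] this[of undefined] show "norm (f i) \<le> lp_norm p f" "lp_norm p f \<ge> 0"
    using norm_ge_zero order_trans by blast+
qed

text \<open>
  For finite \<open>p\<close> the constant comes from \<open>(x + y) powr q \<le> 2 powr q * (x powr q + y powr q)\<close>, applied with
  \<open>q = p\<close> to each term and with \<open>q = 1/p\<close> to the sums.
\<close>

lemma quasi_norm_lp:
  fixes v :: "'i \<Rightarrow> real"
  assumes "p > 0" and v: "\<And>i. v i \<ge> 0"
  shows "quasi_norm {c. lp_mem p (\<lambda>i. c i * complex_of_real (v i))}
           (\<lambda>c. lp_norm p (\<lambda>i. c i * complex_of_real (v i)))"
proof (cases "p = \<infinity>")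
  case True
  have "quasi_norm {c. lp_mem p (\<lambda>i. c i * complex_of_real (v i))} (\<lambda>c. SUP i. norm (c i) * v i)"
    by (rule quasi_norm_SUP[OF v]) (use True v in \<open>simp add: lp_mem_def norm_mult\<close>)
  moreover have "(\<lambda>c. lp_norm p (\<lambda>i. c i * complex_of_real (v i))) = (\<lambda>c. SUP i. norm (c i) * v i)"
    using True v by (simp add: lp_norm_def norm_mult)
  ultimately show ?thesis by simp
next
  case False
  define q where "q = enn2real p"
  have q: "q > 0" using assms(1) False by (simp add: q_def enn2real_positive_iff less_top)
  define A where "A c = (\<Sum>\<^sub>\<infinity>i. (norm (c i) * v i) powr q)" for c :: "'i \<Rightarrow> complex"
  have N: "lp_norm p (\<lambda>i. c i * complex_of_real (v i)) = A c powr (1 / q)" for c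
    using False v by (simp add: lp_norm_def A_def q_def norm_mult)
  have mem: "lp_mem p (\<lambda>i. c i * complex_of_real (v i)) \<longleftrightarrow> (\<lambda>i. (norm (c i) * v i) powr q) summable_on UNIV" for c
    using False v by (simp add: lp_mem_def q_def norm_mult)
  have A0: "A c \<ge> 0" for c unfolding A_def by (rule infsum_nonneg) simp
  have tri: "(\<lambda>i. (norm (f i + g i) * v i) powr q) summable_on UNIV \<and> A (\<lambda>i. f i + g i) \<le> 2 powr q * (A f + A g)"
    if f: "(\<lambda>i. (norm (f i) * v i) powr q) summable_on UNIV"
      and g: "(\<lambda>i. (norm (g i) * v i) powr q) summable_on UNIV" for f g :: "'i \<Rightarrow> complex"
  proof -
    have le: "(norm (f i + g i) * v i) powr q \<le> 2 powr q * ((norm (f i) * v i) powr q + (norm (g i) * v i) powr q)" for i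
    proof -
      have "norm (f i + g i) * v i \<le> norm (f i) * v i + norm (g i) * v i"
        unfolding distrib_right[symmetric] by (intro mult_right_mono v norm_triangle_ineq)
      then have "(norm (f i + g i) * v i) powr q \<le> (norm (f i) * v i + norm (g i) * v i) powr q"
        using q v by (intro powr_mono2) auto
      also have "\<dots> \<le> 2 powr q * ((norm (f i) * v i) powr q + (norm (g i) * v i) powr q)"
        using q v by (intro powr_add_le) auto
      finally show ?thesis .
    qed
    have sum: "((\<lambda>i. 2 powr q * ((norm (f i) * v i) powr q + (norm (g i) * v i) powr q)) has_sum
        2 powr q * (A f + A g)) UNIV"
      unfolding A_def by (intro has_sum_cmult_right has_sum_add has_sum_infsum f g)
    have s: "(\<lambda>i. (norm (f i + g i) * v i) powr q) summable_on UNIV"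
      by (rule summable_on_comparison_test[OF has_sum_imp_summable[OF sum] le]) simp
    moreover have "A (\<lambda>i. f i + g i) \<le> 2 powr q * (A f + A g)"
      unfolding A_def[of "\<lambda>i. f i + g i"] by (rule has_sum_mono[OF has_sum_infsum[OF s] sum le])
    ultimately show ?thesis by simp
  qed
  show ?thesis
    unfolding quasi_norm_def N mem
  proof (intro conjI exI ballI)
    show "A (\<lambda>_. 0) powr (1 / q) = 0" using q by (simp add: A_def)
    show "2 * 2 powr (1 / q) > (0::real)" by simp
    fix f g h :: "'i \<Rightarrow> complex"
    assume "f \<in> {c. (\<lambda>i. (norm (c i) * v i) powr q) summable_on UNIV}"
      "g \<in> {c. (\<lambda>i. (norm (c i) * v i) powr q) summable_on UNIV}"
      "h \<in> {c. (\<lambda>i. (norm (c i) * v i) powr q) summable_on UNIV}"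
    then have f: "(\<lambda>i. (norm (f i) * v i) powr q) summable_on UNIV"
      and g: "(\<lambda>i. (norm (g i) * v i) powr q) summable_on UNIV" "(\<lambda>i. (norm (- g i) * v i) powr q) summable_on UNIV"
      and h: "(\<lambda>i. (norm (- h i) * v i) powr q) summable_on UNIV" by simp_all
    have "A (\<lambda>i. (f i + - g i) + (g i + - h i)) \<le> 2 powr q * (A (\<lambda>i. f i + - g i) + A (\<lambda>i. g i + - h i))"
      using tri[OF tri[OF f g(2), THEN conjunct1] tri[OF g(1) h, THEN conjunct1]] by blast
    then have "A (\<lambda>i. f i - h i) powr (1 / q) \<le> (2 powr q * (A (\<lambda>i. f i - g i) + A (\<lambda>i. g i - h i))) powr (1 / q)"
      using q A0 by (intro powr_mono2) simp_all
    also have "\<dots> = 2 * (A (\<lambda>i. f i - g i) + A (\<lambda>i. g i - h i)) powr (1 / q)"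
      using q A0 by (simp add: powr_mult powr_powr)
    also have "\<dots> \<le> 2 * (2 powr (1 / q) * (A (\<lambda>i. f i - g i) powr (1 / q) + A (\<lambda>i. g i - h i) powr (1 / q)))"
      using q A0 by (intro mult_left_mono powr_add_le) auto
    finally show "A (\<lambda>i. f i - h i) powr (1 / q) \<le> 2 * 2 powr (1 / q) * (A (\<lambda>i. f i - g i) powr (1 / q) + A (\<lambda>i. g i - h i) powr (1 / q))"
      by (simp only: mult.assoc)
  qed
qed

definition lp_space :: "ennreal \<Rightarrow> real \<Rightarrow> real \<Rightarrow> 'd::finite power_series set" where
  "lp_space p s r = {c. lp_mem p (\<lambda>\<alpha>. c \<alpha> * complex_of_real (\<theta> r s \<alpha>))}"

definition lp_weighted_norm :: "ennreal \<Rightarrow> real \<Rightarrow> real \<Rightarrow> 'd::finite power_series \<Rightarrow> real" where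
  "lp_weighted_norm p s r c = lp_norm p (\<lambda>\<alpha>. c \<alpha> * complex_of_real (\<theta> r s \<alpha>))"

lemma lp_topology_\<theta>: "lp_topology p (\<theta> r s) = norm_topology (lp_space p s r) (lp_weighted_norm p s r)"
  unfolding lp_topology_def lp_space_def lp_weighted_norm_def ..

lemma quasi_norm_lp_space: "p > 0 \<Longrightarrow> quasi_norm (lp_space p s r) (lp_weighted_norm p s r)"
  unfolding lp_space_def lp_weighted_norm_def by (rule quasi_norm_lp) (simp_all add: \<theta>_def)

lemma \<theta>_mult_exp_weight: "exp_weight r (1 / (2 * s)) \<alpha> * \<theta> r' s \<alpha> = exp_weight (r - r') (1 / (2 * s)) \<alpha>"
  by (simp add: exp_weight_def \<theta>_def algebra_simps flip: exp_add)

lemma exp_weight_le_1: "r \<ge> 0 \<Longrightarrow> exp_weight r a \<alpha> \<le> 1"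
  by (simp add: exp_weight_def)

lemma exp_weight_antimono: "r \<le> r' \<Longrightarrow> exp_weight r' a \<alpha> \<le> exp_weight r a \<alpha>"
  by (simp add: exp_weight_def mult_right_mono)

lemma exp_weight_pos: "exp_weight r a \<alpha> > 0"
  by (simp add: exp_weight_def)

text \<open>
  A single term is bounded by the whole norm.
\<close>

lemma dominated_by_lp_norm:
  assumes "p > 0"
  shows "dominated_by_norm (lp_space p s r :: 'd::finite power_series set) (lp_weighted_norm p s r)
    (exp_weight r (1 / (2 * s)))"
  unfolding dominated_by_norm_def
proof (intro exI[of _ 1] conjI ballI allI)
  fix c :: "'d power_series" and \<alpha> assume "c \<in> lp_space p s r"
  then have mem: "lp_mem p (\<lambda>\<alpha>. c \<alpha> * complex_of_real (\<theta> r s \<alpha>))" by (simp add: lp_space_def)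
  show "0 \<le> lp_weighted_norm p s r c"
    unfolding lp_weighted_norm_def by (rule lp_norm_upper[OF assms mem])
  have "norm (c \<alpha> * complex_of_real (\<theta> r s \<alpha>)) \<le> lp_weighted_norm p s r c"
    unfolding lp_weighted_norm_def by (rule lp_norm_upper[OF assms mem])
  then have "norm (c \<alpha>) * \<theta> r s \<alpha> \<le> lp_weighted_norm p s r c" by (simp add: norm_mult \<theta>_def)
  then show "norm (c \<alpha>) \<le> 1 * lp_weighted_norm p s r c * exp_weight r (1 / (2 * s)) \<alpha>"
    by (simp add: \<theta>_def exp_weight_def exp_minus field_simps)
qed simp

text \<open>
  Passing from \<open>2r\<close> to \<open>r\<close> leaves the summable factor \<^term>\<open>exp_weight r (1 / (2 * s))\<close>, of which any power
  with positive exponent is summable as well.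
\<close>

lemma lp_norm_dominated:
  assumes "p > 0" "s > 0" "r > 0"
  shows "norm_dominated (exp_weight (2 * r) (1 / (2 * s)) :: nat ^ 'd::finite \<Rightarrow> real)
    (lp_space p s r) (lp_weighted_norm p s r)"
proof -
  define a where "a = 1 / (2 * s)"
  have a: "a > 0" using assms by (simp add: a_def)
  have le: "norm (c \<alpha> * complex_of_real (\<theta> r s \<alpha>)) \<le> K * exp_weight r a \<alpha>"
    if "norm (c \<alpha>) \<le> K * exp_weight (2 * r) a \<alpha>" for c :: "'d power_series" and \<alpha> K
  proof -
    have "norm (c \<alpha> * complex_of_real (\<theta> r s \<alpha>)) = norm (c \<alpha>) * \<theta> r s \<alpha>"
      by (simp add: norm_mult \<theta>_def)
    also have "\<dots> \<le> (K * exp_weight (2 * r) a \<alpha>) * \<theta> r s \<alpha>"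
      using that by (intro mult_right_mono) (simp_all add: \<theta>_def)
    finally show ?thesis by (simp add: a_def mult.assoc \<theta>_mult_exp_weight)
  qed
  show ?thesis
  proof (cases "p = \<infinity>")
    case True
    have main: "c \<in> lp_space p s r \<and> lp_weighted_norm p s r c \<le> 1 * K"
      if "K \<ge> 0" "\<forall>\<alpha>. norm (c \<alpha>) \<le> K * exp_weight (2 * r) a \<alpha>" for c :: "'d power_series" and K
    proof -
      have K: "norm (c \<alpha> * complex_of_real (\<theta> r s \<alpha>)) \<le> K" for \<alpha>
      proof -
        have "K * exp_weight r a \<alpha> \<le> K * 1"
          using that(1) assms by (intro mult_left_mono exp_weight_le_1) auto
        then show ?thesis using le[of c \<alpha> K, OF that(2)[rule_format]] by simp
      qed
      then have "bdd_above (range (\<lambda>\<alpha>. norm (c \<alpha> * complex_of_real (\<theta> r s \<alpha>))))" by (rule bdd_aboveI2)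
      moreover have "(SUP \<alpha>. norm (c \<alpha> * complex_of_real (\<theta> r s \<alpha>))) \<le> K" by (rule cSUP_least) (simp, rule K)
      ultimately show ?thesis
        using True by (simp add: lp_space_def lp_weighted_norm_def lp_mem_def lp_norm_def)
    qed
    show ?thesis
      unfolding norm_dominated_def a_def[symmetric]
      by (intro exI[of _ 1] conjI[OF zero_less_one] allI impI) (rule main)
  next
    case False
    define q where "q = enn2real p"
    have q: "q > 0" using assms(1) False by (simp add: q_def enn2real_positive_iff less_top)
    define S where "S = infsum (exp_weight (r * q) a) (UNIV :: (nat ^ 'd) set)"
    have S: "(exp_weight (r * q) a has_sum S) (UNIV :: (nat ^ 'd) set)"
      unfolding S_def using a q assms by (intro has_sum_infsum summable_on_exp_weight) auto
    have S0: "S \<ge> 0" using S by (rule has_sum_nonneg) (simp add: exp_weight_pos less_imp_le)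
    have main: "c \<in> lp_space p s r \<and> lp_weighted_norm p s r c \<le> (S powr (1 / q) + 1) * K"
      if K: "K \<ge> 0" "\<forall>\<alpha>. norm (c \<alpha>) \<le> K * exp_weight (2 * r) a \<alpha>" for c :: "'d power_series" and K
    proof -
      let ?f = "\<lambda>\<alpha>. norm (c \<alpha> * complex_of_real (\<theta> r s \<alpha>)) powr q"
      have f: "?f \<alpha> \<le> K powr q * exp_weight (r * q) a \<alpha>" for \<alpha>
      proof -
        have "?f \<alpha> \<le> (K * exp_weight r a \<alpha>) powr q"
          using q le[of c \<alpha> K, OF K(2)[rule_format]] by (intro powr_mono2) auto
        also have "\<dots> = K powr q * exp_weight r a \<alpha> powr q"
          using K(1) exp_weight_pos[of r a \<alpha>] by (simp add: powr_mult)
        also have "exp_weight r a \<alpha> powr q = exp_weight (r * q) a \<alpha>"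
          by (simp add: exp_weight_def exp_powr_real mult_ac)
        finally show ?thesis .
      qed
      have sum: "((\<lambda>\<alpha> :: nat ^ 'd. K powr q * exp_weight (r * q) a \<alpha>) has_sum (K powr q * S)) UNIV"
        by (rule has_sum_cmult_right[OF S])
      have fs: "?f summable_on UNIV"
        by (rule summable_on_comparison_test[OF has_sum_imp_summable[OF sum] f]) simp
      have "infsum ?f UNIV \<le> K powr q * S" by (rule has_sum_mono[OF has_sum_infsum[OF fs] sum f])
      moreover have "infsum ?f UNIV \<ge> 0" by (rule infsum_nonneg) simp
      ultimately have "infsum ?f UNIV powr (1 / q) \<le> (K powr q * S) powr (1 / q)"
        using q by (intro powr_mono2) auto
      also have "\<dots> = K * S powr (1 / q)" using q K(1) S0 by (simp add: powr_mult powr_powr)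
      also have "\<dots> \<le> (S powr (1 / q) + 1) * K" using K(1) by (simp add: algebra_simps)
      finally show ?thesis
        using fs False by (simp add: lp_space_def lp_weighted_norm_def lp_mem_def lp_norm_def q_def)
    qed
    have pos: "S powr (1 / q) + 1 > 0" by (simp add: add_nonneg_pos)
    show ?thesis
      unfolding norm_dominated_def a_def[symmetric]
      by (intro exI[of _ "S powr (1 / q) + 1"] conjI[OF pos] allI impI) (rule main)
  qed
qed

lemma mem_lp_spaceI:
  fixes c :: "'d::finite power_series"
  assumes "p > 0" "s > 0" "r > 0" "\<And>\<alpha>. norm (c \<alpha>) \<le> K * exp_weight (2 * r) (1 / (2 * s)) \<alpha>"
  shows "c \<in> lp_space p s r"
proof -
  have "0 \<le> K * exp_weight (2 * r) (1 / (2 * s)) (0 :: nat ^ 'd)"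
    by (rule order_trans[OF norm_ge_zero assms(4)])
  then have K: "K \<ge> 0" using exp_weight_pos[of "2 * r" "1 / (2 * s)" "0 :: nat ^ 'd"] by (simp add: zero_le_mult_iff)
  obtain C where "\<And>(c :: 'd power_series) K. K \<ge> 0 \<Longrightarrow>
      (\<And>\<alpha>. norm (c \<alpha>) \<le> K * exp_weight (2 * r) (1 / (2 * s)) \<alpha>) \<Longrightarrow> c \<in> lp_space p s r \<and> lp_weighted_norm p s r c \<le> C * K"
    using lp_norm_dominated[OF assms(1,2,3)] by (rule norm_dominatedE) blast
  from this[OF K assms(4)] show ?thesis by (rule conjunct1)
qed

lemma mem_lp_spaceE:
  fixes c :: "'d::finite power_series"
  assumes "p > 0" "c \<in> lp_space p s r"
  obtains K where "K \<ge> 0" "\<And>\<alpha>. norm (c \<alpha>) \<le> K * exp_weight r (1 / (2 * s)) \<alpha>"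
proof -
  obtain C where C: "C > 0" "\<And>c :: 'd power_series. c \<in> lp_space p s r \<Longrightarrow> 0 \<le> lp_weighted_norm p s r c"
    "\<And>(c :: 'd power_series) \<alpha>. c \<in> lp_space p s r \<Longrightarrow>
      norm (c \<alpha>) \<le> C * lp_weighted_norm p s r c * exp_weight r (1 / (2 * s)) \<alpha>"
    using dominated_by_lp_norm[OF assms(1), of s r] by (rule dominated_by_normE) blast
  show thesis
  proof (rule that)
    show "C * lp_weighted_norm p s r c \<ge> 0" using C(1) C(2)[OF assms(2)] by simp
  qed (rule C(3)[OF assms(2)])
qed

lemma lp_space_linear:
  fixes c c' :: "'d::finite power_series"
  assumes "p > 0" "s > 0" "r > 0" "2 * r \<le> r1" "2 * r \<le> r2"
    and c: "c \<in> lp_space p s r1" "c' \<in> lp_space p s r2"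
  shows "(\<lambda>\<alpha>. x * c \<alpha> + y * c' \<alpha>) \<in> lp_space p s r"
proof -
  let ?u = "exp_weight (2 * r) (1 / (2 * s))"
  obtain K where K: "K \<ge> 0" "\<And>\<alpha>. norm (c \<alpha>) \<le> K * exp_weight r1 (1 / (2 * s)) \<alpha>"
    using mem_lp_spaceE[OF assms(1) c(1)] by blast
  obtain K' where K': "K' \<ge> 0" "\<And>\<alpha>. norm (c' \<alpha>) \<le> K' * exp_weight r2 (1 / (2 * s)) \<alpha>"
    using mem_lp_spaceE[OF assms(1) c(2)] by blast
  show ?thesis
  proof (rule mem_lp_spaceI[OF assms(1-3)])
    fix \<alpha>
    have "norm (c \<alpha>) \<le> K * ?u \<alpha>"
      by (intro order_trans[OF K(2)] mult_left_mono exp_weight_antimono assms K(1))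
    moreover have "norm (c' \<alpha>) \<le> K' * ?u \<alpha>"
      by (intro order_trans[OF K'(2)] mult_left_mono exp_weight_antimono assms K'(1))
    ultimately have "norm x * norm (c \<alpha>) + norm y * norm (c' \<alpha>) \<le> norm x * (K * ?u \<alpha>) + norm y * (K' * ?u \<alpha>)"
      by (intro add_mono mult_left_mono) auto
    then show "norm (x * c \<alpha> + y * c' \<alpha>) \<le> (norm x * K + norm y * K') * ?u \<alpha>"
      using norm_triangle_ineq[of "x * c \<alpha>" "y * c' \<alpha>"] by (simp add: norm_mult distrib_right mult.assoc)
  qed
qed

lemma finite_series_subset_lp_space:
  assumes "p > 0" "s > 0" "r > 0"
  shows "finite_series \<subseteq> (lp_space p s r :: 'd::finite power_series set)"
proof
  fix c :: "'d power_series" assume "c \<in> finite_series"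
  then have fin: "finite {\<alpha>. c \<alpha> \<noteq> 0}" by (simp add: finite_series_def)
  let ?u = "exp_weight (2 * r) (1 / (2 * s))"
  show "c \<in> lp_space p s r"
  proof (rule mem_lp_spaceI[OF assms])
    fix \<alpha>
    have "norm (c \<alpha>) / ?u \<alpha> \<le> (\<Sum>\<beta> | c \<beta> \<noteq> 0. norm (c \<beta>) / ?u \<beta>)"
    proof (cases "c \<alpha> = 0")
      case True
      then show ?thesis by (simp add: sum_nonneg exp_weight_pos less_imp_le)
    next
      case False
      then show ?thesis using fin by (intro member_le_sum) (auto simp: exp_weight_pos less_imp_le)
    qed
    then show "norm (c \<alpha>) \<le> (\<Sum>\<beta> | c \<beta> \<noteq> 0. norm (c \<beta>) / ?u \<beta>) * ?u \<alpha>"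
      using exp_weight_pos[of "2 * r" "1 / (2 * s)" \<alpha>] by (simp only: pos_divide_le_eq)
  qed
qed

text \<open>
  Of the decay \<open>4r\<close> one half gives the factor \<open>exp (- 2 r n powr a)\<close> tending to 0 for the tail beyond degree
  \<open>n\<close>, the other half the membership in the space with parameter \<open>r\<close>.
\<close>

lemma truncations_converge_lp_space:
  assumes "p > 0" "s > 0" "r > 0"
  shows "truncations_converge (lp_space p s (4 * r) :: 'd::finite power_series set)
    (lp_space p s r) (lp_weighted_norm p s r)"
  unfolding truncations_converge_def
proof (intro ballI)
  define a where "a = 1 / (2 * s)"
  have a: "a > 0" using assms by (simp add: a_def)
  fix c :: "'d power_series" assume "c \<in> lp_space p s (4 * r)"
  then obtain K where K: "K \<ge> 0" "\<And>\<alpha>. norm (c \<alpha>) \<le> K * exp_weight (4 * r) a \<alpha>"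
    using mem_lp_spaceE[OF assms(1)] unfolding a_def by blast
  obtain C where C: "C > 0" "\<And>c' K. K \<ge> 0 \<Longrightarrow> (\<And>\<alpha>. norm (c' \<alpha>) \<le> K * exp_weight (2 * r) a \<alpha>) \<Longrightarrow>
      c' \<in> (lp_space p s r :: 'd power_series set) \<and> lp_weighted_norm p s r c' \<le> C * K"
    using lp_norm_dominated[OF assms, where 'd = 'd] unfolding a_def by (rule norm_dominatedE) blast
  define \<epsilon> where "\<epsilon> n = exp (- (2 * r) * real n powr a)" for n :: nat
  let ?d = "\<lambda>n \<alpha>. truncate_degree n c \<alpha> - c \<alpha>"
  have d: "norm (?d n \<alpha>) \<le> (K * \<epsilon> n) * exp_weight (2 * r) a \<alpha>" for n \<alpha>
  proof (cases "mi_size \<alpha> \<le> n")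
    case True
    then show ?thesis using K(1) by (simp add: truncate_degree_def \<epsilon>_def exp_weight_def)
  next
    case False
    have "norm (?d n \<alpha>) \<le> K * exp_weight (2 * (2 * r)) a \<alpha>"
      using False K(2)[of \<alpha>] by (simp add: truncate_degree_def)
    also have "\<dots> \<le> K * (\<epsilon> n * exp_weight (2 * r) a \<alpha>)"
      unfolding \<epsilon>_def using False a assms K(1) by (intro mult_left_mono exp_weight_decay) auto
    finally show ?thesis by (simp only: mult.assoc)
  qed
  have K\<epsilon>: "K * \<epsilon> n \<ge> 0" for n using K(1) by (simp add: \<epsilon>_def)
  have mem: "?d n \<in> lp_space p s r" "lp_weighted_norm p s r (?d n) \<le> C * (K * \<epsilon> n)" for n
    using C(2)[OF K\<epsilon>[of n] d[of n]] by blast+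
  have nonneg: "lp_weighted_norm p s r (?d n) \<ge> 0" for n
    using lp_norm_upper(2)[OF assms(1), of "\<lambda>\<alpha>. ?d n \<alpha> * complex_of_real (\<theta> r s \<alpha>)"] mem(1)[of n]
    by (simp add: lp_space_def lp_weighted_norm_def)
  have "((\<lambda>x. exp (- (2 * r) * x powr a)) \<longlongrightarrow> 0) at_top"
    using a assms by real_asymp
  then have "\<epsilon> \<longlonglongrightarrow> 0"
    unfolding \<epsilon>_def by (rule filterlim_compose[OF _ filterlim_real_sequentially])
  then have "(\<lambda>n. C * (K * \<epsilon> n)) \<longlonglongrightarrow> C * (K * 0)" by (intro tendsto_intros)
  then have lim: "(\<lambda>n. C * (K * \<epsilon> n)) \<longlonglongrightarrow> 0" by simp
  have "(\<lambda>n. lp_weighted_norm p s r (?d n)) \<longlonglongrightarrow> 0"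
    by (rule tendsto_sandwich[OF _ _ tendsto_const lim]) (simp_all add: nonneg mem(2))
  then show "(\<forall>n. ?d n \<in> lp_space p s r) \<and> (\<lambda>n. lp_weighted_norm p s r (?d n)) \<longlonglongrightarrow> 0"
    using mem(1) by blast
qed

section \<open>The homeomorphisms\<close>

text \<open>
  The following four lemmas solve the conditions that relate \<open>r\<close> and \<open>R\<close> in the estimates above. The
  inductive limit needs the weight of the image for a given weight of the argument (this lemma and
  the next one), the projective limit the converse (the two lemmas after them).
\<close>

lemma ex_growth_weight_series_bound:
  assumes "s > 0" "r > 0"
  shows "\<exists>R>0. series_bound (exp_weight r (1 / (2 * s)) :: nat ^ 'd::finite \<Rightarrow> real) (\<omega>\<^sub>1 R s)"
proof (cases "s < 1 / 2")
  case True
  let ?R = "(r / 2) powr (- 1 / (1 / (2 * s) - 1))"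
  have "?R > 0" using assms by simp
  then show ?thesis using series_bound_log_growth[OF assms(1) True refl assms(2) order_refl] by blast
next
  case False
  then have s: "s \<ge> 1 / 2" by simp
  let ?a = "1 / (2 * s)"
  \<comment> \<open>The second bound is what \<open>s = 1/2\<close> demands.\<close>
  define R where "R = min (r / (2 * 2 powr ?a)) ((1 - ln 2) / 4)"
  have "R > 0" using assms ln_2_less_1 by (simp add: R_def)
  moreover have "2 * R * 2 powr ?a \<le> r"
  proof -
    have "R \<le> r / (2 * 2 powr ?a)" by (simp add: R_def)
    then show ?thesis by (simp add: field_simps)
  qed
  moreover have "4 * R \<le> 1 - ln 2" by (simp add: R_def min_def)
  ultimately show ?thesis using series_bound_gaussian[OF s refl assms(2)] by blast
qed

lemma ex_coefficient_weight_coeff_bound: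
  assumes "s > 0" "R > 0"
  shows "\<exists>r>0. coeff_bound (\<omega>\<^sub>1 R s) (exp_weight r (1 / (2 * s)) :: nat ^ 'd::finite \<Rightarrow> real)"
proof (cases "s < 1 / 2")
  case True
  let ?a = "1 / (2 * s)"
  define b where "b = ?a / (?a - 1)"
  have a: "?a > 1" using assms True by simp
  have "x / (x - 1) > 1" if "x > 1" for x :: real using that by (simp add: field_simps)
  from this[OF a] have b: "b > 1" by (simp only: b_def)
  \<comment> \<open>The solution of \<open>R * 2 powr b * (4 * r) powr b = 2 * r\<close>.\<close>
  define r where "r = (1 / (R * 2 powr (b + 1))) powr (1 / (b - 1)) / 4"
  have r: "r > 0" using assms by (simp add: r_def)
  have "(4 * r) powr (b - 1) = 1 / (R * 2 powr (b + 1))"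
    using b assms by (simp add: r_def powr_powr)
  moreover have "(4 * r) powr b = (4 * r) powr (b - 1) * (4 * r)"
    using r by (simp add: powr_diff)
  ultimately have "R * 2 powr b * (4 * r) powr b = 2 * r"
    using assms by (simp add: powr_add)
  then show ?thesis
    using coeff_bound_log_growth[OF assms(1) True refl r, of R] assms(2) r unfolding b_def by auto
next
  case False
  then have "s \<ge> 1 / 2" by simp
  from coeff_bound_gaussian[OF this refl assms(2)] show ?thesis
    using assms(2) by (intro exI[of _ "R / 2"]) simp
qed

lemma ex_coefficient_weight_series_bound:
  assumes "s > 0" "s \<noteq> 1 / 2" "R > 0"
  shows "\<exists>r>0. series_bound (exp_weight r (1 / (2 * s)) :: nat ^ 'd::finite \<Rightarrow> real) (\<omega>\<^sub>1 R s)"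
proof (cases "s < 1 / 2")
  case True
  let ?a = "1 / (2 * s)"
  define r where "r = 2 * R powr (- (?a - 1))"
  have a: "?a > 1" using assms True by simp
  have r: "r > 0" using assms by (simp add: r_def)
  have "- x * (- 1 / x) = 1" if "x > 0" for x :: real using that by simp
  from this[of "?a - 1"] a have "- (?a - 1) * (- 1 / (?a - 1)) = 1" by (simp only: diff_gt_0_iff_gt)
  then have "(r / 2) powr (- 1 / (?a - 1)) = R"
    unfolding r_def using assms by (simp add: powr_powr)
  then have "series_bound (exp_weight r ?a :: nat ^ 'd \<Rightarrow> real) (\<omega>\<^sub>1 R s)"
    by (intro series_bound_log_growth[OF assms(1) True refl r]) simp
  then show ?thesis using r by blast
next
  case False
  then have s: "s > 1 / 2" using assms(2) by simp
  have "series_bound (exp_weight (2 * R * 2 powr (1 / (2 * s))) (1 / (2 * s)) :: nat ^ 'd \<Rightarrow> real) (\<omega>\<^sub>1 R s)"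
    by (rule series_bound_gaussian) (use s assms(3) in auto)
  moreover have "2 * R * 2 powr (1 / (2 * s)) > 0" using assms(3) by simp
  ultimately show ?thesis by blast
qed

lemma ex_growth_weight_coeff_bound:
  assumes "s > 0" "r > 0"
  shows "\<exists>R>0. coeff_bound (\<omega>\<^sub>1 R s) (exp_weight r (1 / (2 * s)) :: nat ^ 'd::finite \<Rightarrow> real)"
proof (cases "s < 1 / 2")
  case True
  let ?a = "1 / (2 * s)"
  define b where "b = ?a / (?a - 1)"
  define R where "R = 2 * r / (2 powr b * (4 * r) powr b)"
  have R: "R > 0" using assms by (simp add: R_def)
  have "R * 2 powr b * (4 * r) powr b \<le> 2 * r" using assms by (simp add: R_def)
  then show ?thesis
    using coeff_bound_log_growth[OF assms(1) True refl assms(2), of R] R unfolding b_def by auto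
next
  case False
  then have "s \<ge> 1 / 2" by simp
  from coeff_bound_gaussian[OF this refl, of "2 * r"] show ?thesis
    using assms(2) by (intro exI[of _ "2 * r"]) simp
qed

lemma A_topology_homeomorphism:
  assumes "p > 0" "s > 0"
  shows "extends_uniquely_to_homeomorphism
    (\<P> :: 'd::finite power_series \<Rightarrow> complex ^ 'd \<Rightarrow> complex) finite_series
    (A_topology p s) (bounded_some_topology s)"
proof -
  let ?a = "1 / (2 * s)"
  have A: "A_topology p s = inductive_limit_topology {0<..}
      (\<lambda>r. norm_topology (lp_space p s r :: 'd power_series set) (lp_weighted_norm p s r))"
    using assms by (simp add: A_topology_def lp_topology_\<theta>)
  show ?thesis
    unfolding A
  proof (rule inductive_limit_homeomorphism)
    fix r :: real assume "r \<in> {0<..}"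
    then have r: "r > 0" by simp
    show "quasi_norm (lp_space p s r :: 'd power_series set) (lp_weighted_norm p s r)"
      by (rule quasi_norm_lp_space[OF assms(1)])
    show "(\<lambda>_. 0) \<in> (lp_space p s r :: 'd power_series set)"
      using finite_series_subset_lp_space[OF assms r] by (auto simp: finite_series_def)
    obtain R where "R > 0" "series_bound (exp_weight r ?a) (\<omega>\<^sub>1 R s :: complex ^ 'd \<Rightarrow> real)"
      using ex_growth_weight_series_bound[OF assms(2) r] by blast
    then show "\<exists>u R. R > 0 \<and> dominated_by_norm (lp_space p s r) (lp_weighted_norm p s r) u \<and>
        (\<forall>\<alpha>. u \<alpha> \<le> 1) \<and> series_bound u (\<omega>\<^sub>1 R s :: complex ^ 'd \<Rightarrow> real)"
      using r by (intro exI[of _ "exp_weight r ?a"] exI[of _ R])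
        (simp add: dominated_by_lp_norm[OF assms(1)] exp_weight_le_1)
    show "\<exists>j\<in>{0<..}. truncations_converge (lp_space p s r :: 'd power_series set) (lp_space p s j) (lp_weighted_norm p s j)"
      using truncations_converge_lp_space[OF assms, of "r / 4"] r by (intro bexI[of _ "r / 4"]) auto
  next
    fix R :: real assume "R > 0"
    then obtain r where r: "r > 0" "coeff_bound (\<omega>\<^sub>1 R s) (exp_weight r ?a :: nat ^ 'd \<Rightarrow> real)"
      using ex_coefficient_weight_coeff_bound[OF assms(2)] by blast
    then show "\<exists>i\<in>{0<..}. \<exists>u :: nat ^ 'd \<Rightarrow> real. coeff_bound (\<omega>\<^sub>1 R s) u \<and>
        norm_dominated u (lp_space p s i) (lp_weighted_norm p s i)"
      using lp_norm_dominated[OF assms, of "r / 2"]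
      by (intro bexI[of _ "r / 2"] exI[of _ "exp_weight r ?a"]) auto
  next
    fix c c' :: "'d power_series" and x y
    assume "c \<in> (\<Union>i\<in>{0<..}. lp_space p s i)" "c' \<in> (\<Union>i\<in>{0<..}. lp_space p s i)"
    then obtain r1 r2 where r: "r1 > 0" "c \<in> lp_space p s r1" "r2 > 0" "c' \<in> lp_space p s r2" by auto
    have "(\<lambda>\<alpha>. x * c \<alpha> + y * c' \<alpha>) \<in> lp_space p s (min r1 r2 / 2)"
      by (rule lp_space_linear[OF assms _ _ _ r(2,4)]) (use r in auto)
    moreover have "min r1 r2 / 2 \<in> {0<..}" using r by simp
    ultimately show "(\<lambda>\<alpha>. x * c \<alpha> + y * c' \<alpha>) \<in> (\<Union>i\<in>{0<..}. lp_space p s i)" by blast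
  next
    have "(1::real) \<in> {0<..}" by simp
    then show "finite_series \<subseteq> (\<Union>i\<in>{0<..}. lp_space p s i :: 'd power_series set)"
      using finite_series_subset_lp_space[OF assms zero_less_one] by blast
  qed
qed

lemma A0_topology_homeomorphism:
  assumes "p > 0" "s > 0" "s \<noteq> 1 / 2"
  shows "extends_uniquely_to_homeomorphism
    (\<P> :: 'd::finite power_series \<Rightarrow> complex ^ 'd \<Rightarrow> complex) finite_series
    (A0_topology p s) (bounded_every_topology s)"
proof -
  let ?a = "1 / (2 * s)"
  have A: "A0_topology p s = projective_limit_topology {0<..}
      (\<lambda>r. norm_topology (lp_space p s r :: 'd power_series set) (lp_weighted_norm p s r))"
    by (simp add: A0_topology_def lp_topology_\<theta>)
  show ?thesis
    unfolding A
  proof (rule projective_limit_homeomorphism)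
    show "{0::real<..} \<noteq> {}" using greaterThan_iff[of "0::real" 1] zero_less_one by blast
    show "quasi_norm (lp_space p s r :: 'd power_series set) (lp_weighted_norm p s r)" for r
      by (rule quasi_norm_lp_space[OF assms(1)])
    fix c c' :: "'d power_series"
    assume c: "c \<in> (\<Inter>i\<in>{0<..}. lp_space p s i)" "c' \<in> (\<Inter>i\<in>{0<..}. lp_space p s i)"
    show "(\<lambda>\<alpha>. c \<alpha> - c' \<alpha>) \<in> (\<Inter>i\<in>{0<..}. lp_space p s i)"
    proof
      fix r :: real assume "r \<in> {0<..}"
      then have r: "r > 0" "2 * r \<in> {0<..}" by simp_all
      then have "c \<in> lp_space p s (2 * r)" "c' \<in> lp_space p s (2 * r)" using c by blast+
      from lp_space_linear[OF assms(1,2) r(1) order_refl order_refl this, of 1 "- 1"]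
      show "(\<lambda>\<alpha>. c \<alpha> - c' \<alpha>) \<in> lp_space p s r" by simp
    qed
  next
    fix R :: real assume "R > 0"
    then obtain r where "r > 0" "series_bound (exp_weight r ?a) (\<omega>\<^sub>1 R s :: complex ^ 'd \<Rightarrow> real)"
      using ex_coefficient_weight_series_bound[OF assms(2,3)] by blast
    then show "\<exists>i\<in>{0<..}. \<exists>u. dominated_by_norm (lp_space p s i) (lp_weighted_norm p s i) u \<and>
        (\<forall>\<alpha>. u \<alpha> \<le> 1) \<and> series_bound u (\<omega>\<^sub>1 R s :: complex ^ 'd \<Rightarrow> real)"
      by (intro bexI[of _ r] exI[of _ "exp_weight r ?a"])
        (simp_all add: dominated_by_lp_norm[OF assms(1)] exp_weight_le_1)
  next
    fix r :: real assume "r \<in> {0<..}"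
    then have r: "r > 0" by simp
    then obtain R where "R > 0" "coeff_bound (\<omega>\<^sub>1 R s) (exp_weight (2 * r) ?a :: nat ^ 'd \<Rightarrow> real)"
      using ex_growth_weight_coeff_bound[OF assms(2), of "2 * r"] by auto
    then show "\<exists>(u :: nat ^ 'd \<Rightarrow> real) R. R > 0 \<and> coeff_bound (\<omega>\<^sub>1 R s) u \<and>
        norm_dominated u (lp_space p s r) (lp_weighted_norm p s r)"
      using lp_norm_dominated[OF assms(1,2) r] by blast
    have "4 * r \<in> {0<..}" using r by simp
    then have "(\<Inter>i\<in>{0<..}. lp_space p s i) \<subseteq> (lp_space p s (4 * r) :: 'd power_series set)" by (rule INT_lower)
    then show "truncations_converge (\<Inter>i\<in>{0<..}. lp_space p s i :: 'd power_series set) (lp_space p s r) (lp_weighted_norm p s r)"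
      using truncations_converge_lp_space[OF assms(1,2) r] unfolding truncations_converge_def by blast
  next
    show "finite_series \<subseteq> (\<Inter>i\<in>{0<..}. lp_space p s i :: 'd power_series set)"
      using finite_series_subset_lp_space[OF assms(1,2)] by (intro INT_greatest) simp
  qed
qed

text \<open>
  The case \<open>s = 0\<close>: the target consists of the polynomials, and the supremum over all multi-indices is
  finite because only finitely many terms differ from 0.
\<close>

lemma finite_series_homeomorphism:
  "extends_uniquely_to_homeomorphism
    (\<P> :: 'd::finite power_series \<Rightarrow> complex ^ 'd \<Rightarrow> complex) finite_series
    finite_series_topology (bounded_some_topology 0)"
proof -
  let ?X = "\<lambda>n. {c. \<forall>\<alpha>. mi_size \<alpha> > n \<longrightarrow> c \<alpha> = 0} :: 'd power_series set"
  let ?N = "\<lambda>c. SUP \<alpha> :: nat ^ 'd. norm (c \<alpha> :: complex)"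
  have bdd: "bdd_above (range (\<lambda>\<alpha>. norm (c \<alpha>)))" if c: "c \<in> ?X n" for c n
  proof -
    have "range (\<lambda>\<alpha>. norm (c \<alpha>)) \<subseteq> insert 0 ((\<lambda>\<alpha>. norm (c \<alpha>)) ` {\<alpha>. mi_size \<alpha> \<le> n})"
    proof (rule image_subsetI)
      fix \<alpha>
      show "norm (c \<alpha>) \<in> insert 0 ((\<lambda>\<alpha>. norm (c \<alpha>)) ` {\<alpha>. mi_size \<alpha> \<le> n})"
        using c by (cases "mi_size \<alpha> \<le> n") auto
    qed
    then have "finite (range (\<lambda>\<alpha>. norm (c \<alpha>)))"
      by (rule finite_subset) (intro finite.insertI finite_imageI finite_mi_size_le)
    then show ?thesis by (rule bdd_above_finite)
  qed
  show ?thesis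
    unfolding finite_series_topology_def
  proof (rule inductive_limit_homeomorphism)
    fix n :: nat
    show "quasi_norm (?X n) ?N"
      using quasi_norm_SUP[of "\<lambda>_. 1" "?X n"] bdd by simp
    show "(\<lambda>_. 0) \<in> ?X n" by simp
    have "dominated_by_norm (?X n) ?N (degree_cutoff n)"
      unfolding dominated_by_norm_def
    proof (intro exI[of _ 1] conjI ballI allI)
      fix c \<alpha> assume c: "c \<in> ?X n"
      have up: "norm (c \<alpha>) \<le> ?N c" for \<alpha> by (rule cSUP_upper[OF UNIV_I bdd[OF c]])
      then show "0 \<le> ?N c" using norm_ge_zero order_trans by blast
      show "norm (c \<alpha>) \<le> 1 * ?N c * degree_cutoff n \<alpha>"
        using up[of \<alpha>] c by (simp add: degree_cutoff_def)
    qed simp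
    moreover have "series_bound (degree_cutoff n) (\<omega>\<^sub>1 (real n + 1) 0 :: complex ^ 'd \<Rightarrow> real)"
      by (rule series_bound_polynomial) simp
    ultimately show "\<exists>u R. R > 0 \<and> dominated_by_norm (?X n) ?N u \<and> (\<forall>\<alpha>. u \<alpha> \<le> 1) \<and>
        series_bound u (\<omega>\<^sub>1 R 0 :: complex ^ 'd \<Rightarrow> real)"
      by (intro exI[of _ "degree_cutoff n"] exI[of _ "real n + 1"]) (simp add: degree_cutoff_def)
    have "(\<lambda>m. ?N (\<lambda>\<alpha>. truncate_degree m c \<alpha> - c \<alpha>)) \<longlonglongrightarrow> 0" if c: "c \<in> ?X n" for c
    proof (rule tendsto_eventually)
      have "?N (\<lambda>\<alpha>. truncate_degree m c \<alpha> - c \<alpha>) = 0" if "m \<ge> n" for m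
      proof -
        have "truncate_degree m c \<alpha> - c \<alpha> = 0" for \<alpha>
          using c that by (auto simp: truncate_degree_def)
        then show ?thesis by simp
      qed
      then show "\<forall>\<^sub>F m in sequentially. ?N (\<lambda>\<alpha>. truncate_degree m c \<alpha> - c \<alpha>) = 0"
        unfolding eventually_sequentially by blast
    qed
    then show "\<exists>j\<in>UNIV. truncations_converge (?X n) (?X j) ?N"
      unfolding truncations_converge_def by (intro bexI[of _ n]) (auto simp: truncate_degree_def)
  next
    fix R :: real assume R: "R > 0"
    \<comment> \<open>A function bounded by \<open>\<langle>z\<rangle> powr R\<close> is a polynomial of degree at most \<open>R\<close>.\<close>
    define n where "n = nat \<lceil>R\<rceil>"
    have n: "R \<le> real n" unfolding n_def by linarith
    have "norm_dominated (degree_cutoff n) (?X n) ?N"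
      unfolding norm_dominated_def
    proof (intro exI[of _ 1] conjI allI impI)
      fix c :: "'d power_series" and K :: real
      assume K: "0 \<le> K" and c: "\<forall>\<alpha>. norm (c \<alpha>) \<le> K * degree_cutoff n \<alpha>"
      show "c \<in> ?X n"
      proof (intro CollectI allI impI)
        fix \<alpha> :: "nat ^ 'd" assume "n < mi_size \<alpha>"
        then show "c \<alpha> = 0" using c[rule_format, of \<alpha>] by (simp add: degree_cutoff_def)
      qed
      show "?N c \<le> 1 * K"
      proof (rule cSUP_least)
        fix \<alpha>
        show "norm (c \<alpha>) \<le> 1 * K"
          using c[rule_format, of \<alpha>] K by (simp add: degree_cutoff_def split: if_splits)
      qed simp
    qed simp
    moreover have "coeff_bound (\<omega>\<^sub>1 R 0) (degree_cutoff n :: nat ^ 'd \<Rightarrow> real)"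
      by (rule coeff_bound_polynomial) (use R n in simp_all)
    ultimately show "\<exists>i\<in>UNIV. \<exists>u :: nat ^ 'd \<Rightarrow> real. coeff_bound (\<omega>\<^sub>1 R 0) u \<and> norm_dominated u (?X i) ?N"
      by blast
  next
    fix c c' :: "'d power_series" and x y
    assume "c \<in> (\<Union>n\<in>UNIV. ?X n)" "c' \<in> (\<Union>n\<in>UNIV. ?X n)"
    then obtain n m where "c \<in> ?X n" "c' \<in> ?X m" by blast
    then have "(\<lambda>\<alpha>. x * c \<alpha> + y * c' \<alpha>) \<in> ?X (max n m)" by simp
    then show "(\<lambda>\<alpha>. x * c \<alpha> + y * c' \<alpha>) \<in> (\<Union>n\<in>UNIV. ?X n)" by blast
  next
    show "finite_series \<subseteq> (\<Union>n\<in>UNIV. ?X n)"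
    proof
      fix c :: "'d power_series" assume "c \<in> finite_series"
      then have fin: "finite (mi_size ` {\<alpha>. c \<alpha> \<noteq> 0})" by (simp add: finite_series_def)
      have "c \<alpha> = 0" if "mi_size \<alpha> > Max (insert 0 (mi_size ` {\<alpha>. c \<alpha> \<noteq> 0}))" for \<alpha>
      proof (rule ccontr)
        assume "c \<alpha> \<noteq> 0"
        then have "mi_size \<alpha> \<le> Max (insert 0 (mi_size ` {\<alpha>. c \<alpha> \<noteq> 0}))"
          using fin by (intro Max_ge) auto
        with that show False by simp
      qed
      then show "c \<in> (\<Union>n\<in>UNIV. ?X n)" by blast
    qed
  qed
qed

theorem theorem5p3:
  fixes s :: real and p :: ennreal
  assumes "s \<ge> 0" and "p > 0"
  shows "extends_uniquely_to_homeomorphism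
           (\<P> :: 'd::finite power_series \<Rightarrow> complex ^ 'd \<Rightarrow> complex) finite_series
           (A_topology p s) (bounded_some_topology s) \<and>
         (s \<notin> {0, 1/2} \<longrightarrow>
           extends_uniquely_to_homeomorphism
             (\<P> :: 'd power_series \<Rightarrow> complex ^ 'd \<Rightarrow> complex) finite_series
             (A0_topology p s) (bounded_every_topology s))"
proof (cases "s = 0")
  case True
  then show ?thesis using finite_series_homeomorphism by (simp add: A_topology_def)
next
  case False
  then have "s > 0" using assms by simp
  with assms show ?thesis
    by (intro conjI impI A_topology_homeomorphism A0_topology_homeomorphism) simp_all
qed

end
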